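(* Let $G$ be a smooth Hausdorff étale groupoid with compact Hausdorff $G_0$. The Hopf algebroid $C_c^\infty(G)$ over $C^\infty(G_0)$ becomes a Hopf $*$-algebroid with $*$-structures $$u^*(g)=\overline{u(g^{-1})}\ \text{ for }u\in C_c^\infty(G),\qquad f^*(x)=\overline{f(x)}\ \text{ for }f\in C^\infty(G_0).$$
   Context: An étale groupoid $G$ (arrows $G=G_1$, objects $G_0$, source $s$, target $t$, units $1_x$; $gh$ defined when $s(g)=t(h)$) is a smooth groupoid whose source map is a local diffeomorphism. The following is a Hopf algebroid structure on $C_c^\infty(G)$ (compactly supported smooth complex functions) with $A_l=A_r=C^\infty(G_0)$. Product: $(u*v)(g)=\sum_{g=g_1g_2}u(g_1)v(g_2)$. All source and target maps: $s_l=t_l=s_r=t_r$ is the inclusion of $C^\infty(G_0)$ as functions supported on units, $f\mapsto\bar f$ with $\bar f(1_x)=f(x)$ and $\bar f=0$ off the units; so $(f*u)(g)=f(t(g))u(g)$, $(u*f)(g)=u(g)f(s(g))$. Coproducts: $\Delta_l:C_c^\infty(G)\to C_c^\infty(G\,{}^t\!\times^t_{G_0}G)\cong C_c^\infty(G)\otimes^{ll}_{C^\infty(G_0)}C_c^\infty(G)$ and $\Delta_r:C_c^\infty(G)\to C_c^\infty(G\,{}^s\!\times^s_{G_0}G)\cong C_c^\infty(G)\otimes^{rr}_{C^\infty(G_0)}C_c^\infty(G)$, both given by $(\Delta u)(g,g')=u(g)$ if $g=g'$ and $0$ otherwise; here $\otimes^{ll}$, $\otimes^{rr}$ are the tensor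 products with respect to left, resp. right, multiplication actions of $C^\infty(G_0)$, and the isomorphisms are $u\otimes u'\mapsto((g,g')\mapsto u(g)u'(g'))$. Counits: $(\varepsilon_lu)(x)=\sum_{t(g)=x}u(g)$, $(\varepsilon_ru)(x)=\sum_{s(g)=x}u(g)$. Antipode: $(Su)(g)=u(g^{-1})$. A Hopf $*$-algebroid is a Hopf algebroid (left bialgebroid $(H,A_l,s_l,t_l,\Delta_l,\varepsilon_l)$, right bialgebroid $(H,A_r,s_r,t_r,\Delta_r,\varepsilon_r)$, antipode $S$) such that $H,A_l,A_r$ are $*$-algebras, $s_l$ and $s_r$ are $*$-preserving, $\varepsilon_lt_r(a^* )=(\varepsilon_ls_r(a))^*$ for $a\in A_r$, $\varepsilon_rt_l(a^* )=(\varepsilon_rs_l(a))^*$ for $a\in A_l$, and $\Delta_r(h^* )=(h_{(1)})^*\otimes(h_{(2)})^*$ for all $h\in H$, where $\Delta_l(h)=h_{(1)}\otimes h_{(2)}$. *)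

theory Defs
  imports "HOL-Analysis.Analysis" "HOL-Algebra.Algebra" "HOL-Algebra.Algebraic_Closure_Type"
begin

section \<open>Smooth manifolds\<close>

text \<open>Smoothness on an \<^emph>\<open>open\<close> subset of a Euclidean space: all iterated directional derivatives
  exist and are continuous.\<close>

primrec Ck_on :: "nat \<Rightarrow> 'e::real_normed_vector set \<Rightarrow> ('e \<Rightarrow> 'f::real_normed_vector) \<Rightarrow> bool" where
  "Ck_on 0 U f \<longleftrightarrow> continuous_on U f"
| "Ck_on (Suc k) U f \<longleftrightarrow>
     (\<forall>x\<in>U. f differentiable (at x)) \<and> (\<forall>v. Ck_on k U (\<lambda>x. frechet_derivative f (at x) v))"

definition smooth_on :: "'e::real_normed_vector set \<Rightarrow> ('e \<Rightarrow> 'f::real_normed_vector) \<Rightarrow> bool" where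
  "smooth_on U f \<longleftrightarrow> (\<forall>k. Ck_on k U f)"

type_synonym ('m, 'e) atlas = "('m set \<times> ('m \<Rightarrow> 'e)) set"

text \<open>The model space is a finite-dimensional real inner product space, given as a type. The class
  \<^class>\<open>euclidean_space\<close> is not used because it excludes dimension \<open>0\<close>, and with it the discrete
  groupoids.\<close>

definition smooth_atlas :: "('m::topological_space, 'e::real_inner) atlas \<Rightarrow> bool" where
  "smooth_atlas A \<longleftrightarrow>
     (\<exists>B :: 'e set. finite B \<and> Real_Vector_Spaces.span B = UNIV) \<and>
     (\<Union>(U, \<phi>)\<in>A. U) = UNIV \<and>
     (\<forall>(U, \<phi>)\<in>A. open U \<and> open (\<phi> ` U) \<and> (\<exists>\<psi>. homeomorphism U (\<phi> ` U) \<phi> \<psi>)) \<and>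
     (\<forall>(U, \<phi>)\<in>A. \<forall>(V, \<psi>)\<in>A. smooth_on (\<phi> ` (U \<inter> V)) (\<psi> \<circ> the_inv_into U \<phi>))"

definition prod_atlas :: "('m, 'e) atlas \<Rightarrow> ('n, 'f) atlas \<Rightarrow> ('m \<times> 'n, 'e \<times> 'f) atlas" where
  "prod_atlas A B = {(U \<times> V, map_prod \<phi> \<psi>) | U \<phi> V \<psi>. (U, \<phi>) \<in> A \<and> (V, \<psi>) \<in> B}"

text \<open>A map on an arbitrary subset \<open>S\<close> is smooth if in charts it extends, locally around every point
  of \<open>S\<close>, to a smooth map. For open \<open>S\<close> this is ordinary smoothness, and for an embedded
  submanifold \<open>S\<close> it is smoothness for the induced manifold structure.\<close>

definition smooth_map_on ::
  "('m::topological_space, 'e::real_normed_vector) atlas \<Rightarrow> ('n, 'f::real_normed_vector) atlas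
     \<Rightarrow> 'm set \<Rightarrow> ('m \<Rightarrow> 'n) \<Rightarrow> bool" where
  "smooth_map_on A B S f \<longleftrightarrow>
     (\<forall>p\<in>S. \<exists>(U, \<phi>)\<in>A. \<exists>(V, \<psi>)\<in>B. \<exists>W F. open W \<and> p \<in> W \<and> W \<subseteq> U \<and> smooth_on (\<phi> ` W) F \<and>
        (\<forall>q \<in> W \<inter> S. f q \<in> V \<and> \<psi> (f q) = F (\<phi> q)))"

definition local_diffeo ::
  "('m::topological_space, 'e::real_normed_vector) atlas
     \<Rightarrow> ('n::topological_space, 'f::real_normed_vector) atlas \<Rightarrow> ('m \<Rightarrow> 'n) \<Rightarrow> bool" where
  "local_diffeo A B f \<longleftrightarrow>
     (\<forall>p. \<exists>U. open U \<and> p \<in> U \<and> inj_on f U \<and> open (f ` U) \<and>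
        smooth_map_on A B U f \<and> smooth_map_on B A (f ` U) (the_inv_into U f))"

definition smooth_complex :: "('m::topological_space, 'e::real_normed_vector) atlas \<Rightarrow> ('m \<Rightarrow> complex) \<Rightarrow> bool" where
  "smooth_complex A u \<longleftrightarrow> smooth_map_on A {(UNIV, id)} UNIV u"


section \<open>Smooth etale groupoids\<close>

text \<open>The types \<open>'g\<close> and \<open>'x\<close> are the spaces of arrows and objects. The product
  \<open>gmul G g h\<close> is meaningful only when \<open>src G g = tgt G h\<close>.\<close>

record ('g, 'x, 'e) smooth_groupoid =
  arr_atlas :: "('g, 'e) atlas"
  obj_atlas :: "('x, 'e) atlas"
  src :: "'g \<Rightarrow> 'x"
  tgt :: "'g \<Rightarrow> 'x"
  idn :: "'x \<Rightarrow> 'g"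
  ginv :: "'g \<Rightarrow> 'g"
  gmul :: "'g \<Rightarrow> 'g \<Rightarrow> 'g"

locale hausdorff_etale_groupoid =
  fixes G :: "('g::t2_space, 'x::t2_space, 'e::real_inner) smooth_groupoid"
  assumes src_idn: "src G (idn G x) = x"
    and tgt_idn: "tgt G (idn G x) = x"
    and src_gmul: "src G g = tgt G h \<Longrightarrow> src G (gmul G g h) = src G h"
    and tgt_gmul: "src G g = tgt G h \<Longrightarrow> tgt G (gmul G g h) = tgt G g"
    and gmul_assoc: "src G g = tgt G h \<Longrightarrow> src G h = tgt G k \<Longrightarrow>
          gmul G (gmul G g h) k = gmul G g (gmul G h k)"
    and idn_left: "gmul G (idn G (tgt G g)) g = g"
    and idn_right: "gmul G g (idn G (src G g)) = g"
    and src_ginv: "src G (ginv G g) = tgt G g"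
    and tgt_ginv: "tgt G (ginv G g) = src G g"
    and ginv_right: "gmul G g (ginv G g) = idn G (tgt G g)"
    and ginv_left: "gmul G (ginv G g) g = idn G (src G g)"
    and arr_manifold: "smooth_atlas (arr_atlas G)"
    and obj_manifold: "smooth_atlas (obj_atlas G)"
    and src_smooth: "smooth_map_on (arr_atlas G) (obj_atlas G) UNIV (src G)"
    and tgt_smooth: "smooth_map_on (arr_atlas G) (obj_atlas G) UNIV (tgt G)"
    and idn_smooth: "smooth_map_on (obj_atlas G) (arr_atlas G) UNIV (idn G)"
    and ginv_smooth: "smooth_map_on (arr_atlas G) (arr_atlas G) UNIV (ginv G)"
    and gmul_smooth: "smooth_map_on (prod_atlas (arr_atlas G) (arr_atlas G)) (arr_atlas G)
          {(g, h). src G g = tgt G h} (\<lambda>(g, h). gmul G g h)"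
    and src_etale: "local_diffeo (arr_atlas G) (obj_atlas G) (src G)"


section \<open>Complex algebras and *-algebras\<close>

locale complex_algebra = ring H + module "ring_of_type_algebra :: complex ring" H
  for H :: "(complex, 'h) module" +
  assumes smult_mult_left: "x \<in> carrier H \<Longrightarrow> y \<in> carrier H \<Longrightarrow>
            (c \<odot>\<^bsub>H\<^esub> x) \<otimes>\<^bsub>H\<^esub> y = c \<odot>\<^bsub>H\<^esub> (x \<otimes>\<^bsub>H\<^esub> y)"
    and smult_mult_right: "x \<in> carrier H \<Longrightarrow> y \<in> carrier H \<Longrightarrow>
            x \<otimes>\<^bsub>H\<^esub> (c \<odot>\<^bsub>H\<^esub> y) = c \<odot>\<^bsub>H\<^esub> (x \<otimes>\<^bsub>H\<^esub> y)"

definition complex_algebra_hom :: "(complex, 'a) module \<Rightarrow> (complex, 'h) module \<Rightarrow> ('a \<Rightarrow> 'h) set" where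
  "complex_algebra_hom A H =
     {f \<in> ring_hom A H. \<forall>c. \<forall>a\<in>carrier A. f (c \<odot>\<^bsub>A\<^esub> a) = c \<odot>\<^bsub>H\<^esub> f a}"

definition opposite_algebra :: "(complex, 'a) module \<Rightarrow> (complex, 'a) module" where
  "opposite_algebra A = A\<lparr>mult := (\<lambda>x y. y \<otimes>\<^bsub>A\<^esub> x)\<rparr>"

locale star_algebra = complex_algebra H for H :: "(complex, 'h) module" +
  fixes star :: "'h \<Rightarrow> 'h"
  assumes star_closed: "x \<in> carrier H \<Longrightarrow> star x \<in> carrier H"
    and star_add: "x \<in> carrier H \<Longrightarrow> y \<in> carrier H \<Longrightarrow> star (x \<oplus>\<^bsub>H\<^esub> y) = star x \<oplus>\<^bsub>H\<^esub> star y"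
    and star_smult: "x \<in> carrier H \<Longrightarrow> star (c \<odot>\<^bsub>H\<^esub> x) = cnj c \<odot>\<^bsub>H\<^esub> star x"
    and star_mult: "x \<in> carrier H \<Longrightarrow> y \<in> carrier H \<Longrightarrow> star (x \<otimes>\<^bsub>H\<^esub> y) = star y \<otimes>\<^bsub>H\<^esub> star x"
    and star_star: "x \<in> carrier H \<Longrightarrow> star (star x) = x"


section \<open>Balanced tensor powers\<close>

text \<open>A list \<open>Bs = [B\<^sub>1, \<dots>, B\<^sub>n]\<close> of sets of pairs of endomaps of \<open>H\<close> determines the tensor product
  \<open>H \<otimes> H \<otimes> \<dots> \<otimes> H\<close> with \<open>n + 1\<close> factors, in which the \<open>i\<close>-th tensor sign is balanced by
  \<open>r x \<otimes> y = x \<otimes> l y\<close> for all \<open>(r, l) \<in> B\<^sub>i\<close>. A word \<open>[h\<^sub>0, \<dots>, h\<^sub>n]\<close> stands for the pure tensor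
  \<open>h\<^sub>0 \<otimes> \<dots> \<otimes> h\<^sub>n\<close>, and the tensor product is the free abelian group on words modulo multilinearity
  and balancing. Its elements are cosets; the members of a coset are the ways of writing
  a tensor as a formal integer combination of pure tensors.\<close>

type_synonym 'h balancing = "(('h \<Rightarrow> 'h) \<times> ('h \<Rightarrow> 'h)) set"

type_synonym 'h formal_tensor = "'h list \<Rightarrow>\<^sub>0 int"

definition tensor_words :: "('h, 'm) ring_scheme \<Rightarrow> 'h balancing list \<Rightarrow> 'h list set" where
  "tensor_words H Bs = {w. length w = Suc (length Bs) \<and> set w \<subseteq> carrier H}"

definition tensor_relators :: "('h, 'm) ring_scheme \<Rightarrow> 'h balancing list \<Rightarrow> 'h formal_tensor set" where
  "tensor_relators H Bs =
     {frag_of (xs @ (x \<oplus>\<^bsub>H\<^esub> y) # ys) - frag_of (xs @ x # ys) - frag_of (xs @ y # ys) | xs x y ys.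
        xs @ x # ys \<in> tensor_words H Bs \<and> y \<in> carrier H} \<union>
     {frag_of (xs @ r x # y # ys) - frag_of (xs @ x # l y # ys) | xs r l x y ys.
        xs @ x # y # ys \<in> tensor_words H Bs \<and> (r, l) \<in> Bs ! length xs}"

definition tensor_null :: "('h, 'm) ring_scheme \<Rightarrow> 'h balancing list \<Rightarrow> 'h formal_tensor set" where
  "tensor_null H Bs = generate (free_Abelian_group (tensor_words H Bs)) (tensor_relators H Bs)"

definition tensor_product ::
  "('h, 'm) ring_scheme \<Rightarrow> 'h balancing list \<Rightarrow> 'h formal_tensor set monoid" where
  "tensor_product H Bs = free_Abelian_group (tensor_words H Bs) Mod tensor_null H Bs"

definition tensor_class ::
  "('h, 'm) ring_scheme \<Rightarrow> 'h balancing list \<Rightarrow> 'h formal_tensor \<Rightarrow> 'h formal_tensor set" where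
  "tensor_class H Bs p = tensor_null H Bs #>\<^bsub>free_Abelian_group (tensor_words H Bs)\<^esub> p"

text \<open>For a representative \<open>\<Sum> h\<^sub>0 \<otimes> \<dots> \<otimes> h\<^sub>n\<close>, the element \<open>\<Sum> f [h\<^sub>0, \<dots>, h\<^sub>n]\<close> of \<open>H\<close>.\<close>

definition tensor_eval :: "('h, 'm) ring_scheme \<Rightarrow> ('h list \<Rightarrow> 'h) \<Rightarrow> 'h formal_tensor \<Rightarrow> 'h" where
  "tensor_eval H f p = (\<Oplus>\<^bsub>H\<^esub>w\<in>Poly_Mapping.keys p. [Poly_Mapping.lookup p w] \<cdot>\<^bsub>H\<^esub> f w)"

text \<open>For a representative \<open>\<Sum> h\<^sub>0 \<otimes> h\<^sub>1\<close>, the formal tensors \<open>\<Sum> D h\<^sub>0 \<otimes> h\<^sub>1\<close> and \<open>\<Sum> h\<^sub>0 \<otimes> D h\<^sub>1\<close>,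
  where \<open>D h\<close> is a representative of a coproduct of \<open>h\<close>.\<close>

definition apply_first :: "('h \<Rightarrow> 'h formal_tensor) \<Rightarrow> 'h formal_tensor \<Rightarrow> 'h formal_tensor" where
  "apply_first D = frag_extend (\<lambda>w. frag_extend (\<lambda>v. frag_of (v @ [w ! 1])) (D (w ! 0)))"

definition apply_second :: "('h \<Rightarrow> 'h formal_tensor) \<Rightarrow> 'h formal_tensor \<Rightarrow> 'h formal_tensor" where
  "apply_second D = frag_extend (\<lambda>w. frag_extend (\<lambda>v. frag_of (w ! 0 # v)) (D (w ! 1)))"

text \<open>\<open>(\<Delta>\<^sub>1 \<otimes> id) \<Delta>\<^sub>2 = (id \<otimes> \<Delta>\<^sub>3) \<Delta>\<^sub>4\<close> in \<open>H \<otimes> H \<otimes> H\<close> balanced by \<open>Bs\<close>, for all choices of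
  representatives.\<close>

definition coassociative ::
  "('h, 'm) ring_scheme \<Rightarrow> 'h balancing list \<Rightarrow> ('h \<Rightarrow> 'h formal_tensor set) \<Rightarrow> ('h \<Rightarrow> 'h formal_tensor set)
     \<Rightarrow> ('h \<Rightarrow> 'h formal_tensor set) \<Rightarrow> ('h \<Rightarrow> 'h formal_tensor set) \<Rightarrow> bool" where
  "coassociative H Bs \<Delta>\<^sub>1 \<Delta>\<^sub>2 \<Delta>\<^sub>3 \<Delta>\<^sub>4 \<longleftrightarrow>
     (\<forall>h\<in>carrier H. \<forall>p\<in>\<Delta>\<^sub>2 h. \<forall>q\<in>\<Delta>\<^sub>4 h. \<forall>D E.
        (\<forall>x\<in>carrier H. D x \<in> \<Delta>\<^sub>1 x) \<and> (\<forall>x\<in>carrier H. E x \<in> \<Delta>\<^sub>3 x) \<longrightarrow>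
        tensor_class H Bs (apply_first D p) = tensor_class H Bs (apply_second E q))"


section \<open>Bialgebroids\<close>

text \<open>The tensor product \<open>H \<otimes> H\<close> of a left bialgebroid is formed with respect to the bimodule structure
  \<open>a \<cdot> h \<cdot> b = s a * t b * h\<close>.\<close>

definition left_balancing ::
  "('h, 'm) ring_scheme \<Rightarrow> ('a, 'n) ring_scheme \<Rightarrow> ('a \<Rightarrow> 'h) \<Rightarrow> ('a \<Rightarrow> 'h) \<Rightarrow> 'h balancing" where
  "left_balancing H A s t = {(\<lambda>h. t a \<otimes>\<^bsub>H\<^esub> h, \<lambda>h. s a \<otimes>\<^bsub>H\<^esub> h) | a. a \<in> carrier A}"

locale left_bialgebroid =
  H: complex_algebra H + A: complex_algebra A
  for H :: "(complex, 'h) module" and A :: "(complex, 'a) module" +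
  fixes s t :: "'a \<Rightarrow> 'h" and \<Delta> :: "'h \<Rightarrow> 'h formal_tensor set" and \<epsilon> :: "'h \<Rightarrow> 'a"
  assumes source_hom: "s \<in> complex_algebra_hom A H"
    and target_hom: "t \<in> complex_algebra_hom (opposite_algebra A) H"
    and source_target_commute: "a \<in> carrier A \<Longrightarrow> b \<in> carrier A \<Longrightarrow> s a \<otimes>\<^bsub>H\<^esub> t b = t b \<otimes>\<^bsub>H\<^esub> s a"
    and coproduct_additive: "\<Delta> \<in> hom (add_monoid H) (tensor_product H [left_balancing H A s t])"
    and coproduct_bimodule: "h \<in> carrier H \<Longrightarrow> a \<in> carrier A \<Longrightarrow> b \<in> carrier A \<Longrightarrow> p \<in> \<Delta> h \<Longrightarrow>
          \<Delta> (s a \<otimes>\<^bsub>H\<^esub> t b \<otimes>\<^bsub>H\<^esub> h) = tensor_class H [left_balancing H A s t]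
             (frag_extend (\<lambda>w. frag_of [s a \<otimes>\<^bsub>H\<^esub> w ! 0, t b \<otimes>\<^bsub>H\<^esub> w ! 1]) p)"
    and counit_closed: "h \<in> carrier H \<Longrightarrow> \<epsilon> h \<in> carrier A"
    and counit_additive: "h \<in> carrier H \<Longrightarrow> h' \<in> carrier H \<Longrightarrow> \<epsilon> (h \<oplus>\<^bsub>H\<^esub> h') = \<epsilon> h \<oplus>\<^bsub>A\<^esub> \<epsilon> h'"
    and counit_bimodule: "h \<in> carrier H \<Longrightarrow> a \<in> carrier A \<Longrightarrow> b \<in> carrier A \<Longrightarrow>
          \<epsilon> (s a \<otimes>\<^bsub>H\<^esub> t b \<otimes>\<^bsub>H\<^esub> h) = a \<otimes>\<^bsub>A\<^esub> \<epsilon> h \<otimes>\<^bsub>A\<^esub> b"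
    and coassociativity: "coassociative H [left_balancing H A s t, left_balancing H A s t] \<Delta> \<Delta> \<Delta> \<Delta>"
    and counit_left: "h \<in> carrier H \<Longrightarrow> p \<in> \<Delta> h \<Longrightarrow>
          tensor_eval H (\<lambda>w. s (\<epsilon> (w ! 0)) \<otimes>\<^bsub>H\<^esub> w ! 1) p = h"
    and counit_right: "h \<in> carrier H \<Longrightarrow> p \<in> \<Delta> h \<Longrightarrow>
          tensor_eval H (\<lambda>w. t (\<epsilon> (w ! 1)) \<otimes>\<^bsub>H\<^esub> w ! 0) p = h"
    and takeuchi: "h \<in> carrier H \<Longrightarrow> a \<in> carrier A \<Longrightarrow> p \<in> \<Delta> h \<Longrightarrow>
          tensor_class H [left_balancing H A s t] (frag_extend (\<lambda>w. frag_of [w ! 0 \<otimes>\<^bsub>H\<^esub> t a, w ! 1]) p) =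
          tensor_class H [left_balancing H A s t] (frag_extend (\<lambda>w. frag_of [w ! 0, w ! 1 \<otimes>\<^bsub>H\<^esub> s a]) p)"
    and coproduct_one: "\<Delta> \<one>\<^bsub>H\<^esub> = tensor_class H [left_balancing H A s t] (frag_of [\<one>\<^bsub>H\<^esub>, \<one>\<^bsub>H\<^esub>])"
    and coproduct_mult: "h \<in> carrier H \<Longrightarrow> h' \<in> carrier H \<Longrightarrow> p \<in> \<Delta> h \<Longrightarrow> p' \<in> \<Delta> h' \<Longrightarrow>
          \<Delta> (h \<otimes>\<^bsub>H\<^esub> h') = tensor_class H [left_balancing H A s t]
             (frag_extend (\<lambda>w. frag_extend (\<lambda>w'. frag_of [w ! 0 \<otimes>\<^bsub>H\<^esub> w' ! 0, w ! 1 \<otimes>\<^bsub>H\<^esub> w' ! 1]) p') p)"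
    and counit_one: "\<epsilon> \<one>\<^bsub>H\<^esub> = \<one>\<^bsub>A\<^esub>"
    and counit_mult_source: "h \<in> carrier H \<Longrightarrow> h' \<in> carrier H \<Longrightarrow>
          \<epsilon> (h \<otimes>\<^bsub>H\<^esub> s (\<epsilon> h')) = \<epsilon> (h \<otimes>\<^bsub>H\<^esub> h')"
    and counit_mult_target: "h \<in> carrier H \<Longrightarrow> h' \<in> carrier H \<Longrightarrow>
          \<epsilon> (h \<otimes>\<^bsub>H\<^esub> t (\<epsilon> h')) = \<epsilon> (h \<otimes>\<^bsub>H\<^esub> h')"

text \<open>For a right bialgebroid the bimodule structure is \<open>a \<cdot> h \<cdot> b = h * t a * s b\<close>.\<close>

definition right_balancing ::
  "('h, 'm) ring_scheme \<Rightarrow> ('a, 'n) ring_scheme \<Rightarrow> ('a \<Rightarrow> 'h) \<Rightarrow> ('a \<Rightarrow> 'h) \<Rightarrow> 'h balancing" where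
  "right_balancing H A s t = {(\<lambda>h. h \<otimes>\<^bsub>H\<^esub> s a, \<lambda>h. h \<otimes>\<^bsub>H\<^esub> t a) | a. a \<in> carrier A}"

locale right_bialgebroid =
  H: complex_algebra H + A: complex_algebra A
  for H :: "(complex, 'h) module" and A :: "(complex, 'a) module" +
  fixes s t :: "'a \<Rightarrow> 'h" and \<Delta> :: "'h \<Rightarrow> 'h formal_tensor set" and \<epsilon> :: "'h \<Rightarrow> 'a"
  assumes source_hom: "s \<in> complex_algebra_hom A H"
    and target_hom: "t \<in> complex_algebra_hom (opposite_algebra A) H"
    and source_target_commute: "a \<in> carrier A \<Longrightarrow> b \<in> carrier A \<Longrightarrow> s a \<otimes>\<^bsub>H\<^esub> t b = t b \<otimes>\<^bsub>H\<^esub> s a"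
    and coproduct_additive: "\<Delta> \<in> hom (add_monoid H) (tensor_product H [right_balancing H A s t])"
    and coproduct_bimodule: "h \<in> carrier H \<Longrightarrow> a \<in> carrier A \<Longrightarrow> b \<in> carrier A \<Longrightarrow> p \<in> \<Delta> h \<Longrightarrow>
          \<Delta> (h \<otimes>\<^bsub>H\<^esub> t a \<otimes>\<^bsub>H\<^esub> s b) = tensor_class H [right_balancing H A s t]
             (frag_extend (\<lambda>w. frag_of [w ! 0 \<otimes>\<^bsub>H\<^esub> t a, w ! 1 \<otimes>\<^bsub>H\<^esub> s b]) p)"
    and counit_closed: "h \<in> carrier H \<Longrightarrow> \<epsilon> h \<in> carrier A"
    and counit_additive: "h \<in> carrier H \<Longrightarrow> h' \<in> carrier H \<Longrightarrow> \<epsilon> (h \<oplus>\<^bsub>H\<^esub> h') = \<epsilon> h \<oplus>\<^bsub>A\<^esub> \<epsilon> h'"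
    and counit_bimodule: "h \<in> carrier H \<Longrightarrow> a \<in> carrier A \<Longrightarrow> b \<in> carrier A \<Longrightarrow>
          \<epsilon> (h \<otimes>\<^bsub>H\<^esub> t a \<otimes>\<^bsub>H\<^esub> s b) = a \<otimes>\<^bsub>A\<^esub> \<epsilon> h \<otimes>\<^bsub>A\<^esub> b"
    and coassociativity: "coassociative H [right_balancing H A s t, right_balancing H A s t] \<Delta> \<Delta> \<Delta> \<Delta>"
    and counit_left: "h \<in> carrier H \<Longrightarrow> p \<in> \<Delta> h \<Longrightarrow>
          tensor_eval H (\<lambda>w. w ! 1 \<otimes>\<^bsub>H\<^esub> t (\<epsilon> (w ! 0))) p = h"
    and counit_right: "h \<in> carrier H \<Longrightarrow> p \<in> \<Delta> h \<Longrightarrow>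
          tensor_eval H (\<lambda>w. w ! 0 \<otimes>\<^bsub>H\<^esub> s (\<epsilon> (w ! 1))) p = h"
    and takeuchi: "h \<in> carrier H \<Longrightarrow> a \<in> carrier A \<Longrightarrow> p \<in> \<Delta> h \<Longrightarrow>
          tensor_class H [right_balancing H A s t] (frag_extend (\<lambda>w. frag_of [s a \<otimes>\<^bsub>H\<^esub> w ! 0, w ! 1]) p) =
          tensor_class H [right_balancing H A s t] (frag_extend (\<lambda>w. frag_of [w ! 0, t a \<otimes>\<^bsub>H\<^esub> w ! 1]) p)"
    and coproduct_one: "\<Delta> \<one>\<^bsub>H\<^esub> = tensor_class H [right_balancing H A s t] (frag_of [\<one>\<^bsub>H\<^esub>, \<one>\<^bsub>H\<^esub>])"
    and coproduct_mult: "h \<in> carrier H \<Longrightarrow> h' \<in> carrier H \<Longrightarrow> p \<in> \<Delta> h \<Longrightarrow> p' \<in> \<Delta> h' \<Longrightarrow>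
          \<Delta> (h \<otimes>\<^bsub>H\<^esub> h') = tensor_class H [right_balancing H A s t]
             (frag_extend (\<lambda>w. frag_extend (\<lambda>w'. frag_of [w ! 0 \<otimes>\<^bsub>H\<^esub> w' ! 0, w ! 1 \<otimes>\<^bsub>H\<^esub> w' ! 1]) p') p)"
    and counit_one: "\<epsilon> \<one>\<^bsub>H\<^esub> = \<one>\<^bsub>A\<^esub>"
    and counit_mult_source: "h \<in> carrier H \<Longrightarrow> h' \<in> carrier H \<Longrightarrow>
          \<epsilon> (s (\<epsilon> h) \<otimes>\<^bsub>H\<^esub> h') = \<epsilon> (h \<otimes>\<^bsub>H\<^esub> h')"
    and counit_mult_target: "h \<in> carrier H \<Longrightarrow> h' \<in> carrier H \<Longrightarrow>
          \<epsilon> (t (\<epsilon> h) \<otimes>\<^bsub>H\<^esub> h') = \<epsilon> (h \<otimes>\<^bsub>H\<^esub> h')"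


section \<open>Hopf algebroids\<close>

record ('h, 'a, 'b) hopf_data =
  total_alg :: "(complex, 'h) module"
  left_base :: "(complex, 'a) module"
  left_source :: "'a \<Rightarrow> 'h"
  left_target :: "'a \<Rightarrow> 'h"
  left_coproduct :: "'h \<Rightarrow> 'h formal_tensor set"
  left_counit :: "'h \<Rightarrow> 'a"
  right_base :: "(complex, 'b) module"
  right_source :: "'b \<Rightarrow> 'h"
  right_target :: "'b \<Rightarrow> 'h"
  right_coproduct :: "'h \<Rightarrow> 'h formal_tensor set"
  right_counit :: "'h \<Rightarrow> 'b"
  antipode :: "'h \<Rightarrow> 'h"

abbreviation left_bal :: "('h, 'a, 'b) hopf_data \<Rightarrow> 'h balancing" where
  "left_bal K \<equiv> left_balancing (total_alg K) (left_base K) (left_source K) (left_target K)"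

abbreviation right_bal :: "('h, 'a, 'b) hopf_data \<Rightarrow> 'h balancing" where
  "right_bal K \<equiv> right_balancing (total_alg K) (right_base K) (right_source K) (right_target K)"

text \<open>The axioms of Boehm and Szlachanyi, where the antipode is bijective.\<close>

locale hopf_algebroid =
  fixes K :: "('h, 'a, 'b) hopf_data"
  assumes left: "left_bialgebroid (total_alg K) (left_base K) (left_source K) (left_target K)
          (left_coproduct K) (left_counit K)"
    and right: "right_bialgebroid (total_alg K) (right_base K) (right_source K) (right_target K)
          (right_coproduct K) (right_counit K)"
    and source_l_counit_l: "b \<in> carrier (right_base K) \<Longrightarrow>
          left_source K (left_counit K (right_target K b)) = right_target K b"
    and target_l_counit_l: "b \<in> carrier (right_base K) \<Longrightarrow>
          left_target K (left_counit K (right_source K b)) = right_source K b"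
    and source_r_counit_r: "a \<in> carrier (left_base K) \<Longrightarrow>
          right_source K (right_counit K (left_target K a)) = left_target K a"
    and target_r_counit_r: "a \<in> carrier (left_base K) \<Longrightarrow>
          right_target K (right_counit K (left_source K a)) = left_source K a"
    and mixed_coassociativity_lr: "coassociative (total_alg K) [left_bal K, right_bal K]
          (left_coproduct K) (right_coproduct K) (right_coproduct K) (left_coproduct K)"
    and mixed_coassociativity_rl: "coassociative (total_alg K) [right_bal K, left_bal K]
          (right_coproduct K) (left_coproduct K) (left_coproduct K) (right_coproduct K)"
    and antipode_bij: "bij_betw (antipode K) (carrier (total_alg K)) (carrier (total_alg K))"
    and antipode_add: "h \<in> carrier (total_alg K) \<Longrightarrow> h' \<in> carrier (total_alg K) \<Longrightarrow>
          antipode K (h \<oplus>\<^bsub>total_alg K\<^esub> h') = antipode K h \<oplus>\<^bsub>total_alg K\<^esub> antipode K h'"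
    and antipode_smult: "h \<in> carrier (total_alg K) \<Longrightarrow>
          antipode K (c \<odot>\<^bsub>total_alg K\<^esub> h) = c \<odot>\<^bsub>total_alg K\<^esub> antipode K h"
    and antipode_target: "a \<in> carrier (left_base K) \<Longrightarrow> b \<in> carrier (right_base K) \<Longrightarrow>
          h \<in> carrier (total_alg K) \<Longrightarrow>
          antipode K (left_target K a \<otimes>\<^bsub>total_alg K\<^esub> h \<otimes>\<^bsub>total_alg K\<^esub> right_target K b) =
          right_source K b \<otimes>\<^bsub>total_alg K\<^esub> antipode K h \<otimes>\<^bsub>total_alg K\<^esub> left_source K a"
    and antipode_left: "h \<in> carrier (total_alg K) \<Longrightarrow> p \<in> left_coproduct K h \<Longrightarrow>
          tensor_eval (total_alg K) (\<lambda>w. antipode K (w ! 0) \<otimes>\<^bsub>total_alg K\<^esub> w ! 1) p =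
          right_source K (right_counit K h)"
    and antipode_right: "h \<in> carrier (total_alg K) \<Longrightarrow> p \<in> right_coproduct K h \<Longrightarrow>
          tensor_eval (total_alg K) (\<lambda>w. w ! 0 \<otimes>\<^bsub>total_alg K\<^esub> antipode K (w ! 1)) p =
          left_source K (left_counit K h)"

locale hopf_star_algebroid = hopf_algebroid K
  for K :: "('h, 'a, 'b) hopf_data" +
  fixes star :: "'h \<Rightarrow> 'h" and star_l :: "'a \<Rightarrow> 'a" and star_r :: "'b \<Rightarrow> 'b"
  assumes total_star: "star_algebra (total_alg K) star"
    and left_star: "star_algebra (left_base K) star_l"
    and right_star: "star_algebra (right_base K) star_r"
    and left_source_star: "a \<in> carrier (left_base K) \<Longrightarrow>
          left_source K (star_l a) = star (left_source K a)"
    and right_source_star: "b \<in> carrier (right_base K) \<Longrightarrow>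
          right_source K (star_r b) = star (right_source K b)"
    and left_counit_star: "b \<in> carrier (right_base K) \<Longrightarrow>
          left_counit K (right_target K (star_r b)) = star_l (left_counit K (right_source K b))"
    and right_counit_star: "a \<in> carrier (left_base K) \<Longrightarrow>
          right_counit K (left_target K (star_l a)) = star_r (right_counit K (left_source K a))"
    and coproduct_star: "h \<in> carrier (total_alg K) \<Longrightarrow> p \<in> left_coproduct K h \<Longrightarrow>
          right_coproduct K (star h) = tensor_class (total_alg K) [right_bal K]
             (frag_extend (\<lambda>w. frag_of [star (w ! 0), star (w ! 1)]) p)"


section \<open>The convolution Hopf algebroid\<close>

text \<open>All sums over arrows below have finitely many nonzero terms when the functions are compactly
  supported; the condition \<open>\<noteq> 0\<close> in the index set discards the others, since \<^const>\<open>sum\<close> is \<open>0\<close> on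
  infinite index sets.\<close>

definition convolution ::
  "('g, 'x, 'e) smooth_groupoid \<Rightarrow> ('g \<Rightarrow> complex) \<Rightarrow> ('g \<Rightarrow> complex) \<Rightarrow> 'g \<Rightarrow> complex" where
  "convolution G u v g =
     (\<Sum>(g\<^sub>1, g\<^sub>2) \<in> {(g\<^sub>1, g\<^sub>2). src G g\<^sub>1 = tgt G g\<^sub>2 \<and> gmul G g\<^sub>1 g\<^sub>2 = g \<and> u g\<^sub>1 * v g\<^sub>2 \<noteq> 0}. u g\<^sub>1 * v g\<^sub>2)"

definition unit_extension :: "('g, 'x, 'e) smooth_groupoid \<Rightarrow> ('x \<Rightarrow> complex) \<Rightarrow> 'g \<Rightarrow> complex" where
  "unit_extension G f g = (if g \<in> range (idn G) then f (src G g) else 0)"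

definition base_algebra ::
  "('g, 'x::topological_space, 'e::real_normed_vector) smooth_groupoid \<Rightarrow> (complex, 'x \<Rightarrow> complex) module" where
  "base_algebra G =
     \<lparr>carrier = {f. smooth_complex (obj_atlas G) f},
      mult = (\<lambda>f f' x. f x * f' x), one = (\<lambda>x. 1),
      ring.zero = (\<lambda>x. 0), add = (\<lambda>f f' x. f x + f' x), smult = (\<lambda>c f x. c * f x)\<rparr>"

definition convolution_algebra ::
  "('g::topological_space, 'x, 'e::real_normed_vector) smooth_groupoid \<Rightarrow> (complex, 'g \<Rightarrow> complex) module" where
  "convolution_algebra G =
     \<lparr>carrier = {u. smooth_complex (arr_atlas G) u \<and> compact (closure {g. u g \<noteq> 0})},
      mult = convolution G, one = unit_extension G (\<lambda>x. 1),
      ring.zero = (\<lambda>g. 0), add = (\<lambda>u v g. u g + v g), smult = (\<lambda>c u g. c * u g)\<rparr>"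

text \<open>The function \<open>(g, g') \<mapsto> \<Sum> u g * u' g'\<close> attached to a representative \<open>\<Sum> u \<otimes> u'\<close>.\<close>

definition tensor_function :: "('g \<Rightarrow> complex) formal_tensor \<Rightarrow> 'g \<Rightarrow> 'g \<Rightarrow> complex" where
  "tensor_function p g g' =
     (\<Sum>w\<in>Poly_Mapping.keys p. of_int (Poly_Mapping.lookup p w) * ((w ! 0) g * (w ! 1) g'))"

text \<open>The element of \<open>H \<otimes> H\<close> whose associated function on the pairs with equal value under \<open>r\<close>
  (\<open>r = tgt\<close> or \<open>r = src\<close>) is \<open>u\<close> on the diagonal and \<open>0\<close> elsewhere.\<close>

definition diagonal_tensor ::
  "('g::topological_space, 'x, 'e::real_normed_vector) smooth_groupoid \<Rightarrow> ('g \<Rightarrow> complex) balancing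
     \<Rightarrow> ('g \<Rightarrow> 'x) \<Rightarrow> ('g \<Rightarrow> complex) \<Rightarrow> ('g \<Rightarrow> complex) formal_tensor set" where
  "diagonal_tensor G B r u =
     (THE T. T \<in> carrier (tensor_product (convolution_algebra G) [B]) \<and>
        (\<forall>p\<in>T. \<forall>g g'. r g = r g' \<longrightarrow> tensor_function p g g' = (if g = g' then u g else 0)))"

definition convolution_hopf_algebroid ::
  "('g::topological_space, 'x::topological_space, 'e::real_normed_vector) smooth_groupoid
     \<Rightarrow> ('g \<Rightarrow> complex, 'x \<Rightarrow> complex, 'x \<Rightarrow> complex) hopf_data" where
  "convolution_hopf_algebroid G =
     \<lparr>total_alg = convolution_algebra G,
      left_base = base_algebra G,
      left_source = unit_extension G,
      left_target = unit_extension G,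
      left_coproduct = diagonal_tensor G
        (left_balancing (convolution_algebra G) (base_algebra G) (unit_extension G) (unit_extension G)) (tgt G),
      left_counit = (\<lambda>u x. \<Sum>g | tgt G g = x \<and> u g \<noteq> 0. u g),
      right_base = base_algebra G,
      right_source = unit_extension G,
      right_target = unit_extension G,
      right_coproduct = diagonal_tensor G
        (right_balancing (convolution_algebra G) (base_algebra G) (unit_extension G) (unit_extension G)) (src G),
      right_counit = (\<lambda>u x. \<Sum>g | src G g = x \<and> u g \<noteq> 0. u g),
      antipode = (\<lambda>u g. u (ginv G g))\<rparr>"

definition convolution_star :: "('g, 'x, 'e) smooth_groupoid \<Rightarrow> ('g \<Rightarrow> complex) \<Rightarrow> 'g \<Rightarrow> complex" where
  "convolution_star G u g = cnj (u (ginv G g))"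

definition function_star :: "('x \<Rightarrow> complex) \<Rightarrow> 'x \<Rightarrow> complex" where
  "function_star f x = cnj (f x)"

end

theory Submission
  imports Defs
begin

text \<open>Write \<open>H\<close> for the smooth compactly supported functions on the arrows and \<open>A\<close> for the smooth
  functions on the objects. On functions of arrows every structure map is an explicit finite sum, and a
  coproduct is the function that is \<open>u\<close> on the diagonal of a fibred product and \<open>0\<close> elsewhere. If
  elements of \<open>H \<otimes> H\<close> may be treated as functions on pairs of arrows, each axiom becomes a computation
  in which the diagonal forces the summation variables to coincide. The conjugate \<open>u\<^sup>*\<close> involves inversion,
  which reverses products and exchanges source and target; so the star is an antimultiplicative
  involution, and it takes the left coproduct, a diagonal over \<open>tgt\<close>, to the right coproduct, a diagonal
  over \<open>src\<close>.

  Two points carry the proof. The first is that the sums stay inside \<open>H\<close> and \<open>A\<close>. A function in \<open>H\<close> is a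
  finite sum of functions supported in bisections, on which source and target are diffeomorphisms onto
  open sets of objects; for such a function the sums have at most one term, which depends smoothly on
  the point (\<open>fibre_sum_Cobj\<close>, \<open>convolution_Cc\<close>).

  The second is that a tensor is determined by its function (\<open>tensor_null_if_value_zero\<close>), in all the balanced
  tensor powers that occur. Again bisections are decisive: finitely many first factors \<open>u\<close> are
  simultaneously combinations \<open>\<Sum> a\<^sub>j(u) \<phi>\<^sub>j\<close> of fixed functions \<open>\<phi>\<^sub>j\<close> supported in bisections, with
  coefficients from \<open>A\<close>. After the coefficients have been moved to the next factor, the remaining factors
  are combined into tensors whose functions can be read off from the given one, so that they vanish
  together with it. The same decomposition shows that the diagonal functions come from tensors
  (\<open>diagonal_representative\<close>). As a consequence a coproduct, a coset of representatives, is exactly the set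
  of representatives with the diagonal function (\<open>diagonal_tensor_iff\<close>), and the axioms that quantify
  over representatives are accessible to computation.\<close>

section \<open>Iterated directional derivatives\<close>

lemma Ck_on_cong:
  assumes "open U" "\<And>x. x \<in> U \<Longrightarrow> f x = g x" "Ck_on k U f"
  shows "Ck_on k U g"
  using assms(2,3)
proof (induction k arbitrary: f g)
  case 0
  then show ?case using continuous_on_eq by (metis Ck_on.simps(1))
next
  case (Suc k)
  have der: "(g has_derivative frechet_derivative f (at x)) (at x)" if "x \<in> U" for x
  proof -
    have "(f has_derivative frechet_derivative f (at x)) (at x)"
      using Suc.prems(2) that frechet_derivative_works by fastforce
    then show ?thesis
      by (rule has_derivative_transform_within_open[OF _ assms(1) that]) (use Suc.prems(1) in auto)
  qed
  then have eq: "frechet_derivative g (at x) = frechet_derivative f (at x)" if "x \<in> U" for x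
    using that frechet_derivative_at by metis
  have "Ck_on k U (\<lambda>x. frechet_derivative g (at x) v)" for v
    by (rule Suc.IH[of "\<lambda>x. frechet_derivative f (at x) v"]) (use eq Suc.prems(2) in auto)
  moreover have "g differentiable (at x)" if "x \<in> U" for x
    using der that by (auto simp: differentiable_def)
  ultimately show ?case by simp
qed

lemma Ck_on_SucI:
  assumes "open U" "\<And>x. x \<in> U \<Longrightarrow> (f has_derivative f' x) (at x)"
    and "\<And>v. Ck_on k U (\<lambda>x. f' x v)"
  shows "Ck_on (Suc k) U f"
proof -
  have eq: "frechet_derivative f (at x) = f' x" if "x \<in> U" for x
    using assms(2)[OF that] frechet_derivative_at by metis
  have "Ck_on k U (\<lambda>x. frechet_derivative f (at x) v)" for v
    by (rule Ck_on_cong[OF assms(1) _ assms(3)[of v]]) (simp add: eq)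
  then show ?thesis using assms(2) by (auto simp: differentiable_def)
qed

lemma Ck_on_SucD:
  assumes "Ck_on (Suc k) U f"
  shows "x \<in> U \<Longrightarrow> (f has_derivative frechet_derivative f (at x)) (at x)"
    and "Ck_on k U (\<lambda>x. frechet_derivative f (at x) v)"
  using assms frechet_derivative_works by auto

lemma Ck_on_Suc_imp: "Ck_on (Suc k) U f \<Longrightarrow> Ck_on k U f"
proof (induction k arbitrary: f)
  case 0
  then show ?case
    by (auto intro!: continuous_at_imp_continuous_on differentiable_imp_continuous_within)
next
  case (Suc k)
  then show ?case by (metis Ck_on.simps(2))
qed

lemma Ck_on_subset: "Ck_on k U f \<Longrightarrow> V \<subseteq> U \<Longrightarrow> Ck_on k V f"
  by (induction k arbitrary: f) (auto intro: continuous_on_subset)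

lemma Ck_on_const: "open U \<Longrightarrow> Ck_on k U (\<lambda>x. c)"
proof (induction k arbitrary: c)
  case (Suc k)
  show ?case by (rule Ck_on_SucI[where f' = "\<lambda>x v. 0"]) (use Suc in auto)
qed auto

lemma Ck_on_add:
  assumes "open U" "Ck_on k U f" "Ck_on k U g"
  shows "Ck_on k U (\<lambda>x. f x + g x)"
  using assms(2,3)
proof (induction k arbitrary: f g)
  case (Suc k)
  show ?case
  proof (rule Ck_on_SucI[OF assms(1)])
    show "((\<lambda>x. f x + g x) has_derivative
        (\<lambda>v. frechet_derivative f (at x) v + frechet_derivative g (at x) v)) (at x)" if "x \<in> U" for x
      using has_derivative_add[OF Ck_on_SucD(1)[OF Suc.prems(1) that] Ck_on_SucD(1)[OF Suc.prems(2) that]] .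
    show "Ck_on k U (\<lambda>x. frechet_derivative f (at x) v + frechet_derivative g (at x) v)" for v
      using Suc.IH[OF Ck_on_SucD(2)[OF Suc.prems(1)] Ck_on_SucD(2)[OF Suc.prems(2)]] .
  qed
qed (auto intro: continuous_on_add)

lemma Ck_on_linear:
  assumes "open U" "bounded_linear L" "Ck_on k U f"
  shows "Ck_on k U (\<lambda>x. L (f x))"
  using assms(3)
proof (induction k arbitrary: f)
  case 0
  then show ?case
    using continuous_on_compose2[OF linear_continuous_on[OF assms(2)]] by auto
next
  case (Suc k)
  show ?case
  proof (rule Ck_on_SucI[OF assms(1)])
    show "((\<lambda>x. L (f x)) has_derivative (\<lambda>v. L (frechet_derivative f (at x) v))) (at x)"
      if "x \<in> U" for x
      using bounded_linear.has_derivative[OF assms(2)] Ck_on_SucD(1)[OF Suc.prems that] by blast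
    show "Ck_on k U (\<lambda>x. L (frechet_derivative f (at x) v))" for v
      using Suc.IH Ck_on_SucD(2)[OF Suc.prems] by blast
  qed
qed

lemma Ck_on_id: "open U \<Longrightarrow> Ck_on k U (\<lambda>x. x)"
proof (induction k)
  case (Suc k)
  show ?case by (rule Ck_on_SucI[where f' = "\<lambda>x v. v"]) (auto intro: Ck_on_const Suc.prems)
qed auto

lemma Ck_on_bilinear:
  assumes "open U" "bounded_bilinear B" "Ck_on k U f" "Ck_on k U g"
  shows "Ck_on k U (\<lambda>x. B (f x) (g x))"
  using assms(3,4)
proof (induction k arbitrary: f g)
  case 0
  then show ?case using bounded_bilinear.continuous_on[OF assms(2)] by auto
next
  case (Suc k)
  show ?case
  proof (rule Ck_on_SucI[OF assms(1)])
    show "((\<lambda>x. B (f x) (g x)) has_derivative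
        (\<lambda>v. B (f x) (frechet_derivative g (at x) v) + B (frechet_derivative f (at x) v) (g x))) (at x)"
      if "x \<in> U" for x
      using bounded_bilinear.FDERIV[OF assms(2) Ck_on_SucD(1)[OF Suc.prems(1) that]
          Ck_on_SucD(1)[OF Suc.prems(2) that]] .
    show "Ck_on k U (\<lambda>x. B (f x) (frechet_derivative g (at x) v) + B (frechet_derivative f (at x) v) (g x))" for v
      using Suc.prems by (intro Ck_on_add Suc.IH assms(1) Ck_on_Suc_imp[of k] Ck_on_SucD(2))
  qed
qed

lemma Ck_on_sum:
  assumes "open U" "finite I" "\<And>i. i \<in> I \<Longrightarrow> Ck_on k U (f i)"
  shows "Ck_on k U (\<lambda>x. \<Sum>i\<in>I. f i x)"
  using assms(2,3) by (induction I rule: finite_induct) (auto intro: Ck_on_const Ck_on_add assms(1))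

text \<open>The derivative of \<open>1/f\<close> is \<open>- f'/f\<^sup>2\<close>, again a product of inverses of \<open>f\<close> and a derivative of \<open>f\<close>.\<close>

lemma Ck_on_inverse:
  fixes f :: "'e::real_normed_vector \<Rightarrow> 'f::real_normed_div_algebra"
  assumes "open U" "Ck_on k U f" "\<And>x. x \<in> U \<Longrightarrow> f x \<noteq> 0"
  shows "Ck_on k U (\<lambda>x. inverse (f x))"
  using assms(2)
proof (induction k)
  case 0
  then show ?case using assms(3) by (auto intro: continuous_on_inverse)
next
  case (Suc k)
  show ?case
  proof (rule Ck_on_SucI[OF assms(1)])
    show "((\<lambda>x. inverse (f x)) has_derivative
        (\<lambda>v. - (inverse (f x) * frechet_derivative f (at x) v * inverse (f x)))) (at x)"
      if "x \<in> U" for x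
      using Deriv.has_derivative_inverse[OF assms(3)[OF that] Ck_on_SucD(1)[OF Suc.prems that]] .
    show "Ck_on k U (\<lambda>x. - (inverse (f x) * frechet_derivative f (at x) v * inverse (f x)))" for v
      using Suc.IH[OF Ck_on_Suc_imp[OF Suc.prems]] Ck_on_SucD(2)[OF Suc.prems, of v]
      by (intro Ck_on_linear[OF assms(1) bounded_linear_minus[OF bounded_linear_ident]]
          Ck_on_bilinear[OF assms(1) bounded_bilinear_mult])
  qed
qed

text \<open>A finite spanning set can be orthogonalised, and then coordinates are inner products, which are
  continuous. A zero vector in the orthogonal set contributes \<open>0\<close>, by the convention \<open>x / 0 = 0\<close>.\<close>

lemma orthogonal_expansion:
  fixes B :: "'e::real_inner set"
  assumes "finite B" "span B = UNIV"
  obtains C where "finite C" "\<And>x :: 'e. x = (\<Sum>b\<in>C. ((x \<bullet> b) / (b \<bullet> b)) *\<^sub>R b)"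
proof -
  obtain C where C: "finite C" "span C = span B" "pairwise orthogonal C"
    using basis_orthogonal[OF assms(1)] by blast
  have "x = (\<Sum>b\<in>C. ((x \<bullet> b) / (b \<bullet> b)) *\<^sub>R b)" for x :: 'e
  proof -
    have "x \<in> span C" using C(2) assms(2) by simp
    then show ?thesis
    proof (induction rule: span_induct_alt)
      case base
      then show ?case by simp
    next
      case (step c y z)
      have "(\<Sum>b\<in>C. ((y \<bullet> b) / (b \<bullet> b)) *\<^sub>R b) = (\<Sum>b\<in>C. if b = y then y else 0)"
      proof (rule sum.cong[OF refl])
        fix b assume "b \<in> C"
        with C(3) step(1) show "((y \<bullet> b) / (b \<bullet> b)) *\<^sub>R b = (if b = y then y else 0)"
          by (cases "b = y"; cases "y = 0") (auto simp: pairwise_def orthogonal_def)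
      qed
      also have "\<dots> = y" using C(1) step(1) by simp
      finally have y: "(\<Sum>b\<in>C. ((y \<bullet> b) / (b \<bullet> b)) *\<^sub>R b) = y" .
      have "(\<Sum>b\<in>C. (((c *\<^sub>R y + z) \<bullet> b) / (b \<bullet> b)) *\<^sub>R b)
          = c *\<^sub>R (\<Sum>b\<in>C. ((y \<bullet> b) / (b \<bullet> b)) *\<^sub>R b) + (\<Sum>b\<in>C. ((z \<bullet> b) / (b \<bullet> b)) *\<^sub>R b)"
        by (simp add: inner_add_left add_divide_distrib scaleR_add_left sum.distrib scaleR_sum_right)
      then show ?case using y step(2) by simp
    qed
  qed
  with C(1) that show thesis by blast
qed

text \<open>The derivative of \<open>f\<close> at \<open>q x\<close> is applied to a vector that varies with \<open>x\<close>, while \<^const>\<open>Ck_on\<close>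
  speaks of fixed directions only; expanding the vector in a finite basis separates the two.\<close>

lemma Ck_on_compose:
  fixes q :: "'d::real_normed_vector \<Rightarrow> 'e::real_inner" and f :: "'e \<Rightarrow> 'f::real_normed_vector"
  assumes fin: "finite (B :: 'e set)" "span B = UNIV"
    and op: "open U" "open V" and qUV: "\<And>x. x \<in> U \<Longrightarrow> q x \<in> V"
    and Ck: "Ck_on k U q" "Ck_on k V f"
  shows "Ck_on k U (\<lambda>x. f (q x))"
  using Ck
proof (induction k arbitrary: f)
  case 0
  then show ?case using qUV by (auto intro: continuous_on_compose2)
next
  case (Suc k)
  obtain C where C: "finite C" "\<And>x :: 'e. x = (\<Sum>b\<in>C. ((x \<bullet> b) / (b \<bullet> b)) *\<^sub>R b)"
    using orthogonal_expansion[OF fin] by metis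
  let ?q = "\<lambda>x. frechet_derivative q (at x)" and ?f = "\<lambda>y. frechet_derivative f (at y)"
  show ?case
  proof (rule Ck_on_SucI[OF op(1)])
    show "((\<lambda>x. f (q x)) has_derivative (\<lambda>v. \<Sum>b\<in>C. ((?q x v \<bullet> b) / (b \<bullet> b)) *\<^sub>R ?f (q x) b)) (at x)"
      if "x \<in> U" for x
    proof -
      have f: "(f has_derivative ?f (q x)) (at (q x))"
        using Ck_on_SucD(1)[OF Suc.prems(2) qUV[OF that]] .
      have "((\<lambda>x. f (q x)) has_derivative (\<lambda>v. ?f (q x) (?q x v))) (at x)"
        using diff_chain_at[OF Ck_on_SucD(1)[OF Suc.prems(1) that] f] by (simp add: o_def)
      moreover have exp: "?f (q x) w = (\<Sum>b\<in>C. ((w \<bullet> b) / (b \<bullet> b)) *\<^sub>R ?f (q x) b)" for w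
      proof -
        have "linear (?f (q x))" using f has_derivative_linear by blast
        then have "?f (q x) (\<Sum>b\<in>C. ((w \<bullet> b) / (b \<bullet> b)) *\<^sub>R b) = (\<Sum>b\<in>C. ((w \<bullet> b) / (b \<bullet> b)) *\<^sub>R ?f (q x) b)"
          by (simp add: linear_sum linear_scale)
        then show ?thesis using arg_cong[OF C(2)[of w], of "?f (q x)"] by (rule trans[rotated])
      qed
      ultimately show ?thesis by (rule has_derivative_eq_rhs[OF _ ext])
    qed
    show "Ck_on k U (\<lambda>x. \<Sum>b\<in>C. ((?q x v \<bullet> b) / (b \<bullet> b)) *\<^sub>R ?f (q x) b)" for v
    proof (rule Ck_on_sum[OF op(1) C(1)])
      fix b :: 'e
      have "bounded_linear (\<lambda>w. (w \<bullet> b) / (b \<bullet> b))"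
        by (rule bounded_linear_compose[OF bounded_linear_divide bounded_linear_inner_left])
      from Ck_on_linear[OF op(1) this Ck_on_SucD(2)[OF Suc.prems(1), of v]]
      have "Ck_on k U (\<lambda>x. (?q x v \<bullet> b) / (b \<bullet> b))" .
      from Ck_on_bilinear[OF op(1) bounded_bilinear_scaleR this
          Suc.IH[OF Ck_on_Suc_imp[OF Suc.prems(1)] Ck_on_SucD(2)[OF Suc.prems(2), of b]]]
      show "Ck_on k U (\<lambda>x. ((?q x v \<bullet> b) / (b \<bullet> b)) *\<^sub>R ?f (q x) b)" .
    qed
  qed
qed


lemma smooth_on_subset: "smooth_on U f \<Longrightarrow> V \<subseteq> U \<Longrightarrow> smooth_on V f"
  unfolding smooth_on_def by (meson Ck_on_subset)

lemma smooth_on_continuous: "smooth_on U f \<Longrightarrow> continuous_on U f"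
  unfolding smooth_on_def by (metis Ck_on.simps(1))

lemma smooth_on_compose:
  fixes q :: "'d::real_normed_vector \<Rightarrow> 'e::real_inner" and f :: "'e \<Rightarrow> 'f::real_normed_vector"
  assumes "finite (B :: 'e set)" "span B = UNIV" "open U" "open V" "\<And>x. x \<in> U \<Longrightarrow> q x \<in> V"
    and "smooth_on U q" "smooth_on V f"
  shows "smooth_on U (\<lambda>x. f (q x))"
  using assms unfolding smooth_on_def by (blast intro: Ck_on_compose)


section \<open>Bump functions\<close>

text \<open>The flat function \<open>exp (-1/x)\<close> together with its quotients by powers of \<open>x\<close>: the derivative of a
  member of this family is a combination of members, so all of them are smooth at once.\<close>

definition flat :: "nat \<Rightarrow> real \<Rightarrow> real" where
  "flat n x = (if x > 0 then exp (- inverse x) * inverse x ^ n else 0)"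

lemma flat_tendsto_0: "(flat n \<longlongrightarrow> 0) (at 0)"
proof -
  have "((\<lambda>x. inverse x ^ n / exp (inverse x)) \<longlongrightarrow> 0) (at_right (0::real))"
    by (rule filterlim_compose[OF tendsto_power_div_exp_0 filterlim_inverse_at_top_right])
  then have "(flat n \<longlongrightarrow> 0) (at_right 0)"
    by (rule Lim_transform_eventually)
      (auto simp: flat_def eventually_at_filter exp_minus field_simps)
  moreover have "(flat n \<longlongrightarrow> 0) (at_left 0)"
    by (rule tendsto_eventually) (auto simp: flat_def eventually_at_filter)
  ultimately show ?thesis by (simp add: filterlim_split_at)
qed

lemma flat_has_derivative:
  "(flat n has_real_derivative flat (n + 2) x - real n * flat (Suc n) x) (at x)"
proof (cases x "0 :: real" rule: linorder_cases)
  case less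
  have "((\<lambda>x. 0) has_real_derivative 0) (at x)" by simp
  then have "(flat n has_real_derivative 0) (at x)"
    by (rule has_field_derivative_transform_within[where d = "- x"]) (use less in \<open>auto simp: flat_def dist_real_def\<close>)
  then show ?thesis using less by (simp add: flat_def)
next
  case equal
  have "((\<lambda>h. flat n h / h) \<longlongrightarrow> 0) (at 0)"
    by (rule Lim_transform_eventually[OF flat_tendsto_0[of "Suc n"]])
      (auto simp: flat_def eventually_at_filter field_simps)
  then have "(flat n has_real_derivative 0) (at 0)"
    by (simp add: has_field_derivative_iff flat_def)
  then show ?thesis using equal by (simp add: flat_def)
next
  case greater
  have "((\<lambda>x. exp (- inverse x) * inverse x ^ n) has_real_derivative
      flat (n + 2) x - real n * flat (Suc n) x) (at x)"
    using greater
    by (cases n)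
      (auto intro!: derivative_eq_intros simp: flat_def power2_eq_square algebra_simps,
        metis power_eq_if One_nat_def)
  then show ?thesis
    by (rule has_field_derivative_transform_within[where d = x]) (use greater in \<open>auto simp: flat_def dist_real_def\<close>)
qed

lemma smooth_on_flat:
  assumes "open U" "smooth_on U q"
  shows "smooth_on U (\<lambda>x. flat n (q x))"
proof -
  have q: "Ck_on k U q" for k using assms(2) by (simp add: smooth_on_def)
  have "Ck_on k U (\<lambda>x. flat n (q x))" for k
  proof (induction k arbitrary: n)
    case 0
    have "continuous_on UNIV (flat n)"
      using DERIV_isCont[OF flat_has_derivative] by (simp add: continuous_at_imp_continuous_on)
    then show ?case using q[of 0] continuous_on_compose2[of UNIV "flat n" U q] by auto
  next
    case (Suc k)
    show ?case
    proof (rule Ck_on_SucI[OF assms(1)])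
      fix x assume "x \<in> U"
      then have q': "(q has_derivative frechet_derivative q (at x)) (at x)"
        using Ck_on_SucD(1)[OF q] by blast
      show "((\<lambda>x. flat n (q x)) has_derivative
          (\<lambda>v. (flat (n + 2) (q x) + - real n * flat (Suc n) (q x)) * frechet_derivative q (at x) v)) (at x)"
        using has_derivative_compose[where g = "flat n", OF q' flat_has_derivative[unfolded has_field_derivative_def]]
        by simp
    next
      fix v
      show "Ck_on k U (\<lambda>x. (flat (n + 2) (q x) + - real n * flat (Suc n) (q x)) * frechet_derivative q (at x) v)"
        by (intro Ck_on_bilinear[OF assms(1) bounded_bilinear_mult] Ck_on_add[OF assms(1)] Suc.IH
            Ck_on_const[OF assms(1)] Ck_on_SucD(2)[OF q])
    qed
  qed
  then show ?thesis by (simp add: smooth_on_def)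
qed

text \<open>Coordinates with respect to an orthogonal spanning set exhibit the ball as a closed subset of a
  continuous image of a box.\<close>

lemma compact_cball_finite_span:
  fixes B :: "'e::real_inner set"
  assumes "finite B" "span B = UNIV"
  shows "compact (cball (c :: 'e) r)"
proof -
  obtain C where C: "finite C" "\<And>x :: 'e. x = (\<Sum>b\<in>C. ((x \<bullet> b) / (b \<bullet> b)) *\<^sub>R b)"
    using orthogonal_expansion[OF assms] by metis
  define R where "R b = (norm c + r) * norm b / (b \<bullet> b)" for b :: 'e
  let ?K = "\<lambda>D. {y. \<exists>f. (\<forall>b\<in>D. f b \<in> {- R b..R b}) \<and> y = (\<Sum>b\<in>D. f b *\<^sub>R b)}"
  have "compact (?K D)" if "finite D" for D
    using that
  proof (induction D rule: finite_induct)
    case empty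
    then show ?case by simp
  next
    case (insert a D)
    \<comment> \<open>each vector of the spanning set contributes one more interval\<close>
    have "compact ((\<lambda>(t, y). t *\<^sub>R a + y) ` ({- R a..R a} \<times> ?K D))"
      by (intro compact_continuous_image compact_Times insert.IH compact_Icc)
        (auto simp: case_prod_unfold intro!: continuous_intros)
    also have "(\<lambda>(t, y). t *\<^sub>R a + y) ` ({- R a..R a} \<times> ?K D) = ?K (insert a D)"
    proof (intro equalityI subsetI)
      fix z assume "z \<in> (\<lambda>(t, y). t *\<^sub>R a + y) ` ({- R a..R a} \<times> ?K D)"
      then obtain t f where "t \<in> {- R a..R a}" "\<forall>b\<in>D. f b \<in> {- R b..R b}"
        "z = t *\<^sub>R a + (\<Sum>b\<in>D. f b *\<^sub>R b)" by auto
      moreover have "(\<Sum>b\<in>D. (f(a := t)) b *\<^sub>R b) = (\<Sum>b\<in>D. f b *\<^sub>R b)"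
        using insert.hyps by (intro sum.cong) auto
      ultimately show "z \<in> ?K (insert a D)"
        using insert.hyps by (auto intro!: exI[of _ "f(a := t)"])
    next
      fix z assume "z \<in> ?K (insert a D)"
      then obtain f where "\<forall>b\<in>insert a D. f b \<in> {- R b..R b}" "z = f a *\<^sub>R a + (\<Sum>b\<in>D. f b *\<^sub>R b)"
        using insert.hyps by auto
      then show "z \<in> (\<lambda>(t, y). t *\<^sub>R a + y) ` ({- R a..R a} \<times> ?K D)"
        by (intro image_eqI[of _ _ "(f a, \<Sum>b\<in>D. f b *\<^sub>R b)"]) auto
    qed
    finally show ?case .
  qed
  then have cpt: "compact (?K C)" using C(1) by blast
  have "cball c r \<subseteq> ?K C"
  proof
    fix x assume "x \<in> cball c r"
    then have "norm x \<le> norm c + r"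
      by (metis add.commute dist_norm mem_cball norm_minus_commute norm_triangle_sub order_trans add_left_mono)
    then have "\<bar>x \<bullet> b\<bar> \<le> (norm c + r) * norm b" for b
      by (meson Cauchy_Schwarz_ineq2 mult_right_mono norm_ge_zero order_trans)
    then have "\<bar>(x \<bullet> b) / (b \<bullet> b)\<bar> \<le> R b" for b
      unfolding R_def by (simp add: abs_div divide_right_mono)
    then have "\<forall>b\<in>C. (x \<bullet> b) / (b \<bullet> b) \<in> {- R b..R b}" unfolding atLeastAtMost_iff by (metis abs_le_iff minus_le_iff)
    then show "x \<in> ?K C"
      by (intro CollectI exI[of _ "\<lambda>b. (x \<bullet> b) / (b \<bullet> b)"] conjI C(2))
  qed
  then show ?thesis using cpt closed_Int_compact[OF closed_cball, of "?K C" c r] by (simp add: Int_absorb2)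
qed

lemma bump_function_exists:
  fixes B :: "'e::real_inner set"
  assumes "finite B" "span B = UNIV" "open V" "(c :: 'e) \<in> V"
  obtains b :: "'e \<Rightarrow> real" and K where "smooth_on UNIV b" "\<And>x. b x \<ge> 0" "b c > 0"
    "compact K" "K \<subseteq> V" "\<And>x. x \<notin> K \<Longrightarrow> b x = 0"
proof -
  obtain r where r: "r > 0" "cball c r \<subseteq> V" using assms(3,4) open_contains_cball by blast
  \<comment> \<open>a difference written as a sum with a negative, the form in which \<open>Ck_on_add\<close> applies\<close>
  let ?b = "\<lambda>x. flat 0 (r\<^sup>2 + - ((x + - c) \<bullet> (x + - c)))"
  have "Ck_on k UNIV (\<lambda>x. r\<^sup>2 + - ((x + - c) \<bullet> (x + - c)))" for k
    by (intro Ck_on_add Ck_on_const Ck_on_id Ck_on_bilinear[OF _ bounded_bilinear_inner]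
        Ck_on_linear[OF _ bounded_linear_minus[OF bounded_linear_ident]]) auto
  then have "smooth_on UNIV ?b"
    by (intro smooth_on_flat) (simp_all add: smooth_on_def)
  moreover have "?b x = 0" if "x \<notin> cball c r" for x
  proof -
    have "r \<le> norm (x - c)" using that by (simp add: dist_norm norm_minus_commute)
    then have "r\<^sup>2 \<le> (x - c) \<bullet> (x - c)"
      using r(1) by (simp add: power2_norm_eq_inner[symmetric] power_mono)
    then show ?thesis by (simp add: flat_def)
  qed
  ultimately show thesis
    using r compact_cball_finite_span[OF assms(1,2)] that[of ?b "cball c r"] by (auto simp: flat_def)
qed

section \<open>Smooth functions on manifolds\<close>

text \<open>Smoothness at one point. All later arguments are local, so this pointwise form
  spares the bookkeeping with open sets.\<close>

definition smooth_at ::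
  "('m::topological_space, 'e::real_normed_vector) atlas \<Rightarrow> ('m \<Rightarrow> complex) \<Rightarrow> 'm \<Rightarrow> bool" where
  "smooth_at A u p \<longleftrightarrow> (\<exists>(U, \<phi>)\<in>A. \<exists>W F. open W \<and> p \<in> W \<and> W \<subseteq> U \<and> smooth_on (\<phi> ` W) F \<and>
     (\<forall>q\<in>W. u q = F (\<phi> q)))"

lemma smooth_complex_iff: "smooth_complex A u \<longleftrightarrow> (\<forall>p. smooth_at A u p)"
  unfolding smooth_complex_def smooth_map_on_def smooth_at_def by simp

lemma smooth_at_cong:
  assumes "smooth_at A u p" "open N" "p \<in> N" "\<And>q. q \<in> N \<Longrightarrow> v q = u q"
  shows "smooth_at A v p"
proof -
  obtain U \<phi> W F where *: "(U, \<phi>) \<in> A" "open W" "p \<in> W" "W \<subseteq> U" "smooth_on (\<phi> ` W) F"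
    "\<forall>q\<in>W. u q = F (\<phi> q)"
    using assms(1) unfolding smooth_at_def by blast
  have "smooth_on (\<phi> ` (W \<inter> N)) F" by (rule smooth_on_subset[OF *(5)]) auto
  then show ?thesis
    unfolding smooth_at_def using * assms(2-4)
    by (intro bexI[OF _ *(1)] case_prodI exI[of _ "W \<inter> N"] exI[of _ F]) auto
qed

locale manifold =
  fixes A :: "('m::topological_space, 'e::real_inner) atlas"
  assumes atlas: "smooth_atlas A"
begin

lemma finite_span: obtains B :: "'e set" where "finite B" "span B = UNIV"
proof -
  have "\<exists>B :: 'e set. finite B \<and> span B = UNIV"
    using atlas unfolding smooth_atlas_def by (elim conjE)
  then show thesis using that by blast
qed

lemma chart_exists: obtains U \<phi> where "(U, \<phi>) \<in> A" "p \<in> U"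
proof -
  have "(\<Union>(U, \<phi>)\<in>A. U) = UNIV" using atlas unfolding smooth_atlas_def by (elim conjE)
  then have "p \<in> (\<Union>(U, \<phi>)\<in>A. U)" by (simp only: UNIV_I)
  then obtain c where "c \<in> A" "p \<in> fst c" by (auto simp only: case_prod_unfold UN_iff)
  then show thesis using that[of "fst c" "snd c"] by simp
qed

lemma chart:
  assumes "(U, \<phi>) \<in> A"
  shows "open U" "open (\<phi> ` U)" "\<exists>\<psi>. homeomorphism U (\<phi> ` U) \<phi> \<psi>"
proof -
  have "\<forall>(U, \<phi>)\<in>A. open U \<and> open (\<phi> ` U) \<and> (\<exists>\<psi>. homeomorphism U (\<phi> ` U) \<phi> \<psi>)"
    using atlas unfolding smooth_atlas_def by (elim conjE)
  from bspec[OF this assms] show "open U" "open (\<phi> ` U)" "\<exists>\<psi>. homeomorphism U (\<phi> ` U) \<phi> \<psi>"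
    by simp_all
qed

lemmas chart_open = chart(1)

lemma chart_homeomorphism:
  assumes "(U, \<phi>) \<in> A" obtains \<psi> where "homeomorphism U (\<phi> ` U) \<phi> \<psi>"
  using chart(3)[OF assms] by blast

lemma chart_continuous: "(U, \<phi>) \<in> A \<Longrightarrow> continuous_on U \<phi>"
  using chart_homeomorphism homeomorphism_def by metis

lemma chart_inj: "(U, \<phi>) \<in> A \<Longrightarrow> inj_on \<phi> U"
  by (rule chart_homeomorphism) (auto simp: homeomorphism_def intro!: inj_on_inverseI)

lemma chart_image_open:
  assumes "(U, \<phi>) \<in> A" "open W" "W \<subseteq> U"
  shows "open (\<phi> ` W)"
proof -
  obtain \<psi> where h: "homeomorphism U (\<phi> ` U) \<phi> \<psi>" using chart_homeomorphism[OF assms(1)] .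
  have "open (\<phi> ` U)" using chart(2)[OF assms(1)] .
  moreover have "openin (top_of_set U) W"
    using assms chart_open by (simp add: openin_open_eq)
  ultimately show ?thesis
    using homeomorphism_imp_open_map[OF h] openin_open_trans by blast
qed

text \<open>Transition maps are smooth, so a local representative exists in every chart around the point.\<close>

lemma smooth_at_chart:
  assumes "smooth_at A u p" "(V, \<psi>) \<in> A" "p \<in> V"
  obtains W F where "open W" "p \<in> W" "W \<subseteq> V" "smooth_on (\<psi> ` W) F" "\<And>q. q \<in> W \<Longrightarrow> u q = F (\<psi> q)"
proof -
  obtain U \<phi> W F where *: "(U, \<phi>) \<in> A" "open W" "p \<in> W" "W \<subseteq> U" "smooth_on (\<phi> ` W) F"
    "\<forall>q\<in>W. u q = F (\<phi> q)"
    using assms(1) unfolding smooth_at_def by blast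
  let ?\<tau> = "\<phi> \<circ> the_inv_into V \<psi>"
  have inv: "the_inv_into V \<psi> (\<psi> q) = q" if "q \<in> V" for q
    using the_inv_into_f_f[OF chart_inj[OF assms(2)] that] .
  have oV: "open V" using chart_open[OF assms(2)] .
  obtain B :: "'e set" where B: "finite B" "span B = UNIV" using finite_span .
  have "\<forall>(V, \<psi>)\<in>A. \<forall>(U, \<phi>)\<in>A. smooth_on (\<psi> ` (V \<inter> U)) (\<phi> \<circ> the_inv_into V \<psi>)"
    using atlas unfolding smooth_atlas_def by (elim conjE)
  from bspec[OF bspec[OF this assms(2), unfolded prod.case] *(1), unfolded prod.case]
  have "smooth_on (\<psi> ` (V \<inter> U)) ?\<tau>" .
  then have \<tau>: "smooth_on (\<psi> ` (W \<inter> V)) ?\<tau>"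
    by (rule smooth_on_subset) (use *(4) in auto)
  have "smooth_on (\<psi> ` (W \<inter> V)) (\<lambda>x. F (?\<tau> x))"
  proof (rule smooth_on_compose[OF B _ _ _ \<tau>])
    show "open (\<psi> ` (W \<inter> V))" using *(2) oV by (intro chart_image_open[OF assms(2)]) auto
    show "open (\<phi> ` W)" by (rule chart_image_open[OF *(1,2,4)])
    show "?\<tau> x \<in> \<phi> ` W" if "x \<in> \<psi> ` (W \<inter> V)" for x
      using that inv by (elim imageE) (simp only: Int_iff o_apply imageI)
    show "smooth_on (\<phi> ` W) F" by (rule *(5))
  qed
  then show thesis
  proof (rule that[rotated 3])
    show "u q = F (?\<tau> (\<psi> q))" if "q \<in> W \<inter> V" for q
      using that *(6) inv[of q] by (simp only: Int_iff o_apply)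
  qed (use *(2,3) assms(3) oV in auto)
qed

text \<open>A point has one chart in which two given functions can both be expressed, so operations on
  smooth functions reduce to operations on their local representatives.\<close>

lemma smooth_at_combine:
  assumes "smooth_at A u p" "smooth_at A v p"
    and op: "\<And>(U :: 'e set) f g. open U \<Longrightarrow> smooth_on U f \<Longrightarrow> smooth_on U g \<Longrightarrow> smooth_on U (\<lambda>x. h (f x) (g x))"
  shows "smooth_at A (\<lambda>q. h (u q) (v q)) p"
proof -
  obtain U \<phi> where c: "(U, \<phi>) \<in> A" "p \<in> U" using chart_exists .
  obtain W F where 1: "open W" "p \<in> W" "W \<subseteq> U" "smooth_on (\<phi> ` W) F" "\<And>q. q \<in> W \<Longrightarrow> u q = F (\<phi> q)"
    using smooth_at_chart[OF assms(1) c] by metis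
  obtain W' F' where 2: "open W'" "p \<in> W'" "W' \<subseteq> U" "smooth_on (\<phi> ` W') F'" "\<And>q. q \<in> W' \<Longrightarrow> v q = F' (\<phi> q)"
    using smooth_at_chart[OF assms(2) c] by metis
  have "open (W \<inter> W')" "W \<inter> W' \<subseteq> U" using 1 2 by auto
  then have "smooth_on (\<phi> ` (W \<inter> W')) (\<lambda>x. h (F x) (F' x))"
    by (intro op chart_image_open[OF c(1)] smooth_on_subset[OF 1(4)] smooth_on_subset[OF 2(4)]) auto
  then show ?thesis
    unfolding smooth_at_def using 1 2 \<open>open (W \<inter> W')\<close>
    by (intro bexI[OF _ c(1)] case_prodI exI[of _ "W \<inter> W'"] exI[of _ "\<lambda>x. h (F x) (F' x)"]) auto
qed

lemma smooth_at_representative: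
  assumes "smooth_at A u p"
  obtains U \<phi> W F where "(U, \<phi>) \<in> A" "open W" "p \<in> W" "W \<subseteq> U" "smooth_on (\<phi> ` W) F"
    "\<forall>q\<in>W. u q = F (\<phi> q)" "continuous_on W u"
proof -
  obtain U \<phi> W F where *: "(U, \<phi>) \<in> A" "open W" "p \<in> W" "W \<subseteq> U" "smooth_on (\<phi> ` W) F"
    "\<forall>q\<in>W. u q = F (\<phi> q)"
    using assms unfolding smooth_at_def by blast
  have "continuous_on W (\<lambda>q. F (\<phi> q))"
    by (rule continuous_on_compose2[OF smooth_on_continuous[OF *(5)]])
      (use continuous_on_subset[OF chart_continuous[OF *(1)] *(4)] in auto)
  then have "continuous_on W u" by (rule continuous_on_eq) (simp add: *(6))
  then show thesis using that * by metis
qed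

lemma smooth_at_const: "smooth_at A (\<lambda>q. c) p"
proof -
  obtain U \<phi> where c: "(U, \<phi>) \<in> A" "p \<in> U" using chart_exists .
  then have "smooth_on (\<phi> ` U) (\<lambda>x. c)"
    using chart_image_open[OF c(1)] chart_open by (auto simp: smooth_on_def intro: Ck_on_const)
  then show ?thesis unfolding smooth_at_def using c chart_open[OF c(1)] by blast
qed

lemma smooth_at_add: "smooth_at A u p \<Longrightarrow> smooth_at A v p \<Longrightarrow> smooth_at A (\<lambda>q. u q + v q) p"
  by (rule smooth_at_combine[where h = "(+)"]) (auto simp: smooth_on_def intro: Ck_on_add)

lemma smooth_at_mult: "smooth_at A u p \<Longrightarrow> smooth_at A v p \<Longrightarrow> smooth_at A (\<lambda>q. u q * v q) p"
  by (rule smooth_at_combine[where h = "(*)"])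
    (auto simp: smooth_on_def intro: Ck_on_bilinear bounded_bilinear_mult)

lemma smooth_at_cnj: "smooth_at A u p \<Longrightarrow> smooth_at A (\<lambda>q. cnj (u q)) p"
  by (rule smooth_at_combine[where h = "\<lambda>x y. cnj x"])
    (auto simp: smooth_on_def intro: Ck_on_linear bounded_linear_cnj)

lemma smooth_at_sum:
  "finite I \<Longrightarrow> (\<And>i. i \<in> I \<Longrightarrow> smooth_at A (u i) p) \<Longrightarrow> smooth_at A (\<lambda>q. \<Sum>i\<in>I. u i q) p"
  by (induction I rule: finite_induct) (auto intro: smooth_at_const smooth_at_add)

lemma smooth_at_inverse:
  assumes "smooth_at A u p" "u p \<noteq> 0"
  shows "smooth_at A (\<lambda>q. inverse (u q)) p"
proof -
  obtain U \<phi> W F where *: "(U, \<phi>) \<in> A" "open W" "p \<in> W" "W \<subseteq> U" "smooth_on (\<phi> ` W) F"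
    "\<forall>q\<in>W. u q = F (\<phi> q)" "continuous_on W u"
    using smooth_at_representative[OF assms(1)] by metis
  have op: "open {q \<in> W. u q \<noteq> 0}"
    using continuous_open_preimage[OF *(7,2), of "- {0}"] by (auto simp: vimage_def Int_def)
  let ?W = "{q \<in> W. u q \<noteq> 0}"
  have "open (\<phi> ` ?W)" using chart_image_open[OF *(1) op] *(4) by auto
  moreover have "smooth_on (\<phi> ` ?W) F" by (rule smooth_on_subset[OF *(5)]) auto
  ultimately have "smooth_on (\<phi> ` ?W) (\<lambda>x. inverse (F x))"
    using *(6) unfolding smooth_on_def by (auto intro!: Ck_on_inverse)
  then show ?thesis
    unfolding smooth_at_def using * op assms(2)
    by (intro bexI[OF _ *(1)] case_prodI exI[of _ ?W] exI[of _ "\<lambda>x. inverse (F x)"]) auto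
qed

end

lemma smooth_map_onE:
  assumes "smooth_map_on A B S f" "p \<in> S"
  obtains U \<phi> V \<psi> W F where "(U, \<phi>) \<in> A" "(V, \<psi>) \<in> B" "open W" "p \<in> W" "W \<subseteq> U"
      "smooth_on (\<phi> ` W) F" "\<forall>q\<in>W \<inter> S. f q \<in> V \<and> \<psi> (f q) = F (\<phi> q)"
proof -
  have "\<exists>c\<in>A. \<exists>d\<in>B. \<exists>W F. open W \<and> p \<in> W \<and> W \<subseteq> fst c \<and> smooth_on (snd c ` W) F \<and>
      (\<forall>q\<in>W \<inter> S. f q \<in> fst d \<and> snd d (f q) = F (snd c q))"
    using bspec[OF assms(1)[unfolded smooth_map_on_def] assms(2)] by (simp only: case_prod_unfold)
  then obtain c d W F where "c \<in> A" "d \<in> B" "open W" "p \<in> W" "W \<subseteq> fst c" "smooth_on (snd c ` W) F"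
      "\<forall>q\<in>W \<inter> S. f q \<in> fst d \<and> snd d (f q) = F (snd c q)" by (elim bexE exE conjE)
  then show thesis using that[of "fst c" "snd c" "fst d" "snd d" W F] by (simp only: prod.collapse)
qed

text \<open>The atlas of the domain is only required to have continuous charts, because the multiplication is
  smooth with respect to a product atlas.\<close>

lemma smooth_map_continuous_on:
  assumes A: "\<And>U \<phi>. (U, \<phi>) \<in> A \<Longrightarrow> continuous_on U \<phi>" and B: "smooth_atlas B"
    and f: "smooth_map_on A B S f"
  shows "continuous_on S f"
proof -
  have "(f \<longlongrightarrow> f p) (at p within S)" if p: "p \<in> S" for p
  proof -
    interpret B: manifold B using B by unfold_locales
    obtain U \<phi> V \<psi> W F where *: "(U, \<phi>) \<in> A" "(V, \<psi>) \<in> B" "open W" "p \<in> W" "W \<subseteq> U"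
      "smooth_on (\<phi> ` W) F" "\<forall>q\<in>W \<inter> S. f q \<in> V \<and> \<psi> (f q) = F (\<phi> q)"
      using smooth_map_onE[OF f p] by metis
    obtain \<psi>' where h: "homeomorphism V (\<psi> ` V) \<psi> \<psi>'" using B.chart_homeomorphism[OF *(2)] .
    have "continuous_on (W \<inter> S) (\<lambda>q. F (\<phi> q))"
      by (rule continuous_on_compose2[OF smooth_on_continuous[OF *(6)]])
        (use continuous_on_subset[OF A[OF *(1)], of "W \<inter> S"] *(5) in auto)
    then have "continuous_on (W \<inter> S) (\<lambda>q. \<psi>' (F (\<phi> q)))"
      by (rule continuous_on_compose2[OF homeomorphism_cont2[OF h]]) (use *(7) in force)
    moreover have "\<psi>' (F (\<phi> q)) = f q" if "q \<in> W \<inter> S" for q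
      using *(7) that homeomorphism_apply1[OF h] by metis
    ultimately have "continuous_on (W \<inter> S) f" by (rule continuous_on_eq)
    then have "(f \<longlongrightarrow> f p) (at p within (W \<inter> S))"
      using *(4) p by (simp add: continuous_on_def)
    moreover have "at p within (W \<inter> S) = at p within S"
      by (rule at_within_nhd[OF *(4,3)]) auto
    ultimately show ?thesis by simp
  qed
  then show ?thesis by (simp add: continuous_on_def)
qed

lemma smooth_at_compose:
  assumes "smooth_atlas A" "smooth_atlas B" and f: "smooth_map_on A B S f" and S: "open S" "p \<in> S"
    and u: "smooth_at B u (f p)"
  shows "smooth_at A (\<lambda>q. u (f q)) p"
proof -
  interpret A: manifold A using assms(1) by unfold_locales
  interpret B: manifold B using assms(2) by unfold_locales
  obtain U \<phi> V \<psi> W F where *: "(U, \<phi>) \<in> A" "(V, \<psi>) \<in> B" "open W" "p \<in> W" "W \<subseteq> U"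
    "smooth_on (\<phi> ` W) F" "\<forall>q\<in>W \<inter> S. f q \<in> V \<and> \<psi> (f q) = F (\<phi> q)"
    using smooth_map_onE[OF f S(2)] by metis
  have fp: "f p \<in> V" using * S by blast
  obtain W' F' where 2: "open W'" "f p \<in> W'" "W' \<subseteq> V" "smooth_on (\<psi> ` W') F'" "\<And>q. q \<in> W' \<Longrightarrow> u q = F' (\<psi> q)"
    using B.smooth_at_chart[OF u *(2) fp] by metis
  have cont: "continuous_on S f"
    using smooth_map_continuous_on[OF A.chart_continuous assms(2) f] .
  let ?W = "W \<inter> (S \<inter> f -` W')"
  have op: "open ?W"
    using continuous_open_preimage[OF cont S(1) 2(1)] *(3) by blast
  obtain C :: "_ set" where C: "finite C" "span C = (UNIV :: 'd set)" using B.finite_span .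
  have "smooth_on (\<phi> ` ?W) (\<lambda>x. F' (F x))"
  proof (rule smooth_on_compose[OF C])
    show "open (\<phi> ` ?W)" using A.chart_image_open[OF *(1) op] *(5) by auto
    show "open (\<psi> ` W')" using B.chart_image_open[OF *(2) 2(1,3)] .
    show "F x \<in> \<psi> ` W'" if "x \<in> \<phi> ` ?W" for x using that *(7) by force
    show "smooth_on (\<phi> ` ?W) F" by (rule smooth_on_subset[OF *(6)]) auto
    show "smooth_on (\<psi> ` W') F'" by (rule 2(4))
  qed
  moreover have "u (f q) = F' (F (\<phi> q))" if "q \<in> ?W" for q
    using that *(7) 2(5) by auto
  ultimately show ?thesis
    unfolding smooth_at_def using op * 2 S
    by (intro bexI[OF _ *(1)] case_prodI exI[of _ ?W] exI[of _ "\<lambda>x. F' (F x)"]) auto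
qed

text \<open>A bump function of the model space, transported by a chart and extended by \<open>0\<close>. The extension is
  smooth because its support is compact, hence closed in the Hausdorff space of all points.\<close>

lemma manifold_bump:
  fixes A :: "('m::t2_space, 'e::real_inner) atlas"
  assumes "smooth_atlas A" "open N" "p \<in> N"
  obtains b :: "'m \<Rightarrow> real" and K where "smooth_complex A (\<lambda>q. of_real (b q))" "\<And>q. b q \<ge> 0" "b p > 0"
    "compact K" "K \<subseteq> N" "\<And>q. q \<notin> K \<Longrightarrow> b q = 0"
proof -
  interpret manifold A using assms(1) by unfold_locales
  obtain U \<phi> where c: "(U, \<phi>) \<in> A" "p \<in> U" using chart_exists .
  obtain \<psi> where h: "homeomorphism U (\<phi> ` U) \<phi> \<psi>" using chart_homeomorphism[OF c(1)] .
  obtain B :: "'e set" where B: "finite B" "span B = UNIV" using finite_span .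
  let ?W = "U \<inter> N"
  have W: "open ?W" "p \<in> ?W" "open (\<phi> ` ?W)"
    using chart_open[OF c(1)] assms(2,3) c(2) chart_image_open[OF c(1), of ?W] by auto
  obtain \<beta> K where \<beta>: "smooth_on UNIV \<beta>" "\<And>x. \<beta> x \<ge> (0 :: real)" "\<beta> (\<phi> p) > 0"
    "compact K" "K \<subseteq> \<phi> ` ?W" "\<And>x. x \<notin> K \<Longrightarrow> \<beta> x = 0"
    using bump_function_exists[OF B W(3)] W(2) by blast
  define b where "b q = (if q \<in> ?W then \<beta> (\<phi> q) else 0)" for q
  have K: "compact (\<psi> ` K)"
    using compact_continuous_image[OF continuous_on_subset[OF homeomorphism_cont2[OF h]] \<beta>(4)] \<beta>(5) by auto
  have KN: "\<psi> ` K \<subseteq> ?W"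
    using \<beta>(5) homeomorphism_apply1[OF h] by fastforce
  have b0: "b q = 0" if "q \<notin> \<psi> ` K" for q
    using that \<beta>(6) homeomorphism_apply1[OF h] unfolding b_def by (metis Int_iff imageI)
  have smooth: "smooth_at A (\<lambda>q. complex_of_real (b q)) q" for q
  proof (cases "q \<in> ?W")
    case True
    have "smooth_on (\<phi> ` ?W) (\<lambda>x. complex_of_real (\<beta> x))"
      using smooth_on_subset[OF \<beta>(1) subset_UNIV[of "\<phi> ` ?W"]] Ck_on_linear[OF W(3) bounded_linear_of_real]
      unfolding smooth_on_def by blast
    then show ?thesis
      unfolding smooth_at_def using True W(1)
      by (intro bexI[OF _ c(1)] case_prodI exI[of _ ?W] exI[of _ "\<lambda>x. complex_of_real (\<beta> x)"])
        (auto simp: b_def)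
  next
    case False
    show ?thesis
      by (rule smooth_at_cong[OF smooth_at_const, of "- (\<psi> ` K)" _ _ 0])
        (use False KN b0 compact_imp_closed[OF K] in auto)
  qed
  show thesis
  proof (rule that)
    show "b q \<ge> 0" for q using \<beta>(2) by (simp add: b_def)
    show "b p > 0" using \<beta>(3) W(2) by (simp add: b_def)
  qed (use smooth K KN b0 in \<open>auto simp: smooth_complex_iff\<close>)
qed

section \<open>Topology and smooth structure of an etale groupoid\<close>

locale compact_etale_groupoid = hausdorff_etale_groupoid G
  for G :: "('g::t2_space, 'x::t2_space, 'e::real_inner) smooth_groupoid" +
  assumes compact_objects: "compact (UNIV :: 'x set)"
begin

abbreviation inv_arr ("\<iota>") where "\<iota> \<equiv> ginv G"
abbreviation mul_arr (infixl "\<diamondop>" 70) where "g \<diamondop> h \<equiv> gmul G g h"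

lemma ginv_mul_cancel: "tgt G a = tgt G g \<Longrightarrow> a \<diamondop> (\<iota> a \<diamondop> g) = g"
  by (metis gmul_assoc ginv_right idn_left src_ginv tgt_ginv)

lemma mul_ginv_cancel: "src G a = tgt G b \<Longrightarrow> \<iota> a \<diamondop> (a \<diamondop> b) = b"
  by (metis gmul_assoc ginv_left idn_left src_ginv)

lemma mul_right_cancel: "src G a = tgt G b \<Longrightarrow> a \<diamondop> b \<diamondop> \<iota> b = a"
  by (metis gmul_assoc ginv_right idn_right tgt_ginv)

lemma ginv_unique: "src G a = tgt G b \<Longrightarrow> a \<diamondop> b = idn G (tgt G a) \<Longrightarrow> b = \<iota> a"
  by (metis mul_ginv_cancel idn_right src_ginv)

lemma ginv_ginv [simp]: "\<iota> (\<iota> g) = g"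
  by (metis ginv_unique ginv_left src_ginv tgt_ginv)

lemma ginv_idn [simp]: "\<iota> (idn G x) = idn G x"
  by (metis ginv_unique idn_left src_idn tgt_idn)

lemma ginv_mul:
  assumes "src G a = tgt G b" shows "\<iota> (a \<diamondop> b) = \<iota> b \<diamondop> \<iota> a"
proof -
  have "(a \<diamondop> b) \<diamondop> (\<iota> b \<diamondop> \<iota> a) = (a \<diamondop> b \<diamondop> \<iota> b) \<diamondop> \<iota> a"
    using assms by (metis gmul_assoc src_gmul src_ginv tgt_ginv)
  also have "\<dots> = idn G (tgt G (a \<diamondop> b))"
    using assms by (simp add: mul_right_cancel ginv_right tgt_gmul)
  finally show ?thesis
    using ginv_unique[of "a \<diamondop> b" "\<iota> b \<diamondop> \<iota> a"] assms by (simp add: src_gmul src_ginv tgt_ginv tgt_gmul)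
qed

lemma ginv_in_units_iff: "\<iota> g \<in> range (idn G) \<longleftrightarrow> g \<in> range (idn G)"
  using ginv_ginv[of g] by (auto simp del: ginv_ginv)

sublocale arr: manifold "arr_atlas G" by unfold_locales (rule arr_manifold)
sublocale obj: manifold "obj_atlas G" by unfold_locales (rule obj_manifold)

abbreviation smooth_arr where "smooth_arr \<equiv> smooth_at (arr_atlas G)"
abbreviation smooth_obj where "smooth_obj \<equiv> smooth_at (obj_atlas G)"

lemma continuous_structure_maps:
  "continuous_on UNIV (src G)" "continuous_on UNIV (tgt G)" "continuous_on UNIV (ginv G)"
  "continuous_on UNIV (idn G)"
  using smooth_map_continuous_on[OF arr.chart_continuous] smooth_map_continuous_on[OF obj.chart_continuous]
    arr_manifold obj_manifold src_smooth tgt_smooth ginv_smooth idn_smooth by blast+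

lemma continuous_mul: "continuous_on {(g, h). src G g = tgt G h} (\<lambda>(g, h). g \<diamondop> h)"
proof (rule smooth_map_continuous_on[OF _ arr_manifold gmul_smooth])
  fix U and \<phi> :: "'g \<times> 'g \<Rightarrow> 'e \<times> 'e"
  assume "(U, \<phi>) \<in> prod_atlas (arr_atlas G) (arr_atlas G)"
  then obtain V \<psi> V' \<psi>' where "(V, \<psi>) \<in> arr_atlas G" "(V', \<psi>') \<in> arr_atlas G"
    "U = V \<times> V'" "\<phi> = map_prod \<psi> \<psi>'" unfolding prod_atlas_def by blast
  then show "continuous_on U \<phi>"
    using continuous_on_compose2[OF arr.chart_continuous] continuous_on_fst continuous_on_snd
    by (auto simp: map_prod_def case_prod_unfold intro!: continuous_on_Pair
        continuous_on_compose2[OF arr.chart_continuous] continuous_intros)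
qed

lemma smooth_arr_pullback:
  "smooth_obj f (src G g) \<Longrightarrow> smooth_arr (\<lambda>g. f (src G g)) g"
  "smooth_obj f (tgt G g) \<Longrightarrow> smooth_arr (\<lambda>g. f (tgt G g)) g"
  "smooth_arr u (\<iota> g) \<Longrightarrow> smooth_arr (\<lambda>g. u (\<iota> g)) g"
  by (rule smooth_at_compose[OF arr_manifold _ _ open_UNIV UNIV_I];
      simp add: arr_manifold obj_manifold src_smooth tgt_smooth ginv_smooth)+

text \<open>An open set that the structure map \<open>r\<close> embeds diffeomorphically onto an open set of objects,
  expressed through what it does to smooth functions.\<close>

definition slice :: "('g \<Rightarrow> 'x) \<Rightarrow> 'g set \<Rightarrow> bool" where
  "slice r U \<longleftrightarrow> open U \<and> inj_on r U \<and> (\<forall>W. open W \<longrightarrow> W \<subseteq> U \<longrightarrow> open (r ` W)) \<and>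
     (\<forall>u. \<forall>g\<in>U. smooth_arr u g \<longrightarrow> smooth_obj (\<lambda>x. u (the_inv_into U r x)) (r g))"

lemma slice_open: "slice r U \<Longrightarrow> open U"
  and slice_inj: "slice r U \<Longrightarrow> inj_on r U"
  and slice_image_open: "slice r U \<Longrightarrow> open W \<Longrightarrow> W \<subseteq> U \<Longrightarrow> open (r ` W)"
  and slice_smooth: "slice r U \<Longrightarrow> g \<in> U \<Longrightarrow> smooth_arr u g \<Longrightarrow> smooth_obj (\<lambda>x. u (the_inv_into U r x)) (r g)"
  unfolding slice_def by simp_all

lemma sliceI:
  assumes "open U" "inj_on r U" "\<And>W. open W \<Longrightarrow> W \<subseteq> U \<Longrightarrow> open (r ` W)"
    and "\<And>u g. g \<in> U \<Longrightarrow> smooth_arr u g \<Longrightarrow> smooth_obj (\<lambda>x. u (the_inv_into U r x)) (r g)"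
  shows "slice r U"
  using assms unfolding slice_def by simp

lemma slice_the_inv: "slice r U \<Longrightarrow> g \<in> U \<Longrightarrow> the_inv_into U r (r g) = g"
  by (rule the_inv_into_f_f[OF slice_inj])

lemma slice_subset:
  assumes "slice r U" "open W" "W \<subseteq> U"
  shows "slice r W"
proof -
  have inj: "inj_on r U" "inj_on r W"
    using slice_inj[OF assms(1)] inj_on_subset[OF _ assms(3)] by blast+
  have eq: "the_inv_into W r x = the_inv_into U r x" if "x \<in> r ` W" for x
    using that inj assms(3) by (auto simp: the_inv_into_f_f)
  show ?thesis
  proof (rule sliceI[OF assms(2) inj(2)])
    show "open (r ` W')" if "open W'" "W' \<subseteq> W" for W'
      using slice_image_open[OF assms(1) that(1)] that(2) assms(3) by blast
    show "smooth_obj (\<lambda>x. u (the_inv_into W r x)) (r g)" if "g \<in> W" "smooth_arr u g" for u g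
    proof (rule smooth_at_cong)
      show "smooth_obj (\<lambda>x. u (the_inv_into U r x)) (r g)"
        using slice_smooth[OF assms(1)] that assms(3) by blast
      show "open (r ` W)" by (rule slice_image_open[OF assms])
    qed (use that eq in auto)
  qed
qed

text \<open>Continuity of the local inverse makes the source map open on the slice.\<close>

lemma src_slice_exists: obtains U where "p \<in> U" "slice (src G) U"
proof -
  obtain U where U: "open U" "p \<in> U" "inj_on (src G) U" "open (src G ` U)"
    "smooth_map_on (obj_atlas G) (arr_atlas G) (src G ` U) (the_inv_into U (src G))"
    using src_etale unfolding local_diffeo_def by blast
  have cont: "continuous_on (src G ` U) (the_inv_into U (src G))"
    using smooth_map_continuous_on[OF obj.chart_continuous arr_manifold U(5)] .
  have 1: "open (src G ` W)" if W: "open W" "W \<subseteq> U" for W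
  proof -
    have "src G ` W = src G ` U \<inter> the_inv_into U (src G) -` W"
      using W(2) U(3) by (auto simp: the_inv_into_f_f)
    then show ?thesis using continuous_open_preimage[OF cont U(4) W(1)] by simp
  qed
  have 2: "smooth_obj (\<lambda>x. u (the_inv_into U (src G) x)) (src G g)"
    if "g \<in> U" "smooth_arr u g" for u g
    using smooth_at_compose[OF obj_manifold arr_manifold U(5,4), of "src G g" u] that U(3)
    by (simp add: the_inv_into_f_f)
  show thesis using that[OF U(2) sliceI[OF U(1,3) 1 2]] .
qed

text \<open>The target map is the source map after inversion, so slices of \<open>tgt\<close> are inverses of slices of \<open>src\<close>.\<close>

lemma tgt_slice_exists: obtains U where "p \<in> U" "slice (tgt G) U"
proof -
  obtain V where V: "\<iota> p \<in> V" "slice (src G) V" using src_slice_exists .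
  have vimage_eq: "\<iota> ` W = \<iota> -` W" for W
    by (auto simp: image_iff) (metis ginv_ginv)
  have op: "open (\<iota> ` W)" if "open W" for W
    unfolding vimage_eq using that continuous_structure_maps(3) by (simp add: continuous_on_open_vimage)
  have t: "tgt G g = src G (\<iota> g)" for g by (simp add: src_ginv)
  let ?U = "\<iota> ` V"
  have inj: "inj_on (src G) V" using slice_inj[OF V(2)] .
  then have inj': "inj_on (tgt G) ?U" by (auto simp: inj_on_def t)
  have inv: "the_inv_into ?U (tgt G) x = \<iota> (the_inv_into V (src G) x)" if x: "x \<in> src G ` V" for x
  proof -
    obtain g where g: "g \<in> V" "x = src G g" using x by blast
    then have "the_inv_into ?U (tgt G) (tgt G (\<iota> g)) = \<iota> g" by (intro the_inv_into_f_f[OF inj']) auto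
    then show ?thesis using g the_inv_into_f_f[OF inj g(1)] by (simp add: tgt_ginv)
  qed
  have "slice (tgt G) ?U"
  proof (rule sliceI[OF op[OF slice_open[OF V(2)]] inj'])
    show "open (tgt G ` W)" if "open W" "W \<subseteq> ?U" for W
    proof -
      have "tgt G ` W = src G ` \<iota> ` W" by (auto simp: t image_image)
      moreover have "\<iota> ` W \<subseteq> V" using that(2) by auto
      ultimately show ?thesis using slice_image_open[OF V(2) op[OF that(1)]] by simp
    qed
    show "smooth_obj (\<lambda>x. u (the_inv_into ?U (tgt G) x)) (tgt G g)"
      if "g \<in> ?U" "smooth_arr u g" for u g
    proof (rule smooth_at_cong)
      have g: "\<iota> g \<in> V" using that(1) by auto
      have "smooth_arr (\<lambda>g. u (\<iota> g)) (\<iota> g)" using smooth_arr_pullback(3)[of u "\<iota> g"] that(2) by simp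
      from slice_smooth[OF V(2) g this]
      show "smooth_obj (\<lambda>x. u (\<iota> (the_inv_into V (src G) x))) (tgt G g)" unfolding t .
      show "open (src G ` V)" using slice_image_open[OF V(2) slice_open[OF V(2)]] by simp
      show "tgt G g \<in> src G ` V" using g by (simp add: t)
    qed (simp add: inv)
  qed
  moreover have "p \<in> ?U" using V(1) by (metis ginv_ginv imageI)
  ultimately show thesis using that by blast
qed

definition bisection :: "'g set \<Rightarrow> bool" where
  "bisection U \<longleftrightarrow> slice (src G) U \<and> slice (tgt G) U"

lemma bisection_exists: obtains U where "p \<in> U" "bisection U"
proof -
  obtain U V where "p \<in> U" "slice (src G) U" "p \<in> V" "slice (tgt G) V"
    using src_slice_exists tgt_slice_exists by metis
  moreover from this have "open (U \<inter> V)" by (blast intro: slice_open)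
  ultimately show thesis
    using that[of "U \<inter> V"] slice_subset[of _ _ "U \<inter> V"] unfolding bisection_def by blast
qed

text \<open>The two maps over which balanced tensor products are formed.\<close>

definition fibre_map :: "('g \<Rightarrow> 'x) \<Rightarrow> bool" where
  "fibre_map r \<longleftrightarrow> r = src G \<or> r = tgt G"

lemma fibre_map_src [simp]: "fibre_map (src G)" and fibre_map_tgt [simp]: "fibre_map (tgt G)"
  by (auto simp: fibre_map_def)

lemma bisection_slice: "bisection U \<Longrightarrow> fibre_map r \<Longrightarrow> slice r U"
  by (auto simp: bisection_def fibre_map_def)

lemma bisection_inj: "bisection U \<Longrightarrow> fibre_map r \<Longrightarrow> g \<in> U \<Longrightarrow> g' \<in> U \<Longrightarrow> r g = r g' \<Longrightarrow> g = g'"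
  using inj_onD[OF slice_inj[OF bisection_slice]] by metis

lemma continuous_fibre_map: "fibre_map r \<Longrightarrow> continuous_on UNIV r"
  using continuous_structure_maps by (auto simp: fibre_map_def)

lemma smooth_arr_fibre_map: "fibre_map r \<Longrightarrow> smooth_obj f (r g) \<Longrightarrow> smooth_arr (\<lambda>g. f (r g)) g"
  using smooth_arr_pullback by (auto simp: fibre_map_def)

text \<open>Because the source map is a local diffeomorphism, an arrow-valued map is smooth once it is
  continuous and has a smooth source. For the factors \<open>a\<^sup>-\<^sup>1 g\<close> in a convolution the source is that of \<open>g\<close>,
  so continuity of the multiplication makes them smooth in \<open>g\<close>.\<close>

lemma smooth_arr_lift:
  assumes "open N" "p \<in> N" "continuous_on N f" "\<And>q. q \<in> N \<Longrightarrow> src G (f q) = src G q"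
    and u: "smooth_arr u (f p)"
  shows "smooth_arr (\<lambda>q. u (f q)) p"
proof -
  obtain U where U: "f p \<in> U" "slice (src G) U" using src_slice_exists .
  let ?N = "N \<inter> f -` U"
  have "open ?N" using continuous_open_preimage[OF assms(3,1) slice_open[OF U(2)]] .
  have "smooth_obj (\<lambda>x. u (the_inv_into U (src G) x)) (src G p)"
    using slice_smooth[OF U(2,1) u] assms(2,4) by simp
  then have "smooth_arr (\<lambda>q. u (the_inv_into U (src G) (src G q))) p"
    by (rule smooth_arr_pullback)
  then show ?thesis
  proof (rule smooth_at_cong[OF _ \<open>open ?N\<close>])
    fix q assume "q \<in> ?N"
    then show "u (f q) = u (the_inv_into U (src G) (src G q))"
      using assms(4) slice_the_inv[OF U(2), of "f q"] by simp
  qed (use U assms in auto)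
qed


section \<open>Compactly supported smooth functions\<close>

abbreviation "\<H> \<equiv> convolution_algebra G"
abbreviation "\<A> \<equiv> base_algebra G"
abbreviation "Cc \<equiv> carrier \<H>"
abbreviation "Cobj \<equiv> carrier \<A>"
abbreviation "conv \<equiv> convolution G"
abbreviation "unit_ext \<equiv> unit_extension G"

lemma Cobj_iff: "f \<in> Cobj \<longleftrightarrow> (\<forall>x. smooth_obj f x)"
  by (simp add: base_algebra_def smooth_complex_iff)

lemma CcI:
  assumes "\<And>g. smooth_arr u g" "compact K" "\<And>g. g \<notin> K \<Longrightarrow> u g = 0"
  shows "u \<in> Cc"
proof -
  have "{g. u g \<noteq> 0} \<subseteq> K" using assms(3) by auto
  then have "closure {g. u g \<noteq> 0} \<subseteq> K" by (simp add: assms(2) closure_minimal compact_imp_closed)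
  then have "compact (closure {g. u g \<noteq> 0})"
    using compact_Int_closed[OF assms(2) closed_closure] by (metis Int_absorb1)
  moreover have "smooth_complex (arr_atlas G) u" unfolding smooth_complex_iff using assms(1) by (rule allI)
  ultimately show ?thesis by (simp add: convolution_algebra_def)
qed

lemma Cc_smooth: "u \<in> Cc \<Longrightarrow> smooth_arr u g"
  by (simp add: convolution_algebra_def smooth_complex_iff)

lemma Cc_support:
  assumes "u \<in> Cc" obtains K where "compact K" "\<And>g. g \<notin> K \<Longrightarrow> u g = 0"
proof (rule that[of "closure {g. u g \<noteq> 0}"])
  show "u g = 0" if "g \<notin> closure {g. u g \<noteq> 0}" for g
    using that closure_subset[of "{g. u g \<noteq> 0}"] by blast
qed (use assms in \<open>simp add: convolution_algebra_def\<close>)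

lemma Cc_zero: "(\<lambda>g. 0) \<in> Cc"
  by (rule CcI[of _ "{}"]) (auto intro: arr.smooth_at_const)

lemma Cc_add:
  assumes "u \<in> Cc" "v \<in> Cc" shows "(\<lambda>g. u g + v g) \<in> Cc"
proof -
  obtain K where "compact K" "\<And>g. g \<notin> K \<Longrightarrow> u g = 0" using Cc_support[OF assms(1)] by metis
  moreover obtain L where "compact L" "\<And>g. g \<notin> L \<Longrightarrow> v g = 0" using Cc_support[OF assms(2)] by metis
  ultimately show ?thesis
    by (intro CcI[OF arr.smooth_at_add compact_Un[of K L]]) (auto intro: Cc_smooth assms)
qed

lemma Cc_mult_smooth: "(\<And>g. smooth_arr a g) \<Longrightarrow> u \<in> Cc \<Longrightarrow> (\<lambda>g. a g * u g) \<in> Cc"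
  by (rule Cc_support[of u], assumption) (rule CcI[OF arr.smooth_at_mult], auto intro: Cc_smooth)

lemma Cc_smult: "u \<in> Cc \<Longrightarrow> (\<lambda>g. c * u g) \<in> Cc"
  by (rule Cc_mult_smooth) (auto intro: arr.smooth_at_const)

lemma Cc_sum: "finite I \<Longrightarrow> (\<And>i. i \<in> I \<Longrightarrow> u i \<in> Cc) \<Longrightarrow> (\<lambda>g. \<Sum>i\<in>I. u i g) \<in> Cc"
  by (induction I rule: finite_induct) (auto intro: Cc_zero Cc_add)

lemma Cc_fibre_mult:
  assumes "fibre_map r" "f \<in> Cobj" "u \<in> Cc" shows "(\<lambda>g. f (r g) * u g) \<in> Cc"
  using assms Cobj_iff smooth_arr_fibre_map by (intro Cc_mult_smooth) auto

lemma Cc_ginv: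
  assumes "u \<in> Cc" shows "(\<lambda>g. u (\<iota> g)) \<in> Cc"
proof -
  obtain K where K: "compact K" "\<And>g. g \<notin> K \<Longrightarrow> u g = 0" using Cc_support[OF assms] by metis
  have "compact (\<iota> ` K)"
    using K(1) continuous_structure_maps(3) by (blast intro: compact_continuous_image continuous_on_subset)
  then show ?thesis
  proof (rule CcI[rotated])
    show "u (\<iota> g) = 0" if "g \<notin> \<iota> ` K" for g using that K(2) by (metis ginv_ginv imageI)
  qed (intro smooth_arr_pullback(3) Cc_smooth assms)
qed

lemma Cc_cnj: "u \<in> Cc \<Longrightarrow> (\<lambda>g. cnj (u g)) \<in> Cc"
  by (rule Cc_support[of u], assumption) (rule CcI[OF arr.smooth_at_cnj], auto intro: Cc_smooth)

text \<open>Open because \<open>x \<mapsto> 1\<^sub>x\<close> is a continuous section of the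
  local diffeomorphism \<open>src\<close>, compact because the object space is.\<close>

lemma units_compact_open: "compact (range (idn G))" "open (range (idn G))"
proof -
  show "compact (range (idn G))"
    using compact_continuous_image[OF continuous_structure_maps(4) compact_objects] .
  show "open (range (idn G))"
  proof (subst open_subopen, intro ballI)
    fix p assume "p \<in> range (idn G)"
    then obtain x where p: "p = idn G x" by auto
    obtain U where U: "p \<in> U" "slice (src G) U" using src_slice_exists .
    have "open (idn G -` U)"
      using slice_open[OF U(2)] continuous_structure_maps(4) by (simp add: continuous_on_open_vimage)
    then have "open (src G -` (idn G -` U))"
      using continuous_structure_maps(1) by (simp add: continuous_on_open_vimage)
    then have op: "open (U \<inter> src G -` (idn G -` U))" using slice_open[OF U(2)] by blast
    have "g \<in> range (idn G)" if "g \<in> U \<inter> src G -` (idn G -` U)" for g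
    proof -
      have "src G (idn G (src G g)) = src G g" by (rule src_idn)
      then have "idn G (src G g) = g" using inj_onD[OF slice_inj[OF U(2)]] that by blast
      then show ?thesis by (metis rangeI)
    qed
    then show "\<exists>T. open T \<and> p \<in> T \<and> T \<subseteq> range (idn G)"
      using op U(1) p by (intro exI[of _ "U \<inter> src G -` (idn G -` U)"]) (auto simp: src_idn)
  qed
qed

lemma unit_extension_Cc:
  assumes "f \<in> Cobj" shows "unit_ext f \<in> Cc"
proof (rule CcI[OF _ units_compact_open(1)])
  fix g
  show "smooth_arr (unit_ext f) g"
  proof (cases "g \<in> range (idn G)")
    case True
    have "smooth_arr (\<lambda>g. f (src G g)) g"
      using assms by (intro smooth_arr_pullback(1)) (simp add: Cobj_iff)
    then show ?thesis
      by (rule smooth_at_cong[OF _ units_compact_open(2) True]) (simp add: unit_extension_def)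
  next
    case False
    then show ?thesis
      using compact_imp_closed[OF units_compact_open(1)]
      by (intro smooth_at_cong[OF arr.smooth_at_const[where c = 0], of "- range (idn G)"])
        (simp_all add: unit_extension_def open_Compl)
  qed
qed (auto simp: unit_extension_def)

text \<open>A compact support is covered by finitely many bisections, and each meets a fibre in at most one arrow.\<close>

lemma Cc_finite_fibre:
  assumes "u \<in> Cc" "fibre_map r" shows "finite {g. r g = x \<and> u g \<noteq> 0}"
proof -
  obtain K where K: "compact K" "\<And>g. g \<notin> K \<Longrightarrow> u g = 0" using Cc_support[OF assms(1)] by metis
  have "\<forall>p. \<exists>V. p \<in> V \<and> bisection V" using bisection_exists by metis
  then obtain V where V: "\<And>p. p \<in> V p" "\<And>p. bisection (V p)" by metis
  have "\<And>p. open (V p)" using V(2) slice_open by (auto simp: bisection_def)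
  then obtain J where J: "finite J" "K \<subseteq> (\<Union>p\<in>J. V p)"
  proof (rule compactE_image[OF K(1), of UNIV V])
    show "K \<subseteq> (\<Union>p\<in>UNIV. V p)" using V(1) by blast
  qed auto
  have "finite {g \<in> V p. r g = x}" for p
  proof (cases "\<exists>g. g \<in> V p \<and> r g = x")
    case True
    then obtain g where "g \<in> V p" "r g = x" by blast
    then have "{g \<in> V p. r g = x} = {g}" using bisection_inj[OF V(2) assms(2)] by auto
    then show ?thesis by simp
  next
    case False
    then have "{g \<in> V p. r g = x} = {}" by blast
    then show ?thesis by (simp only: finite.emptyI)
  qed
  moreover have "{g. r g = x \<and> u g \<noteq> 0} \<subseteq> (\<Union>p\<in>J. {g \<in> V p. r g = x})"
    using J(2) K(2) by blast
  ultimately show ?thesis using J(1) by (meson finite_UN finite_subset)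
qed

text \<open>With the value \<open>0\<close> off \<open>r ` U\<close> this is the sum of \<open>u\<close> over the part of the fibre that lies in \<open>U\<close>.\<close>

definition push :: "('g \<Rightarrow> 'x) \<Rightarrow> 'g set \<Rightarrow> ('g \<Rightarrow> complex) \<Rightarrow> 'x \<Rightarrow> complex" where
  "push r U u x = (if x \<in> r ` U then u (the_inv_into U r x) else 0)"

lemma push_apply: "bisection U \<Longrightarrow> fibre_map r \<Longrightarrow> g \<in> U \<Longrightarrow> push r U u (r g) = u g"
  using slice_the_inv[OF bisection_slice] by (simp add: push_def)

text \<open>Smooth on \<open>r ` U\<close> by construction, and zero on the complement of the closed set \<open>r ` K\<close>; these two
  open sets cover the object space.\<close>

lemma push_Cobj:
  assumes U: "bisection U" "fibre_map r" and u: "u \<in> Cc"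
    and K: "compact K" "K \<subseteq> U" "\<And>g. g \<notin> K \<Longrightarrow> u g = 0"
  shows "push r U u \<in> Cobj"
proof -
  have sl: "slice r U" using bisection_slice[OF U] .
  have cl: "closed (r ` K)"
    using K(1) continuous_fibre_map[OF U(2)]
    by (blast intro: compact_imp_closed compact_continuous_image continuous_on_subset)
  have "smooth_obj (push r U u) x" for x
  proof (cases "x \<in> r ` U")
    case True
    then obtain g where g: "g \<in> U" "x = r g" by auto
    have "smooth_obj (\<lambda>x. u (the_inv_into U r x)) x"
      using slice_smooth[OF sl g(1) Cc_smooth[OF u]] g(2) by simp
    then show ?thesis
      by (rule smooth_at_cong[of _ _ _ "r ` U"]) (use slice_image_open[OF sl slice_open[OF sl]] True in \<open>auto simp: push_def\<close>)
  next
    case False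
    have "push r U u y = 0" if "y \<notin> r ` K" for y
      using that K(3) slice_the_inv[OF sl] unfolding push_def by (metis imageE imageI)
    then show ?thesis
      using False K(2) cl by (intro smooth_at_cong[OF obj.smooth_at_const[where c = 0], of "- r ` K"]) auto
  qed
  then show ?thesis by (simp add: Cobj_iff)
qed

text \<open>A substitute for a partition of unity on a compact set \<open>K\<close>, in the factored form
  \<open>1 = \<Sum> \<phi>\<^sub>j \<theta>\<^sub>j\<close> on \<open>K\<close>. The factor \<open>\<theta>\<^sub>j u\<close> can be pushed down to the objects while \<open>\<phi>\<^sub>j\<close> stays behind, so
  every \<open>u\<close> with support in \<open>K\<close> is a combination of the fixed functions \<open>\<phi>\<^sub>j\<close> with coefficients from
  the base algebra. Since \<open>\<theta>\<^sub>j\<close> is a quotient that may fail to be smooth outside \<open>K\<close>, smoothness is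
  demanded of \<open>\<theta>\<^sub>j u\<close> only.\<close>

definition bisection_partition ::
  "'g set \<Rightarrow> 'g set \<Rightarrow> ('g \<Rightarrow> 'g set) \<Rightarrow> ('g \<Rightarrow> 'g set) \<Rightarrow> ('g \<Rightarrow> 'g \<Rightarrow> complex) \<Rightarrow> ('g \<Rightarrow> 'g \<Rightarrow> complex) \<Rightarrow> bool"
where
  "bisection_partition K J U C \<phi> \<theta> \<longleftrightarrow> finite J \<and>
     (\<forall>j\<in>J. bisection (U j) \<and> \<phi> j \<in> Cc \<and> compact (C j) \<and> C j \<subseteq> U j \<and>
        (\<forall>g. g \<notin> C j \<longrightarrow> \<phi> j g = 0 \<and> \<theta> j g = 0) \<and>
        (\<forall>u\<in>Cc. (\<forall>g. g \<notin> K \<longrightarrow> u g = 0) \<longrightarrow> (\<lambda>g. \<theta> j g * u g) \<in> Cc)) \<and>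
     (\<forall>g\<in>K. (\<Sum>j\<in>J. \<phi> j g * \<theta> j g) = 1)"

lemma bisection_partitionD:
  assumes "bisection_partition K J U C \<phi> \<theta>"
  shows "finite J" "\<And>j. j \<in> J \<Longrightarrow> bisection (U j)" "\<And>j. j \<in> J \<Longrightarrow> \<phi> j \<in> Cc"
    "\<And>j. j \<in> J \<Longrightarrow> compact (C j)" "\<And>j. j \<in> J \<Longrightarrow> C j \<subseteq> U j"
    "\<And>j g. j \<in> J \<Longrightarrow> g \<notin> C j \<Longrightarrow> \<phi> j g = 0" "\<And>j g. j \<in> J \<Longrightarrow> g \<notin> C j \<Longrightarrow> \<theta> j g = 0"
    "\<And>j u. j \<in> J \<Longrightarrow> u \<in> Cc \<Longrightarrow> (\<And>g. g \<notin> K \<Longrightarrow> u g = 0) \<Longrightarrow> (\<lambda>g. \<theta> j g * u g) \<in> Cc"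
    "\<And>g. g \<in> K \<Longrightarrow> (\<Sum>j\<in>J. \<phi> j g * \<theta> j g) = 1"
  using assms unfolding bisection_partition_def by blast+

text \<open>Take bump functions \<open>\<phi>\<^sub>j \<ge> 0\<close> supported in bisections, finitely many of which suffice to be
  positive somewhere at each point of \<open>K\<close>, and \<open>\<theta>\<^sub>j = \<phi>\<^sub>j / \<Sum> \<phi>\<^sub>i\<^sup>2\<close>.\<close>

lemma bisection_partition_exists:
  assumes "compact K"
  shows "\<exists>J U C \<phi> \<theta>. bisection_partition K J U C \<phi> \<theta>"
proof -
  have "\<forall>p. \<exists>U. p \<in> U \<and> bisection U" using bisection_exists by metis
  then obtain U where U: "\<And>p. p \<in> U p" "\<And>p. bisection (U p)" by metis
  have opU: "open (U p)" for p using U(2)[of p] slice_open by (auto simp: bisection_def)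
  have "\<exists>b C. smooth_complex (arr_atlas G) (\<lambda>q. of_real (b q)) \<and> (\<forall>q. b q \<ge> 0) \<and> b p > (0 :: real) \<and>
      compact C \<and> C \<subseteq> U p \<and> (\<forall>q. q \<notin> C \<longrightarrow> b q = 0)" for p
    by (rule manifold_bump[OF arr_manifold opU U(1)]) blast
  then obtain b C where b: "\<And>p. smooth_complex (arr_atlas G) (\<lambda>q. of_real (b p q))" "\<And>p q. b p q \<ge> (0 :: real)"
    "\<And>p. b p p > 0" "\<And>p. compact (C p)" "\<And>p. C p \<subseteq> U p" "\<And>p q. q \<notin> C p \<Longrightarrow> b p q = 0"
    by metis
  let ?\<phi> = "\<lambda>p q. complex_of_real (b p q)"
  have \<phi>: "smooth_arr (?\<phi> p) q" for p q using b(1) by (simp add: smooth_complex_iff)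
  have \<phi>Cc: "?\<phi> p \<in> Cc" for p by (rule CcI[OF \<phi> b(4)[of p]]) (simp add: b(6))
  have "open {q. b p q > 0}" for p
  proof (subst open_subopen, intro ballI)
    fix q assume q: "q \<in> {q. b p q > 0}"
    obtain W where W: "open W" "q \<in> W" "continuous_on W (?\<phi> p)"
      using arr.smooth_at_representative[OF \<phi>[of p q]] by metis
    then have "open (W \<inter> ?\<phi> p -` (- {0}))"
      by (intro continuous_open_preimage) auto
    moreover have "W \<inter> ?\<phi> p -` (- {0}) \<subseteq> {q. b p q > 0}"
      using b(2) by (auto simp: less_le)
    ultimately show "\<exists>T. open T \<and> q \<in> T \<and> T \<subseteq> {q. b p q > 0}"
      using q W(2) by (intro exI[of _ "W \<inter> ?\<phi> p -` (- {0})"]) auto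
  qed
  then obtain J where J: "finite J" "K \<subseteq> (\<Union>p\<in>J. {q. b p q > 0})"
  proof (rule compactE_image[OF assms, of UNIV "\<lambda>p. {q. b p q > 0}"])
    show "K \<subseteq> (\<Union>p\<in>UNIV. {q. b p q > 0})" using b(3) by blast
  qed auto
  define \<sigma> where "\<sigma> q = (\<Sum>p\<in>J. ?\<phi> p q * ?\<phi> p q)" for q
  have \<sigma>0: "\<sigma> q \<noteq> 0" if q: "q \<in> K" for q
  proof -
    obtain p where "p \<in> J" "b p q > 0" using q J(2) by blast
    then have "(\<Sum>p\<in>J. b p q * b p q) > 0"
      using J(1) by (intro sum_pos2[of _ p]) auto
    moreover have "\<sigma> q = of_real (\<Sum>p\<in>J. b p q * b p q)" by (simp add: \<sigma>_def)
    ultimately show ?thesis by (metis less_irrefl of_real_eq_0_iff)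
  qed
  have \<sigma>: "smooth_arr \<sigma> q" for q
    unfolding \<sigma>_def by (intro arr.smooth_at_sum J(1) arr.smooth_at_mult \<phi>)
  let ?\<theta> = "\<lambda>p q. ?\<phi> p q * inverse (\<sigma> q)"
  have "(\<lambda>q. ?\<theta> p q * u q) \<in> Cc" if "u \<in> Cc" "\<And>g. g \<notin> K \<Longrightarrow> u g = 0" for p u
  proof (rule CcI[OF _ assms])
    fix q
    show "smooth_arr (\<lambda>q. ?\<theta> p q * u q) q"
    proof (cases "q \<in> K")
      case True
      then show ?thesis
        by (intro arr.smooth_at_mult \<phi> arr.smooth_at_inverse \<sigma> \<sigma>0 Cc_smooth[OF that(1)])
    next
      case False
      then show ?thesis
        using compact_imp_closed[OF assms] that(2)
        by (intro smooth_at_cong[OF arr.smooth_at_const[where c = 0], of "- K"]) auto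
    qed
  qed (simp add: that(2))
  moreover have "(\<Sum>p\<in>J. ?\<phi> p q * ?\<theta> p q) = 1" if "q \<in> K" for q
  proof -
    have "(\<Sum>p\<in>J. ?\<phi> p q * ?\<theta> p q) = \<sigma> q * inverse (\<sigma> q)"
      by (simp add: \<sigma>_def sum_distrib_right mult.assoc)
    then show ?thesis using \<sigma>0[OF that] by simp
  qed
  ultimately have "bisection_partition K J U C ?\<phi> ?\<theta>"
    unfolding bisection_partition_def using J(1) U(2) \<phi>Cc b(4,5,6) by simp
  then show ?thesis by blast
qed

section \<open>The convolution algebra\<close>


lemma bisection_decomposition:
  assumes "u \<in> Cc"
  obtains J :: "'g set" and U C w where "finite J" "\<And>j. j \<in> J \<Longrightarrow> bisection (U j)" "\<And>j. j \<in> J \<Longrightarrow> w j \<in> Cc"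
    "\<And>j. j \<in> J \<Longrightarrow> compact (C j)" "\<And>j. j \<in> J \<Longrightarrow> C j \<subseteq> U j" "\<And>j g. j \<in> J \<Longrightarrow> g \<notin> C j \<Longrightarrow> w j g = 0"
    "u = (\<lambda>g. \<Sum>j\<in>J. w j g)"
proof -
  obtain K where K: "compact K" "\<And>g. g \<notin> K \<Longrightarrow> u g = 0" using Cc_support[OF assms] by metis
  obtain J U C \<phi> \<theta> where "bisection_partition K J U C \<phi> \<theta>" using bisection_partition_exists[OF K(1)] by blast
  note P = bisection_partitionD[OF this]
  show thesis
  proof (rule that[OF P(1,2) _ P(4,5)])
    show "(\<lambda>g. \<phi> j g * (\<theta> j g * u g)) \<in> Cc" if "j \<in> J" for j
      by (rule Cc_mult_smooth[OF Cc_smooth[OF P(3)[OF that]] P(8)[OF that assms K(2)]])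
    show "\<phi> j g * (\<theta> j g * u g) = 0" if "j \<in> J" "g \<notin> C j" for j g
      using P(6)[OF that] by simp
    show "u = (\<lambda>g. \<Sum>j\<in>J. \<phi> j g * (\<theta> j g * u g))"
    proof
      fix g
      have "(\<Sum>j\<in>J. \<phi> j g * (\<theta> j g * u g)) = (\<Sum>j\<in>J. \<phi> j g * \<theta> j g) * u g"
        by (simp add: sum_distrib_right mult.assoc)
      then show "u g = (\<Sum>j\<in>J. \<phi> j g * (\<theta> j g * u g))"
        using P(9)[of g] K(2)[of g] by (cases "g \<in> K") auto
    qed
  qed
qed

subsection \<open>Summation over fibres\<close>

definition fibre_sum :: "('g \<Rightarrow> 'x) \<Rightarrow> ('g \<Rightarrow> complex) \<Rightarrow> 'x \<Rightarrow> complex" where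
  "fibre_sum r u x = (\<Sum>g | r g = x \<and> u g \<noteq> 0. u g)"

text \<open>Finite index sets that contain the support in the fibre are interchangeable; a common one for
  finitely many functions is what \<open>finite_fibre_support\<close> provides.\<close>

lemma fibre_sum_eq:
  assumes "finite F" "\<And>a. a \<in> F \<Longrightarrow> r a = x" "\<And>a. r a = x \<Longrightarrow> u a \<noteq> 0 \<Longrightarrow> a \<in> F"
  shows "fibre_sum r u x = (\<Sum>a\<in>F. u a)"
  unfolding fibre_sum_def by (rule sum.mono_neutral_left) (use assms in auto)

lemma finite_fibre_support:
  assumes "finite I" "\<forall>i\<in>I. u i \<in> Cc" "fibre_map r"
  shows "\<exists>F. finite F \<and> (\<forall>a\<in>F. r a = x) \<and> (\<forall>i\<in>I. \<forall>a. r a = x \<longrightarrow> u i a \<noteq> 0 \<longrightarrow> a \<in> F)"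
proof (intro exI[of _ "\<Union>i\<in>I. {a. r a = x \<and> u i a \<noteq> 0}"] conjI)
  show "finite (\<Union>i\<in>I. {a. r a = x \<and> u i a \<noteq> 0})"
    using assms Cc_finite_fibre by (intro finite_UN_I) auto
qed auto

lemma fibre_sum_sum:
  assumes "finite I" "\<And>i. i \<in> I \<Longrightarrow> u i \<in> Cc" "fibre_map r"
  shows "fibre_sum r (\<lambda>g. \<Sum>i\<in>I. u i g) x = (\<Sum>i\<in>I. fibre_sum r (u i) x)"
proof -
  obtain F where F: "finite F" "\<And>a. a \<in> F \<Longrightarrow> r a = x" "\<And>i a. i \<in> I \<Longrightarrow> r a = x \<Longrightarrow> u i a \<noteq> 0 \<Longrightarrow> a \<in> F"
    using finite_fibre_support[of I u r x] assms by metis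
  have "fibre_sum r (\<lambda>g. \<Sum>i\<in>I. u i g) x = (\<Sum>a\<in>F. \<Sum>i\<in>I. u i a)"
    by (rule fibre_sum_eq[OF F(1,2)]) (auto elim!: sum.not_neutral_contains_not_neutral intro: F(3))
  also have "\<dots> = (\<Sum>i\<in>I. \<Sum>a\<in>F. u i a)" by (rule sum.swap)
  also have "\<dots> = (\<Sum>i\<in>I. fibre_sum r (u i) x)"
    using F by (intro sum.cong refl fibre_sum_eq[symmetric]) auto
  finally show ?thesis .
qed

text \<open>For a function supported in a bisection the fibre sum is its push-forward along the bisection.\<close>

lemma fibre_sum_Cobj:
  assumes "u \<in> Cc" "fibre_map r" shows "fibre_sum r u \<in> Cobj"
proof -
  obtain J :: "'g set" and U C w where D: "finite J" "\<And>j. j \<in> J \<Longrightarrow> bisection (U j)" "\<And>j. j \<in> J \<Longrightarrow> w j \<in> Cc"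
    "\<And>j. j \<in> J \<Longrightarrow> compact (C j)" "\<And>j. j \<in> J \<Longrightarrow> C j \<subseteq> U j" "\<And>j g. j \<in> J \<Longrightarrow> g \<notin> C j \<Longrightarrow> w j g = 0"
    "u = (\<lambda>g. \<Sum>j\<in>J. w j g)"
    by (rule bisection_decomposition[OF assms(1)]) blast
  have "fibre_sum r (w j) x = push r (U j) (w j) x" if j: "j \<in> J" for j x
  proof (cases "x \<in> r ` U j")
    case True
    then obtain g where g: "g \<in> U j" "x = r g" by blast
    have "fibre_sum r (w j) x = (\<Sum>a\<in>{g}. w j a)"
    proof (rule fibre_sum_eq)
      show "a \<in> {g}" if "r a = x" "w j a \<noteq> 0" for a
        using that D(5,6)[OF j] g bisection_inj[OF D(2)[OF j] assms(2), of a g] by blast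
    qed (use g in auto)
    then show ?thesis using g push_apply[OF D(2)[OF j] assms(2)] by simp
  next
    case False
    have "fibre_sum r (w j) x = (\<Sum>a\<in>{}. w j a)"
      by (rule fibre_sum_eq) (use False D(5,6)[OF j] in auto)
    then show ?thesis using False by (simp add: push_def)
  qed
  then have "fibre_sum r u x = (\<Sum>j\<in>J. push r (U j) (w j) x)" for x
    unfolding D(7) using fibre_sum_sum[OF D(1,3) assms(2)] by (simp cong: sum.cong)
  then have "fibre_sum r u = (\<lambda>x. \<Sum>j\<in>J. push r (U j) (w j) x)" by blast
  moreover have "push r (U j) (w j) \<in> Cobj" if "j \<in> J" for j
    by (rule push_Cobj[OF D(2)[OF that] assms(2) D(3)[OF that] D(4,5)[OF that] D(6)[OF that]])
  ultimately show ?thesis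
    using D(1) unfolding Cobj_iff by (auto intro: obj.smooth_at_sum)
qed

subsection \<open>Convolution\<close>

text \<open>A factorisation \<open>g = a b\<close> is determined by \<open>a\<close>, an arbitrary arrow with the target of \<open>g\<close>.\<close>

lemma convolution_fibre_sum:
  "conv u v g = fibre_sum (tgt G) (\<lambda>a. u a * v (\<iota> a \<diamondop> g)) (tgt G g)"
proof -
  let ?f = "\<lambda>a. (a, \<iota> a \<diamondop> g)" and ?S = "{a. tgt G a = tgt G g \<and> u a * v (\<iota> a \<diamondop> g) \<noteq> 0}"
  have "{(a, b). src G a = tgt G b \<and> a \<diamondop> b = g \<and> u a * v b \<noteq> 0} = ?f ` ?S" (is "?L = _")
  proof (intro equalityI subsetI)
    fix p assume "p \<in> ?L"
    then obtain a b where p: "p = (a, b)" "src G a = tgt G b" "a \<diamondop> b = g" "u a * v b \<noteq> 0" by auto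
    then have "b = \<iota> a \<diamondop> g" "tgt G a = tgt G g"
      using mul_ginv_cancel[OF p(2)] tgt_gmul[OF p(2)] by simp_all
    then show "p \<in> ?f ` ?S" using p by (intro image_eqI[of _ _ a]) simp_all
  next
    fix p assume "p \<in> ?f ` ?S"
    then obtain a where p: "p = ?f a" and "a \<in> ?S" by (rule imageE)
    then have "tgt G a = tgt G g" "u a * v (\<iota> a \<diamondop> g) \<noteq> 0" by simp_all
    then show "p \<in> ?L"
      unfolding p using ginv_mul_cancel[of a g] tgt_gmul[of "\<iota> a" g] by (simp add: src_ginv tgt_ginv)
  qed
  then show ?thesis
    unfolding convolution_def fibre_sum_def by (simp add: sum.reindex inj_on_def)
qed

lemma convolution_eq:
  assumes "finite F" "\<And>a. a \<in> F \<Longrightarrow> tgt G a = tgt G g" "\<And>a. tgt G a = tgt G g \<Longrightarrow> u a \<noteq> 0 \<Longrightarrow> a \<in> F"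
  shows "conv u v g = (\<Sum>a\<in>F. u a * v (\<iota> a \<diamondop> g))"
  unfolding convolution_fibre_sum
proof (rule fibre_sum_eq[OF assms(1,2)])
  show "a \<in> F" if "tgt G a = tgt G g" "u a * v (\<iota> a \<diamondop> g) \<noteq> 0" for a
    by (rule assms(3)[OF that(1)]) (use that(2) in force)
qed

text \<open>Inversion turns a factorisation \<open>g\<^sup>-\<^sup>1 = a b\<close> into the factorisation \<open>g = b\<^sup>-\<^sup>1 a\<^sup>-\<^sup>1\<close>. Statements about
  the source map are deduced from those about the target map in this way.\<close>

lemma convolution_ginv: "conv u v (\<iota> g) = conv (\<lambda>g. v (\<iota> g)) (\<lambda>g. u (\<iota> g)) g"
  unfolding convolution_def
  by (rule sum.reindex_bij_witness[where i = "\<lambda>(a, b). (\<iota> b, \<iota> a)" and j = "\<lambda>(a, b). (\<iota> b, \<iota> a)"])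
    (auto simp: src_ginv tgt_ginv mult.commute simp flip: ginv_mul)

lemma unit_extension_idn: "unit_ext f (idn G x) = f x"
  by (simp add: unit_extension_def src_idn)

lemma unit_extension_nonzero: "unit_ext f a \<noteq> 0 \<Longrightarrow> a = idn G (tgt G a) \<and> a = idn G (src G a)"
  by (auto simp: unit_extension_def src_idn tgt_idn split: if_splits)

lemma convolution_unit_left: "conv (unit_ext f) u = (\<lambda>g. f (tgt G g) * u g)"
proof
  fix g
  have "conv (unit_ext f) u g
      = (\<Sum>a\<in>{idn G (tgt G g)}. unit_ext f a * u (\<iota> a \<diamondop> g))"
  proof (rule convolution_eq)
    show "a \<in> {idn G (tgt G g)}" if "tgt G a = tgt G g" "unit_ext f a \<noteq> 0" for a
      using unit_extension_nonzero[OF that(2)] that(1) by simp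
  qed (auto simp: tgt_idn)
  then show "conv (unit_ext f) u g = f (tgt G g) * u g"
    by (simp add: unit_extension_idn idn_left)
qed

lemma unit_extension_ginv: "unit_ext f (\<iota> g) = unit_ext f g"
proof (cases "g \<in> range (idn G)")
  case False
  then show ?thesis by (simp add: ginv_in_units_iff unit_extension_def)
qed auto

lemma convolution_unit_right: "conv u (unit_ext f) = (\<lambda>g. u g * f (src G g))"
proof
  fix g
  have "conv u (unit_ext f) g = conv (\<lambda>g. unit_ext f (\<iota> g)) (\<lambda>g. u (\<iota> g)) (\<iota> g)"
    using convolution_ginv[of u "unit_ext f" "\<iota> g"] by simp
  also have "\<dots> = u g * f (src G g)"
    unfolding unit_extension_ginv convolution_unit_left by (simp add: tgt_ginv)
  finally show "conv u (unit_ext f) g = u g * f (src G g)" .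
qed

lemma convolution_sum_left:
  assumes "finite I" "\<And>i. i \<in> I \<Longrightarrow> u i \<in> Cc"
  shows "conv (\<lambda>g. \<Sum>i\<in>I. u i g) v g = (\<Sum>i\<in>I. conv (u i) v g)"
proof -
  obtain F where F: "finite F" "\<And>a. a \<in> F \<Longrightarrow> tgt G a = tgt G g"
    "\<And>i a. i \<in> I \<Longrightarrow> tgt G a = tgt G g \<Longrightarrow> u i a \<noteq> 0 \<Longrightarrow> a \<in> F"
    using finite_fibre_support[of I u "tgt G" "tgt G g"] assms fibre_map_tgt by metis
  have "conv (\<lambda>g. \<Sum>i\<in>I. u i g) v g = (\<Sum>a\<in>F. (\<Sum>i\<in>I. u i a) * v (\<iota> a \<diamondop> g))"
    by (rule convolution_eq[OF F(1,2)]) (auto elim!: sum.not_neutral_contains_not_neutral intro: F(3))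
  also have "\<dots> = (\<Sum>i\<in>I. \<Sum>a\<in>F. u i a * v (\<iota> a \<diamondop> g))"
    unfolding sum_distrib_right by (rule sum.swap)
  also have "\<dots> = (\<Sum>i\<in>I. conv (u i) v g)"
    by (intro sum.cong refl convolution_eq[OF F(1,2) F(3), symmetric])
  finally show ?thesis .
qed

lemma slice_inverse_continuous:
  assumes "slice r U" shows "continuous_on (r ` U) (the_inv_into U r)"
proof -
  have op: "open (r ` U)" using slice_image_open[OF assms slice_open[OF assms]] by simp
  have "the_inv_into U r -` W \<inter> r ` U = r ` (U \<inter> W)" for W
    using slice_the_inv[OF assms] by auto
  moreover have "open (r ` (U \<inter> W))" if "open W" for W
    using slice_image_open[OF assms open_Int[OF slice_open[OF assms] that]] by simp
  ultimately show ?thesis unfolding continuous_on_open_vimage[OF op] by simp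
qed

text \<open>The support lies in the product of the two supports, the image under multiplication of a closed
  subset of a compact set.\<close>

lemma convolution_support:
  assumes "compact K" "\<And>g. g \<notin> K \<Longrightarrow> u g = 0" "compact L" "\<And>g. g \<notin> L \<Longrightarrow> v g = 0"
  obtains M where "compact M" "\<And>g. g \<notin> M \<Longrightarrow> conv u v g = 0"
proof (rule that)
  let ?D = "{p. src G (fst p) = tgt G (snd p)}"
  have "closed ?D"
    by (intro closed_Collect_eq continuous_on_compose2[OF continuous_structure_maps(1)]
        continuous_on_compose2[OF continuous_structure_maps(2)] continuous_on_fst continuous_on_snd
        continuous_on_id subset_UNIV)
  then have "compact (K \<times> L \<inter> ?D)" using assms by (intro compact_Int_closed compact_Times)
  moreover have "continuous_on (K \<times> L \<inter> ?D) (\<lambda>(g, h). g \<diamondop> h)"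
    by (rule continuous_on_subset[OF continuous_mul]) auto
  ultimately show "compact ((\<lambda>(g, h). g \<diamondop> h) ` (K \<times> L \<inter> ?D))"
    by (rule compact_continuous_image[rotated])
  show "conv u v g = 0" if g: "g \<notin> (\<lambda>(g, h). g \<diamondop> h) ` (K \<times> L \<inter> ?D)" for g
  proof -
    have "{(a, b). src G a = tgt G b \<and> a \<diamondop> b = g \<and> u a * v b \<noteq> 0} = {}"
    proof (rule ccontr)
      assume "{(a, b). src G a = tgt G b \<and> a \<diamondop> b = g \<and> u a * v b \<noteq> 0} \<noteq> {}"
      then obtain a b where "src G a = tgt G b" "a \<diamondop> b = g" "u a * v b \<noteq> 0" by auto
      moreover from this have "a \<in> K" "b \<in> L" using assms(2,4) by auto
      ultimately have "g \<in> (\<lambda>(g, h). g \<diamondop> h) ` (K \<times> L \<inter> ?D)"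
        by (intro image_eqI[of _ _ "(a, b)"]) auto
      then show False using g by contradiction
    qed
    then show ?thesis unfolding convolution_def by (simp only: sum.empty)
  qed
qed

text \<open>For \<open>u\<close> supported in a bisection \<open>U\<close>, the sum defining \<open>u * v\<close> at \<open>g\<close> has at most one term: the
  factorisation \<open>g = a (a\<^sup>-\<^sup>1 g)\<close> with \<open>a\<close> the arrow of \<open>U\<close> that has the target of \<open>g\<close>.\<close>

lemma convolution_Cc_bisection:
  assumes U: "bisection U" and u: "u \<in> Cc" and K: "compact K" "K \<subseteq> U" "\<And>g. g \<notin> K \<Longrightarrow> u g = 0"
    and v: "v \<in> Cc"
  shows "conv u v \<in> Cc"
proof -
  obtain L where L: "compact L" "\<And>g. g \<notin> L \<Longrightarrow> v g = 0" using Cc_support[OF v] by metis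
  obtain M where M: "compact M" "\<And>g. g \<notin> M \<Longrightarrow> conv u v g = 0"
    using convolution_support[of K u L v] K(1,3) L by metis
  have sl: "slice (tgt G) U" using U by (simp add: bisection_def)
  define \<tau> where "\<tau> g = the_inv_into U (tgt G) (tgt G g)" for g
  let ?N = "tgt G -` (tgt G ` U)"
  have opN: "open ?N"
    using slice_image_open[OF sl slice_open[OF sl]] continuous_structure_maps(2)
    by (simp add: continuous_on_open_vimage)
  have \<tau>: "\<tau> g \<in> U" "tgt G (\<tau> g) = tgt G g" if "g \<in> ?N" for g
    using that slice_the_inv[OF sl] by (auto simp: \<tau>_def)
  have eq: "conv u v g = push (tgt G) U u (tgt G g) * v (\<iota> (\<tau> g) \<diamondop> g)" if "g \<in> ?N" for g
  proof -
    have "conv u v g = (\<Sum>a\<in>{\<tau> g}. u a * v (\<iota> a \<diamondop> g))"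
    proof (rule convolution_eq)
      show "a \<in> {\<tau> g}" if "tgt G a = tgt G g" "u a \<noteq> 0" for a
        using bisection_inj[OF U fibre_map_tgt, of a "\<tau> g"] that \<tau>[OF \<open>g \<in> ?N\<close>] K by auto
    qed (use \<tau>[OF that] in auto)
    then show ?thesis using push_apply[OF U fibre_map_tgt \<tau>(1)[OF that], of u] \<tau>(2)[OF that] by simp
  qed
  have cont\<tau>: "continuous_on ?N \<tau>"
    unfolding \<tau>_def
    by (rule continuous_on_compose2[OF slice_inverse_continuous[OF sl]])
      (use continuous_on_subset[OF continuous_structure_maps(2)] in auto)
  have "continuous_on ?N (\<lambda>g. (\<iota> (\<tau> g), g))"
    by (intro continuous_on_Pair continuous_on_id continuous_on_compose2[OF continuous_structure_maps(3) cont\<tau>]) auto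
  moreover have "(\<lambda>g. (\<iota> (\<tau> g), g)) ` ?N \<subseteq> {(g, h). src G g = tgt G h}"
    by (intro image_subsetI) (simp add: src_ginv \<tau>(2))
  ultimately have "continuous_on ?N (\<lambda>g. case (\<iota> (\<tau> g), g) of (g, h) \<Rightarrow> g \<diamondop> h)"
    by (rule continuous_on_compose2[OF continuous_mul])
  then have cont: "continuous_on ?N (\<lambda>g. \<iota> (\<tau> g) \<diamondop> g)" by simp
  have smooth: "smooth_arr (conv u v) g" for g
  proof (cases "g \<in> ?N")
    case True
    have "push (tgt G) U u \<in> Cobj" by (rule push_Cobj[OF U fibre_map_tgt u K])
    then have "smooth_arr (\<lambda>g. push (tgt G) U u (tgt G g)) g"
      by (intro smooth_arr_pullback(2)) (simp add: Cobj_iff)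
    moreover have "smooth_arr (\<lambda>g. v (\<iota> (\<tau> g) \<diamondop> g)) g"
      using \<tau>(2) by (intro smooth_arr_lift[OF opN True cont] Cc_smooth[OF v])
        (simp add: src_gmul src_ginv)
    ultimately show ?thesis
      by (intro smooth_at_cong[OF arr.smooth_at_mult opN True eq])
  next
    case False
    have "closed (tgt G ` K)"
      using K(1) continuous_structure_maps(2)
      by (blast intro: compact_imp_closed compact_continuous_image continuous_on_subset)
    then have "open (tgt G -` (- (tgt G ` K)))"
      using continuous_structure_maps(2) by (simp add: continuous_on_open_vimage open_Compl)
    then show ?thesis
    proof (rule smooth_at_cong[OF arr.smooth_at_const[where c = 0]])
      show "g \<in> tgt G -` (- (tgt G ` K))" using False K(2) by auto
      fix q assume "q \<in> tgt G -` (- (tgt G ` K))"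
      then have "conv u v q = (\<Sum>a\<in>{}. u a * v (\<iota> a \<diamondop> q))"
        using K(3) by (intro convolution_eq) (auto simp: image_iff, metis)
      then show "conv u v q = 0" by simp
    qed
  qed
  show ?thesis by (rule CcI[OF smooth M])
qed

lemma convolution_Cc:
  assumes "u \<in> Cc" "v \<in> Cc" shows "conv u v \<in> Cc"
proof -
  obtain J :: "'g set" and U C w where D: "finite J" "\<And>j. j \<in> J \<Longrightarrow> bisection (U j)" "\<And>j. j \<in> J \<Longrightarrow> w j \<in> Cc"
    "\<And>j. j \<in> J \<Longrightarrow> compact (C j)" "\<And>j. j \<in> J \<Longrightarrow> C j \<subseteq> U j" "\<And>j g. j \<in> J \<Longrightarrow> g \<notin> C j \<Longrightarrow> w j g = 0"
    "u = (\<lambda>g. \<Sum>j\<in>J. w j g)"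
    by (rule bisection_decomposition[OF assms(1)]) blast
  have "conv u v = (\<lambda>g. \<Sum>j\<in>J. conv (w j) v g)"
    unfolding D(7) by (intro ext convolution_sum_left D(1,3))
  moreover have "conv (w j) v \<in> Cc" if "j \<in> J" for j
    by (rule convolution_Cc_bisection[OF D(2)[OF that] D(3)[OF that] D(4,5)[OF that] D(6)[OF that] assms(2)])
  ultimately show ?thesis using Cc_sum[OF D(1)] by simp
qed

text \<open>Both sides are the sum of \<open>u(a) v(b) w(b\<^sup>-\<^sup>1 a\<^sup>-\<^sup>1 g)\<close>; they differ in whether \<open>b\<close> or \<open>c = a b\<close> is the
  second summation variable. The third factor is arbitrary, which \<open>fibre_sum_convolution_tgt\<close> exploits.\<close>

lemma convolution_assoc:
  assumes "u \<in> Cc" "v \<in> Cc"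
  shows "conv (conv u v) w = conv u (conv v w)"
proof
  fix g
  define A where "A = {a. tgt G a = tgt G g \<and> u a \<noteq> 0}"
  define B where "B a = {b. tgt G b = src G a \<and> v b \<noteq> 0}" for a
  define C where "C = (\<Union>a\<in>A. (\<lambda>b. a \<diamondop> b) ` B a)"
  have finA: "finite A" unfolding A_def by (rule Cc_finite_fibre[OF assms(1) fibre_map_tgt])
  have finB: "finite (B a)" for a unfolding B_def by (rule Cc_finite_fibre[OF assms(2) fibre_map_tgt])
  have finC: "finite C" unfolding C_def using finA finB by blast
  have tC: "tgt G c = tgt G g" if "c \<in> C" for c
    using that by (auto simp: C_def A_def B_def tgt_gmul)
  have uv: "conv u v c = (\<Sum>a\<in>A. u a * v (\<iota> a \<diamondop> c))" if "tgt G c = tgt G g" for c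
    by (rule convolution_eq[OF finA]) (auto simp: A_def that)
  have "conv (conv u v) w g = (\<Sum>c\<in>C. conv u v c * w (\<iota> c \<diamondop> g))"
  proof (rule convolution_eq[OF finC tC])
    fix c assume c: "tgt G c = tgt G g" "conv u v c \<noteq> 0"
    then obtain a where a: "a \<in> A" "u a * v (\<iota> a \<diamondop> c) \<noteq> 0"
      using uv[OF c(1)] by (metis (no_types, lifting) sum.not_neutral_contains_not_neutral)
    have "tgt G a = tgt G c" using a(1) c(1) by (simp add: A_def)
    then have "\<iota> a \<diamondop> c \<in> B a" "c = a \<diamondop> (\<iota> a \<diamondop> c)"
      using a(2) by (auto simp: B_def tgt_gmul src_ginv tgt_ginv ginv_mul_cancel)
    then show "c \<in> C" using a(1) unfolding C_def by blast
  qed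
  also have "\<dots> = (\<Sum>c\<in>C. \<Sum>a\<in>A. u a * (v (\<iota> a \<diamondop> c) * w (\<iota> c \<diamondop> g)))"
    using uv tC by (intro sum.cong) (auto simp: sum_distrib_right mult.assoc)
  also have "\<dots> = (\<Sum>a\<in>A. u a * (\<Sum>c\<in>C. v (\<iota> a \<diamondop> c) * w (\<iota> c \<diamondop> g)))"
    by (subst sum.swap) (simp add: sum_distrib_left)
  also have "\<dots> = (\<Sum>a\<in>A. u a * conv v w (\<iota> a \<diamondop> g))"
  proof (rule sum.cong[OF refl])
    fix a assume a: "a \<in> A"
    then have ta: "tgt G a = tgt G g" by (simp add: A_def)
    \<comment> \<open>for fixed \<open>a\<close> only the products \<open>c = a b\<close> with this \<open>a\<close> contribute\<close>
    have "(\<Sum>c\<in>C. v (\<iota> a \<diamondop> c) * w (\<iota> c \<diamondop> g))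
        = (\<Sum>c\<in>(\<lambda>b. a \<diamondop> b) ` B a. v (\<iota> a \<diamondop> c) * w (\<iota> c \<diamondop> g))"
    proof (rule sum.mono_neutral_right[OF finC])
      show "\<forall>c\<in>C - (\<lambda>b. a \<diamondop> b) ` B a. v (\<iota> a \<diamondop> c) * w (\<iota> c \<diamondop> g) = 0"
      proof
        fix c assume c: "c \<in> C - (\<lambda>b. a \<diamondop> b) ` B a"
        then have "tgt G a = tgt G c" using tC ta by auto
        then have "tgt G (\<iota> a \<diamondop> c) = src G a" "c = a \<diamondop> (\<iota> a \<diamondop> c)"
          by (auto simp: tgt_gmul src_ginv tgt_ginv ginv_mul_cancel)
        then have "v (\<iota> a \<diamondop> c) = 0" using c by (auto simp: B_def)
        then show "v (\<iota> a \<diamondop> c) * w (\<iota> c \<diamondop> g) = 0" by simp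
      qed
    qed (use a in \<open>auto simp: C_def\<close>)
    also have "\<dots> = (\<Sum>b\<in>B a. v (\<iota> a \<diamondop> (a \<diamondop> b)) * w (\<iota> (a \<diamondop> b) \<diamondop> g))"
    proof (subst sum.reindex)
      show "inj_on (\<lambda>b. a \<diamondop> b) (B a)"
        using mul_ginv_cancel by (intro inj_onI) (metis (mono_tags, lifting) B_def mem_Collect_eq)
    qed simp
    also have "\<dots> = (\<Sum>b\<in>B a. v b * w (\<iota> b \<diamondop> (\<iota> a \<diamondop> g)))"
    proof (rule sum.cong[OF refl])
      fix b assume "b \<in> B a"
      then have "src G a = tgt G b" by (simp add: B_def)
      then show "v (\<iota> a \<diamondop> (a \<diamondop> b)) * w (\<iota> (a \<diamondop> b) \<diamondop> g) = v b * w (\<iota> b \<diamondop> (\<iota> a \<diamondop> g))"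
        using ta by (simp add: mul_ginv_cancel ginv_mul gmul_assoc src_ginv tgt_ginv)
    qed
    also have "\<dots> = conv v w (\<iota> a \<diamondop> g)"
      using ta by (intro convolution_eq[symmetric, OF finB]) (auto simp: B_def tgt_gmul src_ginv tgt_ginv)
    finally show "u a * (\<Sum>c\<in>C. v (\<iota> a \<diamondop> c) * w (\<iota> c \<diamondop> g)) = u a * conv v w (\<iota> a \<diamondop> g)" by simp
  qed
  also have "\<dots> = conv u (conv v w) g"
    by (rule convolution_eq[symmetric, OF finA]) (auto simp: A_def)
  finally show "conv (conv u v) w g = conv u (conv v w) g" .
qed

lemma cnj_convolution: "cnj (conv u v g) = conv (\<lambda>g. cnj (u g)) (\<lambda>g. cnj (v g)) g"
  unfolding convolution_def by (simp add: case_prod_unfold flip: complex_cnj_mult)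

lemma convolution_add_left:
  assumes "u \<in> Cc" "u' \<in> Cc"
  shows "conv (\<lambda>g. u g + u' g) v = (\<lambda>g. conv u v g + conv u' v g)"
proof
  fix g
  show "conv (\<lambda>g. u g + u' g) v g = conv u v g + conv u' v g"
    using convolution_sum_left[of "UNIV :: bool set" "\<lambda>b. if b then u else u'" v g] assms
    by (simp add: UNIV_bool add.commute)
qed

lemma convolution_add_right:
  assumes "u \<in> Cc"
  shows "conv u (\<lambda>g. v g + v' g) = (\<lambda>g. conv u v g + conv u v' g)"
proof
  fix g
  let ?F = "{a. tgt G a = tgt G g \<and> u a \<noteq> 0}"
  have "finite ?F" by (rule Cc_finite_fibre[OF assms fibre_map_tgt])
  then have "conv u w g = (\<Sum>a\<in>?F. u a * w (\<iota> a \<diamondop> g))" for w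
    by (rule convolution_eq) auto
  then show "conv u (\<lambda>g. v g + v' g) g = conv u v g + conv u v' g"
    by (simp add: distrib_left sum.distrib)
qed

lemma convolution_smult:
  "conv (\<lambda>g. c * u g) v = (\<lambda>g. c * conv u v g)"
  "conv u (\<lambda>g. c * v g) = (\<lambda>g. c * conv u v g)"
proof -
  have 1: "{(a, b). src G a = tgt G b \<and> a \<diamondop> b = g \<and> c * u a * v b \<noteq> 0} =
      (if c = 0 then {} else {(a, b). src G a = tgt G b \<and> a \<diamondop> b = g \<and> u a * v b \<noteq> 0})" for g
    by auto
  show "conv (\<lambda>g. c * u g) v = (\<lambda>g. c * conv u v g)"
    unfolding convolution_def 1 by (auto simp: fun_eq_iff sum_distrib_left case_prod_unfold mult.assoc)
  then show "conv u (\<lambda>g. c * v g) = (\<lambda>g. c * conv u v g)"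
    unfolding convolution_def by (simp add: mult.left_commute mult.assoc)
qed

end

section \<open>Integer combinations\<close>

abbreviation keys :: "('a \<Rightarrow>\<^sub>0 'b::zero) \<Rightarrow> 'a set" where "keys \<equiv> Poly_Mapping.keys"

definition frag_sum :: "('a \<Rightarrow> 'r::comm_ring_1) \<Rightarrow> ('a \<Rightarrow>\<^sub>0 int) \<Rightarrow> 'r" where
  "frag_sum f p = (\<Sum>w\<in>keys p. of_int (Poly_Mapping.lookup p w) * f w)"

lemma frag_sum_superset:
  "finite S \<Longrightarrow> keys p \<subseteq> S \<Longrightarrow> frag_sum f p = (\<Sum>w\<in>S. of_int (Poly_Mapping.lookup p w) * f w)"
  unfolding frag_sum_def by (rule sum.mono_neutral_left) (auto simp: in_keys_iff)

lemma frag_sum_0 [simp]: "frag_sum f 0 = 0"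
  by (simp add: frag_sum_def)

lemma frag_sum_of [simp]: "frag_sum f (frag_of w) = f w"
  by (simp add: frag_sum_def)

lemma frag_sum_diff: "frag_sum f (p - q) = frag_sum f p - frag_sum f q"
proof -
  let ?S = "keys p \<union> keys q"
  have "frag_sum f (p - q) = (\<Sum>w\<in>?S. of_int (Poly_Mapping.lookup (p - q) w) * f w)"
    using keys_diff[of p q] by (intro frag_sum_superset) auto
  also have "\<dots> = (\<Sum>w\<in>?S. of_int (Poly_Mapping.lookup p w) * f w) - (\<Sum>w\<in>?S. of_int (Poly_Mapping.lookup q w) * f w)"
    by (simp add: lookup_minus algebra_simps sum_subtractf)
  finally show ?thesis by (simp flip: frag_sum_superset)
qed

lemma frag_sum_add: "frag_sum f (p + q) = frag_sum f p + frag_sum f q"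
  using frag_sum_diff[of f "p + q" q] by simp

lemma frag_sum_sum: "frag_sum f (\<Sum>i\<in>I. p i) = (\<Sum>i\<in>I. frag_sum f (p i))"
  by (induction I rule: infinite_finite_induct) (auto simp: frag_sum_add)

lemma frag_sum_cong:
  "(\<And>w. w \<in> keys p \<Longrightarrow> f w = f' w) \<Longrightarrow> frag_sum f p = frag_sum f' p"
  unfolding frag_sum_def by (rule sum.cong) auto

lemma frag_sum_mult: "frag_sum (\<lambda>w. c * f w) p = c * frag_sum f p"
  unfolding frag_sum_def by (simp add: sum_distrib_left mult.left_commute)

lemma frag_sum_swap: "frag_sum (\<lambda>w. \<Sum>i\<in>I. f i w) p = (\<Sum>i\<in>I. frag_sum (f i) p)"
  unfolding frag_sum_def by (simp add: sum_distrib_left sum.swap[of _ I])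

lemma frag_sum_extend: "frag_sum f (frag_extend h p) = frag_sum (\<lambda>w. frag_sum f (h w)) p"
proof -
  have "keys p \<subseteq> UNIV" by simp
  then show ?thesis
    by (induction p rule: frag_induction) (auto simp: frag_extend_diff frag_sum_diff)
qed


section \<open>Balanced tensors as functions\<close>

definition word_value :: "('g \<Rightarrow> complex) list \<Rightarrow> 'g list \<Rightarrow> complex" where
  "word_value w gs = prod_list (map2 (\<lambda>u g. u g) w gs)"

definition tensor_value :: "('g \<Rightarrow> complex) formal_tensor \<Rightarrow> 'g list \<Rightarrow> complex" where
  "tensor_value p gs = frag_sum (\<lambda>w. word_value w gs) p"

lemma word_value_Nil [simp]: "word_value [] gs = 1"
  by (simp add: word_value_def)

lemma word_value_Cons [simp]: "word_value (u # w) (g # gs) = u g * word_value w gs"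
  by (simp add: word_value_def)

lemma word_value_append:
  "word_value (xs @ ys) gs = word_value xs (take (length xs) gs) * word_value ys (drop (length xs) gs)"
  by (simp add: word_value_def zip_append1)

text \<open>The points at which an element of a balanced tensor power is to be evaluated: lists of arrows in
  which neighbours agree under the map over which their tensor sign is balanced.\<close>

definition fibred :: "('g \<Rightarrow> 'x) list \<Rightarrow> 'g list \<Rightarrow> bool" where
  "fibred rs gs \<longleftrightarrow> length gs = Suc (length rs) \<and> (\<forall>i<length rs. (rs ! i) (gs ! i) = (rs ! i) (gs ! Suc i))"

lemma fibred_Cons: "fibred (r # rs) (g # g' # gs) \<longleftrightarrow> r g = r g' \<and> fibred rs (g' # gs)"
  by (auto simp: fibred_def less_Suc_eq_0_disj)

lemma fibred_single: "(\<forall>gs. fibred [] gs \<longrightarrow> P gs) \<longleftrightarrow> (\<forall>g. P [g])"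
  by (auto simp: fibred_def length_Suc_conv)

lemma fibred_pair: "(\<forall>gs. fibred [r] gs \<longrightarrow> P gs) \<longleftrightarrow> (\<forall>g g'. r g = r g' \<longrightarrow> P [g, g'])"
  by (auto simp: fibred_def length_Suc_conv)

lemma fibred_triple:
  "(\<forall>gs. fibred [r, r'] gs \<longrightarrow> P gs) \<longleftrightarrow> (\<forall>g g' g''. r g = r g' \<longrightarrow> r' g' = r' g'' \<longrightarrow> P [g, g', g''])"
  by (auto simp: fibred_def length_Suc_conv less_Suc_eq_0_disj)

definition delta :: "('g \<Rightarrow> complex) \<Rightarrow> 'g \<Rightarrow> 'g \<Rightarrow> complex" where
  "delta u g g' = (if g = g' then u g else 0)"

lemma tensor_function_frag_sum: "tensor_function p g g' = frag_sum (\<lambda>w. (w ! 0) g * (w ! 1) g') p"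
  by (simp add: tensor_function_def frag_sum_def)

context compact_etale_groupoid
begin

definition fibre_balancing :: "('g \<Rightarrow> 'x) \<Rightarrow> ('g \<Rightarrow> complex) balancing" where
  "fibre_balancing r = {(\<lambda>u g. f (r g) * u g, \<lambda>u g. f (r g) * u g) | f. f \<in> Cobj}"

lemma convolution_algebra_simps:
  "u \<otimes>\<^bsub>\<H>\<^esub> v = conv u v"
  "u \<oplus>\<^bsub>\<H>\<^esub> v = (\<lambda>g. u g + v g)"
  "\<zero>\<^bsub>\<H>\<^esub> = (\<lambda>g. 0)"
  "\<one>\<^bsub>\<H>\<^esub> = unit_ext (\<lambda>x. 1)"
  "c \<odot>\<^bsub>\<H>\<^esub> u = (\<lambda>g. c * u g)"
  by (simp_all add: convolution_algebra_def)

lemma left_balancing_eq: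
  "left_balancing \<H> \<A> (unit_ext) (unit_ext)
     = fibre_balancing (tgt G)"
proof -
  have "(\<lambda>u. unit_ext f \<otimes>\<^bsub>\<H>\<^esub> u) = (\<lambda>u g. f (tgt G g) * u g)" for f
    by (rule ext) (simp only: convolution_algebra_simps convolution_unit_left)
  then show ?thesis unfolding left_balancing_def fibre_balancing_def by (simp only:)
qed

lemma right_balancing_eq:
  "right_balancing \<H> \<A> (unit_ext) (unit_ext)
     = fibre_balancing (src G)"
proof -
  have "(\<lambda>u. u \<otimes>\<^bsub>\<H>\<^esub> unit_ext f) = (\<lambda>u g. f (src G g) * u g)" for f
    by (rule ext) (simp only: convolution_algebra_simps convolution_unit_right mult.commute)
  then show ?thesis unfolding right_balancing_def fibre_balancing_def by (simp only:)
qed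

definition words where
  "words rs = tensor_words \<H> (map fibre_balancing rs)"
definition relators where
  "relators rs = tensor_relators \<H> (map fibre_balancing rs)"
definition null where
  "null rs = tensor_null \<H> (map fibre_balancing rs)"
definition tclass where
  "tclass rs = tensor_class \<H> (map fibre_balancing rs)"

lemma words_iff: "w \<in> words rs \<longleftrightarrow> length w = Suc (length rs) \<and> set w \<subseteq> Cc"
  by (simp add: words_def tensor_words_def)

lemma words_Cons: "u # w \<in> words (r # rs) \<longleftrightarrow> u \<in> Cc \<and> w \<in> words rs"
  by (auto simp: words_iff)

lemma relators_cases:
  assumes "q \<in> relators rs"
  obtains (add) xs x y ys where
      "q = frag_of (xs @ (\<lambda>g. x g + y g) # ys) - frag_of (xs @ x # ys) - frag_of (xs @ y # ys)"
      "xs @ x # ys \<in> words rs" "y \<in> Cc"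
  | (balance) xs f x y ys where
      "q = frag_of (xs @ (\<lambda>g. f ((rs ! length xs) g) * x g) # y # ys)
         - frag_of (xs @ x # (\<lambda>g. f ((rs ! length xs) g) * y g) # ys)"
      "xs @ x # y # ys \<in> words rs" "f \<in> Cobj" "length xs < length rs"
proof -
  from assms consider
    (1) xs x y ys where "q = frag_of (xs @ (\<lambda>g. x g + y g) # ys) - frag_of (xs @ x # ys) - frag_of (xs @ y # ys)"
      "xs @ x # ys \<in> words rs" "y \<in> Cc"
  | (2) xs r l x y ys where "q = frag_of (xs @ r x # y # ys) - frag_of (xs @ x # l y # ys)"
      "xs @ x # y # ys \<in> words rs" "(r, l) \<in> map fibre_balancing rs ! length xs"
    unfolding relators_def words_def tensor_relators_def convolution_algebra_simps by blast
  then show thesis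
  proof cases
    case 1
    then show thesis by (rule add)
  next
    case 2
    then have len: "length xs < length rs" by (simp add: words_iff)
    then obtain f where "f \<in> Cobj" "r = (\<lambda>u g. f ((rs ! length xs) g) * u g)"
      "l = (\<lambda>u g. f ((rs ! length xs) g) * u g)"
      using 2(3) by (auto simp: fibre_balancing_def)
    then show thesis using balance[of xs f x y ys] 2(1,2) len by simp
  qed
qed

lemma relator_add:
  assumes "xs @ x # ys \<in> words rs" "y \<in> Cc"
  shows "frag_of (xs @ (\<lambda>g. x g + y g) # ys) - frag_of (xs @ x # ys) - frag_of (xs @ y # ys) \<in> relators rs"
  using assms unfolding relators_def words_def tensor_relators_def convolution_algebra_simps by blast

lemma relator_balance:
  assumes "xs @ x # y # ys \<in> words rs" "f \<in> Cobj" "length xs < length rs"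
  shows "frag_of (xs @ (\<lambda>g. f ((rs ! length xs) g) * x g) # y # ys)
         - frag_of (xs @ x # (\<lambda>g. f ((rs ! length xs) g) * y g) # ys) \<in> relators rs"
proof -
  let ?m = "\<lambda>u g. f ((rs ! length xs) g) * u g"
  have "(?m, ?m) \<in> map fibre_balancing rs ! length xs"
    using assms(2,3) by (auto simp: fibre_balancing_def)
  then have "\<exists>xs' r l x' y' ys'. frag_of (xs @ ?m x # y # ys) - frag_of (xs @ x # ?m y # ys)
      = frag_of (xs' @ r x' # y' # ys') - frag_of (xs' @ x' # l y' # ys') \<and>
      xs' @ x' # y' # ys' \<in> words rs \<and> (r, l) \<in> map fibre_balancing rs ! length xs'"
    using assms(1) by (intro exI[of _ xs] exI[of _ ?m] exI[of _ x] exI[of _ y] exI[of _ ys] conjI refl)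
  then show ?thesis
    unfolding relators_def words_def tensor_relators_def by (intro UnI2 CollectI)
qed

lemma relators_keys:
  assumes "\<forall>r\<in>set rs. fibre_map r" "q \<in> relators rs" shows "keys q \<subseteq> words rs"
  using assms(2)
proof (cases rule: relators_cases)
  case (add xs x y ys)
  then have "xs @ (\<lambda>g. x g + y g) # ys \<in> words rs" "xs @ y # ys \<in> words rs"
    by (auto simp: words_iff Cc_add)
  then show ?thesis
    using add keys_diff by (fastforce simp: dest!: subsetD[OF keys_diff])
next
  case (balance xs f x y ys)
  then have "fibre_map (rs ! length xs)" using assms(1) by auto
  then have "xs @ (\<lambda>g. f ((rs ! length xs) g) * x g) # y # ys \<in> words rs"
    "xs @ x # (\<lambda>g. f ((rs ! length xs) g) * y g) # ys \<in> words rs"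
    using balance by (auto simp: words_iff Cc_fibre_mult)
  then show ?thesis
    using balance(1) by (auto dest!: subsetD[OF keys_diff])
qed

lemma null_generate: "null rs = generate (free_Abelian_group (words rs)) (relators rs)"
  by (simp add: null_def tensor_null_def words_def relators_def)

lemma null_subgroup:
  assumes "\<forall>r\<in>set rs. fibre_map r" shows "subgroup (null rs) (free_Abelian_group (words rs))"
  unfolding null_generate
  by (rule group.generate_is_subgroup) (use relators_keys[OF assms] in auto)

lemma null_relator: "q \<in> relators rs \<Longrightarrow> q \<in> null rs"
  unfolding null_generate by (rule generate.incl)

context
  fixes rs assumes rs: "\<forall>r\<in>set rs. fibre_map r"
begin

lemma null_keys: "q \<in> null rs \<Longrightarrow> keys q \<subseteq> words rs"
  using subgroup.mem_carrier[OF null_subgroup[OF rs]] by auto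

lemma null_zero: "0 \<in> null rs"
  using subgroup.one_closed[OF null_subgroup[OF rs]] by simp

lemma null_add: "p \<in> null rs \<Longrightarrow> q \<in> null rs \<Longrightarrow> p + q \<in> null rs"
  using subgroup.m_closed[OF null_subgroup[OF rs]] by simp

lemma null_minus: "p \<in> null rs \<Longrightarrow> - p \<in> null rs"
  using subgroup.m_inv_closed[OF null_subgroup[OF rs], of p] null_keys[of p] by simp

lemma null_diff: "p \<in> null rs \<Longrightarrow> q \<in> null rs \<Longrightarrow> p - q \<in> null rs"
  using null_add[of p "- q"] null_minus by simp

lemma null_sum: "(\<And>i. i \<in> I \<Longrightarrow> p i \<in> null rs) \<Longrightarrow> (\<Sum>i\<in>I. p i) \<in> null rs"
  by (induction I rule: infinite_finite_induct) (auto intro: null_zero null_add)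

lemma null_induct [consumes 1, case_names relator zero diff]:
  assumes "q \<in> null rs" "\<And>q. q \<in> relators rs \<Longrightarrow> P q" "P 0" "\<And>p q. P p \<Longrightarrow> P q \<Longrightarrow> P (p - q)"
  shows "P q"
proof -
  have "P q" if "q \<in> generate (free_Abelian_group (words rs)) (relators rs)" for q
    using that
  proof (induction rule: generate.induct)
    case (inv q)
    then show ?case using assms(4)[OF assms(3) assms(2)[of q]] relators_keys[OF rs, of q] by simp
  next
    case (eng p q)
    then show ?case using assms(4)[of p "0 - q"] assms(4)[OF assms(3), of q] by simp
  qed (use assms in auto)
  then show ?thesis using assms(1) by (simp add: null_generate)
qed

text \<open>The two factors next to a tensor sign are evaluated at arrows with the same image under the map over
  which the sign is balanced, so the scalar may sit on either side.\<close>

lemma tensor_value_null: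
  assumes "q \<in> null rs" "fibred rs gs" shows "tensor_value q gs = 0"
  using assms(1)
proof (induction rule: null_induct)
  case (relator q)
  then show ?case
  proof (cases rule: relators_cases)
    case (add xs x y ys)
    then have "length xs < length gs" using assms(2) by (auto simp: words_iff fibred_def)
    then have "drop (length xs) gs = gs ! length xs # drop (Suc (length xs)) gs"
      by (simp add: Cons_nth_drop_Suc)
    then show ?thesis
      by (simp add: add(1) tensor_value_def frag_sum_diff frag_sum_add word_value_append algebra_simps)
  next
    case (balance xs f x y ys)
    then have "Suc (length xs) < length gs"
      "(rs ! length xs) (gs ! length xs) = (rs ! length xs) (gs ! Suc (length xs))"
      using assms(2) by (auto simp: fibred_def)
    moreover from this have "drop (length xs) gs = gs ! length xs # gs ! Suc (length xs) # drop (Suc (Suc (length xs))) gs"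
      by (simp add: Cons_nth_drop_Suc)
    ultimately show ?thesis
      by (simp add: balance(1) tensor_value_def frag_sum_diff frag_sum_add word_value_append algebra_simps)
  qed
qed (auto simp: tensor_value_def frag_sum_diff)

lemma null_head_add:
  assumes "x # ys \<in> words rs" "y \<in> Cc"
  shows "frag_of ((\<lambda>g. x g + y g) # ys) - frag_of (x # ys) - frag_of (y # ys) \<in> null rs"
  using null_relator[OF relator_add[of "[]"]] assms by simp

lemma null_head_zero:
  assumes "x # ys \<in> words rs" shows "frag_of ((\<lambda>g. 0) # ys) \<in> null rs"
proof -
  have "(\<lambda>g. 0) # ys \<in> words rs" using assms Cc_zero by (simp add: words_iff)
  from null_minus[OF null_head_add[OF this Cc_zero]] show ?thesis by simp
qed

lemma null_head_sum:
  assumes "finite I" "\<And>i. i \<in> I \<Longrightarrow> u i \<in> Cc" "x # ys \<in> words rs"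
  shows "frag_of ((\<lambda>g. \<Sum>i\<in>I. u i g) # ys) - (\<Sum>i\<in>I. frag_of (u i # ys)) \<in> null rs"
  using assms(1,2)
proof (induction I rule: finite_induct)
  case empty
  then show ?case using null_head_zero[OF assms(3)] by simp
next
  case (insert i I)
  have "u i # ys \<in> words rs" using insert.prems assms(3) by (simp add: words_iff)
  then have "frag_of ((\<lambda>g. u i g + (\<Sum>i\<in>I. u i g)) # ys) - frag_of (u i # ys) - frag_of ((\<lambda>g. \<Sum>i\<in>I. u i g) # ys) \<in> null rs"
    using insert by (intro null_head_add Cc_sum) auto
  then have "(frag_of ((\<lambda>g. u i g + (\<Sum>i\<in>I. u i g)) # ys) - frag_of (u i # ys) - frag_of ((\<lambda>g. \<Sum>i\<in>I. u i g) # ys))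
      + (frag_of ((\<lambda>g. \<Sum>i\<in>I. u i g) # ys) - (\<Sum>i\<in>I. frag_of (u i # ys))) \<in> null rs"
    using insert by (intro null_add) auto
  then show ?case using insert.hyps by (simp add: algebra_simps)
qed

end

text \<open>Tensoring with a fixed first factor sends relators to relators.\<close>

lemma null_lift:
  assumes "\<forall>r\<in>set (r # rs). fibre_map r" "x \<in> Cc" "q \<in> null rs"
  shows "frag_extend (\<lambda>w. frag_of (x # w)) q \<in> null (r # rs)"
proof -
  have rs: "\<forall>r\<in>set rs. fibre_map r" using assms(1) by simp
  show ?thesis
    using assms(3)
  proof (induction rule: null_induct[OF rs, consumes 1])
    case (1 q)
    then have "frag_extend (\<lambda>w. frag_of (x # w)) q \<in> relators (r # rs)"
    proof (cases rule: relators_cases)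
      case (add xs y z ys)
      then show ?thesis
        using relator_add[of "x # xs" y ys "r # rs" z] assms(2) by (simp add: frag_extend_diff words_Cons)
    next
      case (balance xs f y z ys)
      then show ?thesis
        using relator_balance[of "x # xs" y z ys "r # rs" f] assms(2) by (simp add: frag_extend_diff words_Cons)
    qed
    then show ?case by (rule null_relator)
  next
    case 2
    then show ?case using null_zero[OF assms(1)] by simp
  next
    case (3 p q)
    then show ?case using null_diff[OF assms(1)] by (simp add: frag_extend_diff)
  qed
qed

text \<open>By induction on the number of tensor signs. For the inductive step write the first factors \<open>u\<close> of
  all words, simultaneously, as combinations \<open>\<Sum> a\<^sub>j(u) \<phi>\<^sub>j\<close> of the same
  functions \<open>\<phi>\<^sub>j\<close>, each supported in a bisection \<open>U\<^sub>j\<close>, with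
  coefficients \<open>a\<^sub>j(u)\<close> from the base algebra. Balancing moves the coefficients across the
  first tensor sign, so the tensor becomes \<open>\<Sum> \<phi>\<^sub>j \<otimes> p\<^sub>j\<close>. The
  function of \<open>p\<^sub>j\<close> is, up to a scalar factor, that of the given tensor with the first
  argument in \<open>U\<^sub>j\<close> determined by the second one; hence it vanishes and \<open>p\<^sub>j =
  0\<close> by induction.\<close>

theorem tensor_null_if_value_zero:
  assumes "\<forall>r\<in>set rs. fibre_map r" "keys p \<subseteq> words rs"
    and "\<And>gs. fibred rs gs \<Longrightarrow> tensor_value p gs = 0"
  shows "p \<in> null rs"
  using assms
proof (induction rs arbitrary: p)
  case Nil
  have fm: "\<forall>r\<in>set []. fibre_map r" by simp
  \<comment> \<open>without tensor signs, additivity alone collapses a combination of words to its sum in \<open>H\<close>\<close>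
  have "(\<lambda>g. tensor_value q [g]) \<in> Cc \<and> q - frag_of [\<lambda>g. tensor_value q [g]] \<in> null []"
    if "keys q \<subseteq> words []" for q
    using that
  proof (induction q rule: free_Abelian_group_induct[consumes 1, case_names zero diff word])
    case zero
    have "[\<lambda>g. 0] \<in> words []" using Cc_zero by (simp add: words_iff)
    from null_minus[OF fm null_head_zero[OF fm this]] show ?case
      using Cc_zero by (simp add: tensor_value_def)
  next
    case (diff p q)
    let ?v = "\<lambda>q g. tensor_value q [g]"
    have Cc: "?v p \<in> Cc" "?v q \<in> Cc" using diff by auto
    have "(\<lambda>g. ?v p g + (- 1) * ?v q g) \<in> Cc" by (rule Cc_add[OF Cc(1) Cc_smult[OF Cc(2)]])
    moreover have vd: "?v (p - q) = (\<lambda>g. ?v p g + (- 1) * ?v q g)"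
      by (simp add: tensor_value_def frag_sum_diff)
    ultimately have Cd: "?v (p - q) \<in> Cc" by simp
    have "frag_of [\<lambda>g. ?v (p - q) g + ?v q g] - frag_of [?v (p - q)] - frag_of [?v q] \<in> null []"
      using null_head_add[OF fm, of "?v (p - q)" "[]" "?v q"] Cd Cc by (simp add: words_iff)
    moreover have "(\<lambda>g. ?v (p - q) g + ?v q g) = ?v p"
      by (simp add: tensor_value_def frag_sum_diff)
    ultimately have d: "frag_of [?v p] - frag_of [?v (p - q)] - frag_of [?v q] \<in> null []" by simp
    have IH: "p - frag_of [?v p] \<in> null []" "q - frag_of [?v q] \<in> null []" using diff by auto
    from null_add[OF fm null_diff[OF fm IH] d] show ?case using Cd by (simp add: algebra_simps)
  next
    case (word w)
    then obtain u where "w = [u]" "u \<in> Cc" by (auto simp: words_iff length_Suc_conv)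
    then show ?case using null_zero[OF fm] by (simp add: tensor_value_def)
  qed
  from this[OF Nil(2)] have "p - frag_of [\<lambda>g. tensor_value p [g]] \<in> null []" ..
  moreover have "(\<lambda>g. tensor_value p [g]) = (\<lambda>g. 0)"
    using Nil(3) fibred_single[of "\<lambda>gs. tensor_value p gs = 0"] by auto
  moreover have "frag_of [\<lambda>g. 0] \<in> null []"
    by (rule null_head_zero[OF fm, of "\<lambda>g. 0"]) (simp add: words_iff Cc_zero)
  ultimately show ?case
    using null_add[OF fm, of "p - frag_of [\<lambda>g. 0]" "frag_of [\<lambda>g. 0]"] by simp
next
  case (Cons r rs)
  have r: "fibre_map r" and rs: "\<forall>r\<in>set rs. fibre_map r" using Cons.prems(1) by auto
  define K where "K = (\<Union>w\<in>keys p. closure {g. hd w g \<noteq> 0})"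
  have "hd w \<in> Cc" if "w \<in> keys p" for w
    using that Cons.prems(2) by (cases w) (auto simp: words_iff)
  then have "compact K"
    unfolding K_def by (intro compact_UN) (auto simp: convolution_algebra_def)
  then obtain J U C \<phi> \<theta> where "bisection_partition K J U C \<phi> \<theta>" using bisection_partition_exists by blast
  note P = bisection_partitionD[OF this]
  define a where "a j u = push r (U j) (\<lambda>g. \<theta> j g * u g)" for j and u :: "'g \<Rightarrow> complex"
  define W where "W = {w \<in> words (r # rs). \<forall>g. g \<notin> K \<longrightarrow> hd w g = 0}"
  have pW: "keys p \<subseteq> W"
  proof
    fix w assume w: "w \<in> keys p"
    have "hd w g = 0" if "g \<notin> K" for g
      using that w closure_subset[of "{g. hd w g \<noteq> 0}"] unfolding K_def by blast
    then show "w \<in> W" using w Cons.prems(2) unfolding W_def by blast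
  qed
  have a_Cobj: "a j u \<in> Cobj" if "j \<in> J" "u \<in> Cc" "\<And>g. g \<notin> K \<Longrightarrow> u g = 0" for j u
  proof -
    have "\<theta> j g * u g = 0" if "g \<notin> C j" for g using P(7)[OF \<open>j \<in> J\<close> that] by simp
    moreover have "(\<lambda>g. \<theta> j g * u g) \<in> Cc" using P(8)[OF that(1,2)] that(3) by blast
    ultimately show ?thesis
      unfolding a_def by (intro push_Cobj[OF P(2)[OF that(1)] r _ P(4,5)[OF that(1)]])
  qed
  have a_apply: "a j u (r g) = \<theta> j g * u g" if "j \<in> J" "g \<in> U j" for j u g
    unfolding a_def by (rule push_apply[OF P(2)[OF that(1)] r that(2)])
  have expand: "u = (\<lambda>g. \<Sum>j\<in>J. a j u (r g) * \<phi> j g)" if u: "\<And>g. g \<notin> K \<Longrightarrow> u g = 0" for u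
  proof
    fix g
    have "a j u (r g) * \<phi> j g = \<phi> j g * \<theta> j g * u g" if "j \<in> J" for j
      using a_apply[OF that, of g u] P(5,6)[OF that] by (cases "g \<in> U j") auto
    then have "(\<Sum>j\<in>J. a j u (r g) * \<phi> j g) = (\<Sum>j\<in>J. \<phi> j g * \<theta> j g) * u g"
      unfolding sum_distrib_right by (rule sum.cong[OF refl])
    then show "u g = (\<Sum>j\<in>J. a j u (r g) * \<phi> j g)"
      using P(9)[of g] u[of g] by (cases "g \<in> K") auto
  qed
  define L where "L j w = (\<lambda>g. a j (hd w) (r g) * (hd (tl w)) g) # tl (tl w)" for j w
  have Wcases: "\<exists>u v ws. w = u # v # ws \<and> u \<in> Cc \<and> v \<in> Cc \<and> set ws \<subseteq> Cc \<and> length ws = length rs \<and> (\<forall>g. g \<notin> K \<longrightarrow> u g = 0)"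
    if "w \<in> W" for w
    using that by (cases w; cases "tl w") (auto simp: W_def words_iff)
  have Lwords: "L j w \<in> words rs" if "j \<in> J" "w \<in> W" for j w
    using Wcases[OF that(2)] a_Cobj[OF that(1)] by (auto simp: L_def words_iff intro: Cc_fibre_mult[OF r])
  have one_word: "frag_of w - (\<Sum>j\<in>J. frag_of (\<phi> j # L j w)) \<in> null (r # rs)" if w: "w \<in> W" for w
  proof -
    obtain u v ws where w': "w = u # v # ws" "u \<in> Cc" "v \<in> Cc" "set ws \<subseteq> Cc" "length ws = length rs"
      "\<And>g. g \<notin> K \<Longrightarrow> u g = 0" using Wcases[OF w] by blast
    have aC: "a j u \<in> Cobj" if "j \<in> J" for j using a_Cobj[OF that w'(2,6)] .
    have "frag_of ((\<lambda>g. \<Sum>j\<in>J. a j u (r g) * \<phi> j g) # v # ws)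
        - (\<Sum>j\<in>J. frag_of ((\<lambda>g. a j u (r g) * \<phi> j g) # v # ws)) \<in> null (r # rs)"
      using w' by (intro null_head_sum[OF Cons.prems(1) P(1), where x = u] Cc_fibre_mult[OF r aC P(3)]) (auto simp: words_iff)
    then have 1: "frag_of w - (\<Sum>j\<in>J. frag_of ((\<lambda>g. a j u (r g) * \<phi> j g) # v # ws)) \<in> null (r # rs)"
      using expand[of u] w'(1,6) by simp
    have "frag_of ((\<lambda>g. a j u (r g) * \<phi> j g) # v # ws) - frag_of (\<phi> j # L j w) \<in> null (r # rs)" if "j \<in> J" for j
      using null_relator[OF relator_balance[of "[]" "\<phi> j" v ws "r # rs" "a j u"]] aC[OF that] P(3)[OF that] w'
      by (simp add: L_def words_iff)
    then have "(\<Sum>j\<in>J. frag_of ((\<lambda>g. a j u (r g) * \<phi> j g) # v # ws) - frag_of (\<phi> j # L j w)) \<in> null (r # rs)"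
      by (rule null_sum[OF Cons.prems(1)])
    from null_add[OF Cons.prems(1) 1 this] show ?thesis by (simp add: sum_subtractf)
  qed
  \<comment> \<open>the rewriting of the tensor as \<open>\<Sum> \<phi>\<^sub>j \<otimes> p\<^sub>j\<close>, where \<open>p\<^sub>j\<close> has the words \<open>L j w\<close>\<close>
  have reduce: "q - (\<Sum>j\<in>J. frag_extend (\<lambda>w. frag_of (\<phi> j # L j w)) q) \<in> null (r # rs)"
    if "keys q \<subseteq> W" for q
    using that
  proof (induction q rule: free_Abelian_group_induct[consumes 1, case_names zero diff word])
    case zero
    then show ?case using null_zero[OF Cons.prems(1)] by simp
  next
    case (diff p q)
    then show ?case using null_diff[OF Cons.prems(1) diff(3,4)]
      by (simp add: frag_extend_diff sum_subtractf algebra_simps)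
  next
    case (word w)
    then show ?case using one_word by simp
  qed
  have "frag_extend (\<lambda>w. frag_of (\<phi> j # L j w)) p \<in> null (r # rs)" if j: "j \<in> J" for j
  proof -
    let ?P = "frag_extend (\<lambda>w. frag_of (L j w)) p"
    have "?P \<in> null rs"
    proof (rule Cons.IH[OF rs])
      show "keys ?P \<subseteq> words rs"
        using keys_frag_extend[of "\<lambda>w. frag_of (L j w)" p] Lwords[OF j] pW by fastforce
      fix gs assume gs: "fibred rs gs"
      then obtain g' gs' where gs': "gs = g' # gs'" by (cases gs) (auto simp: fibred_def)
      have val: "tensor_value ?P gs = frag_sum (\<lambda>w. word_value (L j w) gs) p"
        by (simp add: tensor_value_def frag_sum_extend)
      show "tensor_value ?P gs = 0"
      proof (cases "r g' \<in> r ` U j")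
        case True
        then obtain g where g: "g \<in> U j" "r g' = r g" by blast
        have "word_value (L j w) gs = \<theta> j g * word_value w (g # gs)" if w: "w \<in> keys p" for w
        proof -
          obtain u v ws where "w = u # v # ws" using Wcases[of w] w pW by blast
          then show ?thesis using a_apply[OF j g(1)] g(2) gs' by (simp add: L_def)
        qed
        then have e: "frag_sum (\<lambda>w. word_value (L j w) gs) p = frag_sum (\<lambda>w. \<theta> j g * word_value w (g # gs)) p"
          by (rule frag_sum_cong)
        have "tensor_value ?P gs = \<theta> j g * tensor_value p (g # gs)"
          by (simp only: val e frag_sum_mult tensor_value_def[of p])
        moreover have "fibred (r # rs) (g # gs)" using gs gs' g(2) by (simp add: fibred_Cons)
        ultimately show ?thesis using Cons.prems(3) by simp
      next
        case False
        then have "word_value (L j w) gs = 0" for w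
          by (simp add: L_def gs' a_def push_def)
        then show ?thesis unfolding val by (simp add: frag_sum_def)
      qed
    qed
    from null_lift[OF Cons.prems(1) P(3)[OF j] this] show ?thesis
      using frag_extend_compose[of "\<lambda>w. frag_of (\<phi> j # w)" "L j" p] by (simp add: o_def)
  qed
  then have "(\<Sum>j\<in>J. frag_extend (\<lambda>w. frag_of (\<phi> j # L j w)) p) \<in> null (r # rs)"
    by (rule null_sum[OF Cons.prems(1)])
  from null_add[OF Cons.prems(1) reduce[OF pW] this] show ?case by simp
qed

lemma tclass_iff:
  assumes "\<forall>r\<in>set rs. fibre_map r" "keys p \<subseteq> words rs"
  shows "q \<in> tclass rs p \<longleftrightarrow>
    keys q \<subseteq> words rs \<and> (\<forall>gs. fibred rs gs \<longrightarrow> tensor_value q gs = tensor_value p gs)"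
proof -
  have diff: "tensor_value (q - p) gs = tensor_value q gs - tensor_value p gs" for gs
    by (simp add: tensor_value_def frag_sum_diff)
  have "q \<in> tclass rs p \<longleftrightarrow> (\<exists>h\<in>null rs. q = h + p)"
    by (simp add: tclass_def tensor_class_def r_coset_def null_def)
  also have "\<dots> \<longleftrightarrow> q - p \<in> null rs"
    by (metis add_diff_cancel diff_add_cancel)
  also have "\<dots> \<longleftrightarrow> keys q \<subseteq> words rs \<and> (\<forall>gs. fibred rs gs \<longrightarrow> tensor_value q gs = tensor_value p gs)"
  proof
    assume *: "q - p \<in> null rs"
    have "keys (q - p + p) \<subseteq> words rs"
      using null_keys[OF assms(1) *] assms(2) keys_add[of "q - p" p] by blast
    then show "keys q \<subseteq> words rs \<and> (\<forall>gs. fibred rs gs \<longrightarrow> tensor_value q gs = tensor_value p gs)"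
      using tensor_value_null[OF assms(1) *] by (simp add: diff)
  next
    assume "keys q \<subseteq> words rs \<and> (\<forall>gs. fibred rs gs \<longrightarrow> tensor_value q gs = tensor_value p gs)"
    then show "q - p \<in> null rs"
      using assms keys_diff[of q p] by (intro tensor_null_if_value_zero) (auto simp: diff)
  qed
  finally show ?thesis .
qed

lemma tclass_eqI:
  assumes "\<forall>r\<in>set rs. fibre_map r" "keys p \<subseteq> words rs" "keys q \<subseteq> words rs"
    and "\<And>gs. fibred rs gs \<Longrightarrow> tensor_value p gs = tensor_value q gs"
  shows "tclass rs p = tclass rs q"
  using assms by (auto simp: tclass_iff)

lemma carrier_tensor_product:
  "carrier (tensor_product \<H> (map fibre_balancing rs))
     = tclass rs ` {p. keys p \<subseteq> words rs}"
  unfolding tensor_product_def FactGroup_def RCOSETS_def tclass_def tensor_class_def words_def by auto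

lemma tensor_value_pair:
  assumes "keys p \<subseteq> words [r]" shows "tensor_value p [g, g'] = tensor_function p g g'"
  unfolding tensor_value_def tensor_function_frag_sum
proof (rule frag_sum_cong)
  fix w assume "w \<in> keys p"
  then have "length w = Suc (Suc 0)" using assms by (auto simp: words_iff)
  then obtain u v where "w = [u, v]" by (auto simp: length_Suc_conv)
  then show "word_value w [g, g'] = (w ! 0) g * (w ! 1) g'" by simp
qed


section \<open>The coproducts\<close>

text \<open>The tensor \<open>\<Sum> \<phi>\<^sub>j \<otimes> \<theta>\<^sub>j u\<close> works: in its \<open>j\<close>-th term both arguments lie in \<open>U\<^sub>j\<close>, so they are equal
  as soon as they lie in the same fibre, and on the diagonal \<open>\<Sum> \<phi>\<^sub>j \<theta>\<^sub>j = 1\<close>.\<close>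

lemma diagonal_representative:
  assumes "fibre_map r" "u \<in> Cc"
  obtains p where "keys p \<subseteq> words [r]" "\<And>g g'. r g = r g' \<Longrightarrow> tensor_function p g g' = delta u g g'"
proof -
  obtain K where K: "compact K" "\<And>g. g \<notin> K \<Longrightarrow> u g = 0" using Cc_support[OF assms(2)] by metis
  obtain J U C \<phi> \<theta> where "bisection_partition K J U C \<phi> \<theta>" using bisection_partition_exists[OF K(1)] by blast
  note P = bisection_partitionD[OF this]
  let ?p = "\<Sum>j\<in>J. frag_of [\<phi> j, \<lambda>g. \<theta> j g * u g]"
  show thesis
  proof (rule that)
    have "?p \<in> carrier (free_Abelian_group (words [r]))"
      using P(3) P(8)[OF _ assms(2) K(2)] by (intro sum_closed_free_Abelian_group) (simp add: words_iff)
    then show "keys ?p \<subseteq> words [r]" by simp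
    fix g g' assume r: "r g = r g'"
    have "tensor_function ?p g g' = (\<Sum>j\<in>J. \<phi> j g * (\<theta> j g' * u g'))"
      by (simp add: tensor_function_frag_sum frag_sum_sum)
    also have "\<dots> = delta u g g'"
    proof (cases "g = g'")
      case True
      have "(\<Sum>j\<in>J. \<phi> j g * (\<theta> j g * u g)) = (\<Sum>j\<in>J. \<phi> j g * \<theta> j g) * u g"
        by (simp add: sum_distrib_right mult.assoc)
      then show ?thesis using True P(9)[of g] K(2)[of g] by (cases "g \<in> K") (auto simp: delta_def)
    next
      case False
      have "\<phi> j g * (\<theta> j g' * u g') = 0" if j: "j \<in> J" for j
        using bisection_inj[OF P(2)[OF j] assms(1) _ _ r] False P(5,6,7)[OF j] by fastforce
      then have "(\<Sum>j\<in>J. \<phi> j g * (\<theta> j g' * u g')) = 0" by (rule sum.neutral[OF ballI])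
      then show ?thesis using False by (simp add: delta_def)
    qed
    finally show "tensor_function ?p g g' = delta u g g'" .
  qed
qed

text \<open>Two tensors with the diagonal function differ by a tensor with function \<open>0\<close>, hence coincide, and so
  the definite description in \<open>\<Delta> u\<close> denotes the coset of \<open>diagonal_representative\<close>. Identities between
  coproducts thereby become identities between functions.\<close>

lemma diagonal_tensor_iff:
  assumes "fibre_map r" "u \<in> Cc"
  shows "q \<in> diagonal_tensor G (fibre_balancing r) r u \<longleftrightarrow>
    keys q \<subseteq> words [r] \<and> (\<forall>g g'. r g = r g' \<longrightarrow> tensor_function q g g' = delta u g g')"
proof -
  obtain p where p: "keys p \<subseteq> words [r]" "\<And>g g'. r g = r g' \<Longrightarrow> tensor_function p g g' = delta u g g'"
    by (rule diagonal_representative[OF assms]) blast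
  have fm: "\<forall>r\<in>set [r]. fibre_map r" using assms(1) by simp
  have mem: "x \<in> tclass [r] y \<longleftrightarrow> keys x \<subseteq> words [r] \<and>
      (\<forall>g g'. r g = r g' \<longrightarrow> tensor_function x g g' = tensor_function y g g')"
    if y: "keys y \<subseteq> words [r]" for x y
    unfolding tclass_iff[OF fm y] fibred_pair
    using tensor_value_pair[OF y] tensor_value_pair[of x r] by (auto simp del: split_paired_All)
  let ?B = "fibre_balancing r"
  have carrier: "carrier (tensor_product \<H> [?B]) = tclass [r] ` {p. keys p \<subseteq> words [r]}"
    using carrier_tensor_product[of "[r]"] by simp
  have "diagonal_tensor G ?B r u = tclass [r] p"
    unfolding diagonal_tensor_def
  proof (rule the_equality)
    show "tclass [r] p \<in> carrier (tensor_product \<H> [?B]) \<and>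
        (\<forall>q\<in>tclass [r] p. \<forall>g g'. r g = r g' \<longrightarrow> tensor_function q g g' = (if g = g' then u g else 0))"
      using carrier p mem[OF p(1)] by (auto simp: delta_def)
  next
    fix T
    assume T: "T \<in> carrier (tensor_product \<H> [?B]) \<and>
        (\<forall>q\<in>T. \<forall>g g'. r g = r g' \<longrightarrow> tensor_function q g g' = (if g = g' then u g else 0))"
    then obtain q where q: "keys q \<subseteq> words [r]" "T = tclass [r] q"
      using carrier by auto
    then have "q \<in> T" using mem[OF q(1)] by simp
    then have "tensor_function q g g' = tensor_function p g g'" if "r g = r g'" for g g'
      using T p(2) that by (simp add: delta_def)
    then show "T = tclass [r] p" using mem[OF p(1)] mem[OF q(1)] q(2) by auto
  qed
  then show ?thesis using mem[OF p(1)] p(2) by auto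
qed

lemma diagonal_tensor_eqI:
  assumes "fibre_map r" "u \<in> Cc" "keys p \<subseteq> words [r]"
    and "\<And>g g'. r g = r g' \<Longrightarrow> tensor_function p g g' = delta u g g'"
  shows "diagonal_tensor G (fibre_balancing r) r u = tclass [r] p"
proof -
  have fm: "\<forall>r\<in>set [r]. fibre_map r" using assms(1) by simp
  show ?thesis
    unfolding set_eq_iff diagonal_tensor_iff[OF assms(1,2)] tclass_iff[OF fm assms(3)] fibred_pair
    using tensor_value_pair[OF assms(3)] tensor_value_pair[of _ r] assms(4) by simp metis
qed

end

section \<open>The algebras as algebraic structures\<close>

lemma function_complex_algebraI:
  fixes A :: "(complex, 'p \<Rightarrow> complex) module"
  assumes add: "\<And>u v. u \<oplus>\<^bsub>A\<^esub> v = (\<lambda>p. u p + v p)" and zero: "\<zero>\<^bsub>A\<^esub> = (\<lambda>p. 0)"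
    and smult: "\<And>c u. c \<odot>\<^bsub>A\<^esub> u = (\<lambda>p. c * u p)"
    and zero_closed: "(\<lambda>p. 0) \<in> carrier A"
    and add_closed: "\<And>u v. u \<in> carrier A \<Longrightarrow> v \<in> carrier A \<Longrightarrow> (\<lambda>p. u p + v p) \<in> carrier A"
    and smult_closed: "\<And>c u. u \<in> carrier A \<Longrightarrow> (\<lambda>p. c * u p) \<in> carrier A"
    and monoid: "monoid A"
    and distr: "\<And>u v w. u \<in> carrier A \<Longrightarrow> v \<in> carrier A \<Longrightarrow> w \<in> carrier A \<Longrightarrow>
        (u \<oplus>\<^bsub>A\<^esub> v) \<otimes>\<^bsub>A\<^esub> w = u \<otimes>\<^bsub>A\<^esub> w \<oplus>\<^bsub>A\<^esub> v \<otimes>\<^bsub>A\<^esub> w"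
      "\<And>u v w. u \<in> carrier A \<Longrightarrow> v \<in> carrier A \<Longrightarrow> w \<in> carrier A \<Longrightarrow>
        w \<otimes>\<^bsub>A\<^esub> (u \<oplus>\<^bsub>A\<^esub> v) = w \<otimes>\<^bsub>A\<^esub> u \<oplus>\<^bsub>A\<^esub> w \<otimes>\<^bsub>A\<^esub> v"
    and smult_mult: "\<And>c u v. u \<in> carrier A \<Longrightarrow> v \<in> carrier A \<Longrightarrow> (c \<odot>\<^bsub>A\<^esub> u) \<otimes>\<^bsub>A\<^esub> v = c \<odot>\<^bsub>A\<^esub> (u \<otimes>\<^bsub>A\<^esub> v)"
      "\<And>c u v. u \<in> carrier A \<Longrightarrow> v \<in> carrier A \<Longrightarrow> u \<otimes>\<^bsub>A\<^esub> (c \<odot>\<^bsub>A\<^esub> v) = c \<odot>\<^bsub>A\<^esub> (u \<otimes>\<^bsub>A\<^esub> v)"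
  shows "complex_algebra A"
proof -
  have ab: "abelian_group A"
  proof (rule abelian_groupI)
    fix u assume "u \<in> carrier A"
    then show "\<exists>v\<in>carrier A. v \<oplus>\<^bsub>A\<^esub> u = \<zero>\<^bsub>A\<^esub>"
      using smult_closed[of u "- 1"] by (intro bexI[of _ "\<lambda>p. - 1 * u p"]) (auto simp: add zero)
  qed (auto simp: add zero zero_closed add_closed algebra_simps)
  have ring: "ring A" by (rule ringI[OF ab monoid distr])
  have "Module.module (ring_of_type_algebra :: complex ring) A"
    by (rule moduleI[OF cring_from_type_algebra ab])
      (auto simp: ring_of_type_algebra_def add smult smult_closed algebra_simps)
  then show ?thesis
    using ring smult_mult unfolding complex_algebra_def complex_algebra_axioms_def by blast
qed

context compact_etale_groupoid
begin

lemma base_algebra_simps: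
  "f \<otimes>\<^bsub>\<A>\<^esub> f' = (\<lambda>x. f x * f' x)"
  "f \<oplus>\<^bsub>\<A>\<^esub> f' = (\<lambda>x. f x + f' x)"
  "\<zero>\<^bsub>\<A>\<^esub> = (\<lambda>x. 0)"
  "\<one>\<^bsub>\<A>\<^esub> = (\<lambda>x. 1)"
  "c \<odot>\<^bsub>\<A>\<^esub> f = (\<lambda>x. c * f x)"
  by (simp_all add: base_algebra_def)

lemma Cobj_const: "(\<lambda>x. c) \<in> Cobj"
  by (simp add: Cobj_iff obj.smooth_at_const)

lemma Cobj_add: "f \<in> Cobj \<Longrightarrow> f' \<in> Cobj \<Longrightarrow> (\<lambda>x. f x + f' x) \<in> Cobj"
  by (simp add: Cobj_iff obj.smooth_at_add)

lemma Cobj_mult: "f \<in> Cobj \<Longrightarrow> f' \<in> Cobj \<Longrightarrow> (\<lambda>x. f x * f' x) \<in> Cobj"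
  by (simp add: Cobj_iff obj.smooth_at_mult)

lemma Cobj_cnj: "f \<in> Cobj \<Longrightarrow> (\<lambda>x. cnj (f x)) \<in> Cobj"
  by (simp add: Cobj_iff obj.smooth_at_cnj)

lemma base_complex_algebra: "complex_algebra \<A>"
proof (rule function_complex_algebraI)
  show "monoid \<A>"
    by (rule monoidI) (auto simp: base_algebra_simps Cobj_const Cobj_mult mult.assoc)
qed (auto simp: base_algebra_simps Cobj_const Cobj_add Cobj_mult algebra_simps)

lemma convolution_one:
  "conv (unit_ext (\<lambda>x. 1)) u = u" "conv u (unit_ext (\<lambda>x. 1)) = u"
  by (simp_all add: convolution_unit_left convolution_unit_right)

lemma convolution_complex_algebra: "complex_algebra \<H>"
proof (rule function_complex_algebraI)
  show "monoid \<H>"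
    unfolding monoid_def convolution_algebra_simps
    by (intro conjI allI impI convolution_Cc unit_extension_Cc Cobj_const convolution_assoc convolution_one)
  fix u v w assume "u \<in> Cc" "v \<in> Cc" "w \<in> Cc"
  then show "(u \<oplus>\<^bsub>\<H>\<^esub> v) \<otimes>\<^bsub>\<H>\<^esub> w =
      u \<otimes>\<^bsub>\<H>\<^esub> w \<oplus>\<^bsub>\<H>\<^esub> v \<otimes>\<^bsub>\<H>\<^esub> w"
    and "w \<otimes>\<^bsub>\<H>\<^esub> (u \<oplus>\<^bsub>\<H>\<^esub> v) =
      w \<otimes>\<^bsub>\<H>\<^esub> u \<oplus>\<^bsub>\<H>\<^esub> w \<otimes>\<^bsub>\<H>\<^esub> v"
    by (simp_all only: convolution_algebra_simps convolution_add_left convolution_add_right)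
qed (simp_all only: convolution_algebra_simps convolution_smult Cc_zero Cc_add Cc_smult)

lemma base_star_algebra: "star_algebra \<A> function_star"
proof -
  have star: "function_star f = (\<lambda>x. cnj (f x))" for f :: "'x \<Rightarrow> complex"
    by (rule ext) (simp add: function_star_def)
  show ?thesis
    unfolding star_algebra_def star_algebra_axioms_def base_algebra_simps star
    using base_complex_algebra by (simp add: Cobj_cnj mult.commute)
qed

lemma convolution_star_eq: "convolution_star G u = (\<lambda>g. cnj (u (\<iota> g)))"
  by (rule ext) (simp add: convolution_star_def)

lemma convolution_star_algebra: "star_algebra \<H> (convolution_star G)"
proof -
  have mult: "(\<lambda>g. cnj (conv u v (\<iota> g))) = conv (\<lambda>g. cnj (v (\<iota> g))) (\<lambda>g. cnj (u (\<iota> g)))" for u v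
    by (rule ext) (simp add: convolution_ginv cnj_convolution)
  have closed: "(\<lambda>g. cnj (u (\<iota> g))) \<in> Cc" if "u \<in> Cc" for u by (rule Cc_cnj[OF Cc_ginv[OF that]])
  show ?thesis
    unfolding star_algebra_def star_algebra_axioms_def convolution_algebra_simps convolution_star_eq
    using convolution_complex_algebra by (simp add: mult closed)
qed

lemma convolution_ring: "ring \<H>"
  using convolution_complex_algebra by (simp add: complex_algebra_def)

lemma finsum_convolution_algebra:
  assumes "finite S" "\<And>w. w \<in> S \<Longrightarrow> f w \<in> Cc"
  shows "finsum \<H> f S = (\<lambda>g. \<Sum>w\<in>S. f w g)"
proof -
  interpret ring "\<H>" by (rule convolution_ring)
  show ?thesis
    using assms by (induction S rule: finite_induct) (auto simp: convolution_algebra_simps Pi_iff)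
qed

lemma add_pow_convolution_algebra:
  fixes k :: int
  assumes "u \<in> Cc" shows "[k] \<cdot>\<^bsub>\<H>\<^esub> u = (\<lambda>g. of_int k * u g)"
proof -
  interpret ring "\<H>" by (rule convolution_ring)
  have nat: "[n] \<cdot>\<^bsub>\<H>\<^esub> u = (\<lambda>g. of_nat n * u g)" for n :: nat
    by (induction n) (simp_all add: convolution_algebra_simps algebra_simps)
  have minus: "\<ominus>\<^bsub>\<H>\<^esub> v = (\<lambda>g. - v g)" if "v \<in> Cc" for v
    using Cc_smult[OF that, of "- 1"] that
    by (intro minus_equality) (auto simp: convolution_algebra_simps)
  show ?thesis
  proof (cases "k < 0")
    case True
    have "[k] \<cdot>\<^bsub>\<H>\<^esub> u = \<ominus>\<^bsub>\<H>\<^esub> ([nat (- k)] \<cdot>\<^bsub>\<H>\<^esub> u)"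
      unfolding add_pow_def a_inv_def by (rule trans[OF int_pow_def2 if_P[OF True]])
    also have "\<dots> = (\<lambda>g. - (of_nat (nat (- k)) * u g))"
      by (simp only: nat minus[OF Cc_smult[OF assms]])
    also have "\<dots> = (\<lambda>g. of_int k * u g)" using True by (simp add: of_nat_nat)
    finally show ?thesis .
  next
    case False
    then have "[k] \<cdot>\<^bsub>\<H>\<^esub> u = [nat k] \<cdot>\<^bsub>\<H>\<^esub> u"
      by (intro add_pow_int_ge) simp
    also have "\<dots> = (\<lambda>g. of_nat (nat k) * u g)" by (rule nat)
    also have "\<dots> = (\<lambda>g. of_int k * u g)" using False by (simp add: of_nat_nat)
    finally show ?thesis .
  qed
qed

text \<open>The sums in the abstract algebra are pointwise sums, so a contraction of a tensor can be computed at
  each arrow from the function of the tensor.\<close>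

lemma tensor_eval_frag_sum:
  assumes "\<And>w. w \<in> keys p \<Longrightarrow> f w \<in> Cc"
  shows "tensor_eval \<H> f p = (\<lambda>g. frag_sum (\<lambda>w. f w g) p)"
proof -
  interpret ring "\<H>" by (rule convolution_ring)
  have "tensor_eval \<H> f p =
      finsum \<H> (\<lambda>w g. of_int (Poly_Mapping.lookup p w) * f w g) (keys p)"
    unfolding tensor_eval_def
    using assms Cc_smult by (intro finsum_cong') (auto simp: add_pow_convolution_algebra)
  also have "\<dots> = (\<lambda>g. frag_sum (\<lambda>w. f w g) p)"
    using assms Cc_smult by (subst finsum_convolution_algebra) (auto simp: frag_sum_def)
  finally show ?thesis .
qed


section \<open>The counits\<close>

lemma fibre_sum_unit: "fibre_map r \<Longrightarrow> fibre_sum r (unit_ext f) = f"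
proof
  fix x assume r: "fibre_map r"
  have "fibre_sum r (unit_ext f) x = (\<Sum>a\<in>{idn G x}. unit_ext f a)"
  proof (rule fibre_sum_eq)
    show "a \<in> {idn G x}" if "r a = x" "unit_ext f a \<noteq> 0" for a
      using unit_extension_nonzero[OF that(2)] that(1) r by (auto simp: fibre_map_def)
  qed (use r in \<open>auto simp: fibre_map_def src_idn tgt_idn\<close>)
  then show "fibre_sum r (unit_ext f) x = f x" by (simp add: unit_extension_idn)
qed

lemma fibre_sum_add:
  assumes "u \<in> Cc" "v \<in> Cc" "fibre_map r"
  shows "fibre_sum r (\<lambda>g. u g + v g) = (\<lambda>x. fibre_sum r u x + fibre_sum r v x)"
proof
  fix x
  show "fibre_sum r (\<lambda>g. u g + v g) x = fibre_sum r u x + fibre_sum r v x"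
    using fibre_sum_sum[of "UNIV :: bool set" "\<lambda>b. if b then u else v" r x] assms
    by (simp add: UNIV_bool add.commute)
qed

lemma fibre_sum_mult:
  assumes "u \<in> Cc" "fibre_map r"
  shows "fibre_sum r (\<lambda>g. f (r g) * u g) = (\<lambda>x. f x * fibre_sum r u x)"
proof
  fix x
  let ?F = "{g. r g = x \<and> u g \<noteq> 0}"
  have "fibre_sum r (\<lambda>g. f (r g) * u g) x = (\<Sum>a\<in>?F. f (r a) * u a)"
    by (rule fibre_sum_eq) (auto intro: Cc_finite_fibre[OF assms])
  also have "\<dots> = f x * fibre_sum r u x"
    by (simp add: fibre_sum_def sum_distrib_left)
  finally show "fibre_sum r (\<lambda>g. f (r g) * u g) x = f x * fibre_sum r u x" .
qed

lemma fibre_sum_src: "fibre_sum (src G) u = fibre_sum (tgt G) (\<lambda>g. u (\<iota> g))"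
proof
  fix x
  have "{g. src G g = x \<and> u g \<noteq> 0} = \<iota> ` {g. tgt G g = x \<and> u (\<iota> g) \<noteq> 0}"
  proof (intro equalityI subsetI)
    fix g assume "g \<in> {g. src G g = x \<and> u g \<noteq> 0}"
    then show "g \<in> \<iota> ` {g. tgt G g = x \<and> u (\<iota> g) \<noteq> 0}"
      by (intro image_eqI[of _ _ "\<iota> g"]) (auto simp: tgt_ginv)
  qed (auto simp: src_ginv)
  moreover have "inj_on \<iota> S" for S by (rule inj_on_inverseI[where g = \<iota>]) (rule ginv_ginv)
  ultimately show "fibre_sum (src G) u x = fibre_sum (tgt G) (\<lambda>g. u (\<iota> g)) x"
    by (simp add: fibre_sum_def sum.reindex)
qed

text \<open>Convolution with the constant function \<open>1\<close> on the right sums over the fibres of the target map, so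
  the compatibility of the counit with products is associativity with third factor \<open>1\<close>.\<close>

lemma fibre_sum_convolution_tgt:
  assumes "u \<in> Cc" "v \<in> Cc"
  shows "fibre_sum (tgt G) (\<lambda>g. u g * fibre_sum (tgt G) v (src G g)) = fibre_sum (tgt G) (conv u v)"
proof
  fix x
  have one: "conv w (\<lambda>g. 1) g = fibre_sum (tgt G) w (tgt G g)" for w g
    by (simp add: convolution_fibre_sum)
  have "fibre_sum (tgt G) (conv u v) x = conv u (conv v (\<lambda>g. 1)) (idn G x)"
    by (simp add: one tgt_idn flip: convolution_assoc[OF assms])
  also have "\<dots> = fibre_sum (tgt G) (\<lambda>a. u a * fibre_sum (tgt G) v (tgt G (\<iota> a \<diamondop> idn G x))) x"
    by (simp add: convolution_fibre_sum[of u] one tgt_idn)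
  also have "\<dots> = fibre_sum (tgt G) (\<lambda>a. u a * fibre_sum (tgt G) v (src G a)) x"
  proof -
    have "tgt G (\<iota> a \<diamondop> idn G x) = src G a" if "tgt G a = x" for a
      using that by (simp add: tgt_gmul src_ginv tgt_ginv tgt_idn)
    then show ?thesis unfolding fibre_sum_def by (intro sum.cong) auto
  qed
  finally show "fibre_sum (tgt G) (\<lambda>g. u g * fibre_sum (tgt G) v (src G g)) x = fibre_sum (tgt G) (conv u v) x" ..
qed

lemma fibre_sum_convolution_src:
  assumes "u \<in> Cc" "v \<in> Cc"
  shows "fibre_sum (src G) (\<lambda>g. fibre_sum (src G) u (tgt G g) * v g) = fibre_sum (src G) (conv u v)"
  using fibre_sum_convolution_tgt[OF Cc_ginv[OF assms(2)] Cc_ginv[OF assms(1)]]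
  by (simp add: fibre_sum_src tgt_ginv convolution_ginv mult.commute)


section \<open>Identities for the coproducts\<close>

abbreviation coproduct where
  "coproduct r \<equiv> diagonal_tensor G (fibre_balancing r) r"

lemma coproductD:
  assumes "p \<in> coproduct r u" "fibre_map r" "u \<in> Cc"
  shows "keys p \<subseteq> words [r]"
    and "r g = r g' \<Longrightarrow> frag_sum (\<lambda>w. (w ! 0) g * (w ! 1) g') p = delta u g g'"
    and "w \<in> keys p \<Longrightarrow> w ! 0 \<in> Cc" "w \<in> keys p \<Longrightarrow> w ! 1 \<in> Cc"
  using assms(1) unfolding diagonal_tensor_iff[OF assms(2,3)] tensor_function_frag_sum
  by (auto simp: words_iff subset_iff)

lemma coproduct_nonempty: "fibre_map r \<Longrightarrow> u \<in> Cc \<Longrightarrow> \<exists>p. p \<in> coproduct r u"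
  by (rule diagonal_representative[of r u]) (auto simp: diagonal_tensor_iff)

lemma words_pair: "[u, v] \<in> words [r] \<longleftrightarrow> u \<in> Cc \<and> v \<in> Cc"
  by (simp add: words_iff)

lemma frag_extend_keys:
  "(\<And>w. w \<in> keys p \<Longrightarrow> keys (F w) \<subseteq> S) \<Longrightarrow> keys (frag_extend F p) \<subseteq> S"
  using keys_frag_extend[of F p] by blast

lemma frag_extend_words:
  assumes "\<And>w. w \<in> keys p \<Longrightarrow> a w \<in> Cc" "\<And>w. w \<in> keys p \<Longrightarrow> b w \<in> Cc"
  shows "keys (frag_extend (\<lambda>w. frag_of [a w, b w]) p) \<subseteq> words [r]"
  by (rule frag_extend_keys) (auto simp: assms words_pair)

lemma tensor_function_extend:
  "tensor_function (frag_extend F p) g g' = frag_sum (\<lambda>w. tensor_function (F w) g g') p"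
  by (simp add: tensor_function_frag_sum frag_sum_extend)

lemma tensor_function_of: "tensor_function (frag_of [u, v]) g g' = u g * v g'"
  by (simp add: tensor_function_frag_sum)

lemma tclass_pair_eqI:
  assumes "fibre_map r" "keys p \<subseteq> words [r]" "keys q \<subseteq> words [r]"
    and "\<And>g g'. r g = r g' \<Longrightarrow> tensor_function p g g' = tensor_function q g g'"
  shows "tclass [r] p = tclass [r] q"
proof -
  have "\<forall>gs. fibred [r] gs \<longrightarrow> tensor_value p gs = tensor_value q gs"
    unfolding fibred_pair using assms(4) tensor_value_pair[OF assms(2)] tensor_value_pair[OF assms(3)] by simp
  then show ?thesis using assms(1-3) by (intro tclass_eqI) auto
qed

text \<open>Subtracting a representative of \<open>\<Delta> u\<close> from one of \<open>\<Delta> (u + v)\<close> leaves one of \<open>\<Delta> v\<close>, so the coset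
  \<open>\<Delta> (u + v)\<close> is the sum of the other two.\<close>

lemma coproduct_hom:
  assumes r: "fibre_map r"
  shows "coproduct r \<in> hom (add_monoid \<H>) (tensor_product \<H> [fibre_balancing r])"
proof (rule homI)
  fix u assume "u \<in> carrier (add_monoid \<H>)"
  then have u: "u \<in> Cc" by simp
  obtain p where p: "p \<in> coproduct r u" using coproduct_nonempty[OF r u] by blast
  have "coproduct r u = tclass [r] p"
    using coproductD[OF p r u] by (intro diagonal_tensor_eqI[OF r u]) (auto simp: tensor_function_frag_sum)
  then show "coproduct r u \<in> carrier (tensor_product \<H> [fibre_balancing r])"
    using carrier_tensor_product[of "[r]"] coproductD(1)[OF p r u] by auto
next
  fix u v assume "u \<in> carrier (add_monoid \<H>)" "v \<in> carrier (add_monoid \<H>)"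
  then have uv: "u \<in> Cc" "v \<in> Cc" by simp_all
  have d: "delta (\<lambda>g. u g + v g) g g' = delta u g g' + delta v g g'" for g g' by (simp add: delta_def)
  obtain p where p: "p \<in> coproduct r u" using coproduct_nonempty[OF r uv(1)] by blast
  have "coproduct r (\<lambda>g. u g + v g) = {q + q' | q q'. q \<in> coproduct r u \<and> q' \<in> coproduct r v}" (is "?L = ?R")
  proof (intro equalityI subsetI)
    fix x assume "x \<in> ?L"
    then have "x - p \<in> coproduct r v"
      using p keys_diff[of x p]
      by (auto simp: diagonal_tensor_iff r uv Cc_add tensor_function_frag_sum frag_sum_diff d)
    then show "x \<in> ?R" using p by (intro CollectI exI[of _ p] exI[of _ "x - p"]) simp
  next
    fix x assume "x \<in> ?R"
    then obtain q q' where q: "x = q + q'" "q \<in> coproduct r u" "q' \<in> coproduct r v" by blast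
    then show "x \<in> ?L"
      using keys_add[of q q']
      by (auto simp: diagonal_tensor_iff r uv Cc_add tensor_function_frag_sum frag_sum_add d)
  qed
  moreover have "x \<otimes>\<^bsub>tensor_product \<H> [fibre_balancing r]\<^esub> y = {q + q' | q q'. q \<in> x \<and> q' \<in> y}" for x y
    by (auto simp: tensor_product_def FactGroup_def set_mult_def)
  ultimately show "coproduct r (u \<otimes>\<^bsub>add_monoid \<H>\<^esub> v) =
      coproduct r u \<otimes>\<^bsub>tensor_product \<H> [fibre_balancing r]\<^esub> coproduct r v"
    by (simp add: convolution_algebra_simps)
qed

text \<open>Both sides are represented by tensors whose function is \<open>u\<close> on the triple diagonal. With \<open>r = r'\<close> this
  is coassociativity of one coproduct, with \<open>r \<noteq> r'\<close> the mixed law between the left and the right one.\<close>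

lemma coproduct_coassociative:
  assumes r: "fibre_map r" "fibre_map r'"
  shows "coassociative \<H> [fibre_balancing r, fibre_balancing r']
    (coproduct r) (coproduct r') (coproduct r') (coproduct r)"
  unfolding coassociative_def
proof (intro ballI allI impI)
  fix u p q D E
  assume u: "u \<in> Cc" and p: "p \<in> coproduct r' u" and q: "q \<in> coproduct r u"
    and DE: "(\<forall>x\<in>Cc. D x \<in> coproduct r x) \<and> (\<forall>x\<in>Cc. E x \<in> coproduct r' x)"
  note p = coproductD[OF p r(2) u] and q = coproductD[OF q r(1) u]
  have D: "D x \<in> coproduct r x" and E: "E x \<in> coproduct r' x" if "x \<in> Cc" for x using DE that by auto
  note D = coproductD[OF D r(1)] and E = coproductD[OF E r(2)]
  have words3: "[x, y, z] \<in> words [r, r'] \<longleftrightarrow> x \<in> Cc \<and> y \<in> Cc \<and> z \<in> Cc" for x y z by (simp add: words_iff)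
  have pair: "\<exists>x y. v = [x, y]" if "v \<in> words [s]" for v and s :: "'g \<Rightarrow> 'x"
    using that by (auto simp: words_iff length_Suc_conv)
  have "tclass [r, r'] (apply_first D p) = tclass [r, r'] (apply_second E q)"
  proof (rule tclass_eqI)
    show "keys (apply_first D p) \<subseteq> words [r, r']"
      unfolding apply_first_def
    proof (intro frag_extend_keys)
      fix w v assume w: "w \<in> keys p" and v: "v \<in> keys (D (w ! 0))"
      obtain x y where "v = [x, y]" using pair D(1)[OF p(3)[OF w] p(3)[OF w]] v by blast
      then show "keys (frag_of (v @ [w ! 1])) \<subseteq> words [r, r']"
        using D(3,4)[OF p(3)[OF w] p(3)[OF w] v] p(4)[OF w] by (simp add: words3)
    qed
    show "keys (apply_second E q) \<subseteq> words [r, r']"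
      unfolding apply_second_def
    proof (intro frag_extend_keys)
      fix w v assume w: "w \<in> keys q" and v: "v \<in> keys (E (w ! 1))"
      obtain x y where "v = [x, y]" using pair E(1)[OF q(4)[OF w] q(4)[OF w]] v by blast
      then show "keys (frag_of (w ! 0 # v)) \<subseteq> words [r, r']"
        using E(3,4)[OF q(4)[OF w] q(4)[OF w] v] q(3)[OF w] by (simp add: words3)
    qed
    have "tensor_value (apply_first D p) [a, b, c] = (if a = b \<and> b = c then u a else 0)"
      if abc: "r a = r b" "r' b = r' c" for a b c
    proof -
      have "frag_sum (\<lambda>v. word_value (v @ [w ! 1]) [a, b, c]) (D (w ! 0)) = delta (w ! 0) a b * (w ! 1) c"
        if w: "w \<in> keys p" for w
      proof -
        have "frag_sum (\<lambda>v. word_value (v @ [w ! 1]) [a, b, c]) (D (w ! 0))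
            = frag_sum (\<lambda>v. (w ! 1) c * ((v ! 0) a * (v ! 1) b)) (D (w ! 0))"
        proof (rule frag_sum_cong)
          fix v assume "v \<in> keys (D (w ! 0))"
          then obtain x y where "v = [x, y]" using pair D(1)[OF p(3)[OF w] p(3)[OF w]] by blast
          then show "word_value (v @ [w ! 1]) [a, b, c] = (w ! 1) c * ((v ! 0) a * (v ! 1) b)" by simp
        qed
        then show ?thesis
          unfolding frag_sum_mult D(2)[OF p(3)[OF w] p(3)[OF w] abc(1)] by (simp add: mult.commute)
      qed
      then have "tensor_value (apply_first D p) [a, b, c] = frag_sum (\<lambda>w. delta (w ! 0) a b * (w ! 1) c) p"
        unfolding tensor_value_def apply_first_def frag_sum_extend frag_sum_of by (rule frag_sum_cong)
      also have "\<dots> = (if a = b then frag_sum (\<lambda>w. (w ! 0) a * (w ! 1) c) p else 0)"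
        by (simp add: delta_def frag_sum_def)
      also have "\<dots> = (if a = b \<and> b = c then u a else 0)"
        using p(2)[of a c] abc by (auto simp: delta_def)
      finally show ?thesis .
    qed
    moreover have "tensor_value (apply_second E q) [a, b, c] = (if a = b \<and> b = c then u a else 0)"
      if abc: "r a = r b" "r' b = r' c" for a b c
    proof -
      have "frag_sum (\<lambda>v. word_value (w ! 0 # v) [a, b, c]) (E (w ! 1)) = (w ! 0) a * delta (w ! 1) b c"
        if w: "w \<in> keys q" for w
      proof -
        have "frag_sum (\<lambda>v. word_value (w ! 0 # v) [a, b, c]) (E (w ! 1))
            = frag_sum (\<lambda>v. (w ! 0) a * ((v ! 0) b * (v ! 1) c)) (E (w ! 1))"
        proof (rule frag_sum_cong)
          fix v assume "v \<in> keys (E (w ! 1))"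
          then obtain x y where "v = [x, y]" using pair E(1)[OF q(4)[OF w] q(4)[OF w]] by blast
          then show "word_value (w ! 0 # v) [a, b, c] = (w ! 0) a * ((v ! 0) b * (v ! 1) c)" by simp
        qed
        then show ?thesis
          unfolding frag_sum_mult E(2)[OF q(4)[OF w] q(4)[OF w] abc(2)] .
      qed
      then have "tensor_value (apply_second E q) [a, b, c] = frag_sum (\<lambda>w. (w ! 0) a * delta (w ! 1) b c) q"
        unfolding tensor_value_def apply_second_def frag_sum_extend frag_sum_of by (rule frag_sum_cong)
      also have "\<dots> = (if b = c then frag_sum (\<lambda>w. (w ! 0) a * (w ! 1) b) q else 0)"
        by (simp add: delta_def frag_sum_def)
      also have "\<dots> = (if a = b \<and> b = c then u a else 0)"
        using q(2)[OF abc(1)] by (auto simp: delta_def)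
      finally show ?thesis .
    qed
    ultimately have "\<forall>gs. fibred [r, r'] gs \<longrightarrow> tensor_value (apply_first D p) gs = tensor_value (apply_second E q) gs"
      unfolding fibred_triple by simp
    then show "fibred [r, r'] gs \<Longrightarrow> tensor_value (apply_first D p) gs = tensor_value (apply_second E q) gs" for gs
      by blast
  qed (use r in auto)
  then show "tensor_class \<H> [fibre_balancing r, fibre_balancing r'] (apply_first D p) =
      tensor_class \<H> [fibre_balancing r, fibre_balancing r'] (apply_second E q)"
    by (simp add: tclass_def)
qed

text \<open>Summing the diagonal function \<open>\<delta>\<^bsub>a,g\<^esub> u(g)\<close> over all \<open>a\<close> in the fibre of \<open>g\<close> returns \<open>u(g)\<close>.\<close>

lemma coproduct_counit:
  assumes p: "p \<in> coproduct r u" and r: "fibre_map r" and u: "u \<in> Cc"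
  shows "frag_sum (\<lambda>w. fibre_sum r (w ! 0) (r g) * (w ! 1) g) p = u g"
    and "frag_sum (\<lambda>w. fibre_sum r (w ! 1) (r g) * (w ! 0) g) p = u g"
proof -
  note P = coproductD[OF p r u]
  let ?I = "(\<lambda>w. w ! 0) ` keys p \<union> (\<lambda>w. w ! 1) ` keys p"
  have "finite ?I" "\<forall>v\<in>?I. v \<in> Cc" using P(3,4) by auto
  from finite_fibre_support[OF this r, of "r g"]
  obtain F where F: "finite F" "\<forall>a\<in>F. r a = r g" "\<forall>v\<in>?I. \<forall>a. r a = r g \<longrightarrow> v a \<noteq> 0 \<longrightarrow> a \<in> F"
    by blast
  let ?F = "insert g F"
  have fin: "finite ?F" using F(1) by simp
  have F': "a \<in> ?F \<Longrightarrow> r a = r g" for a using F(2) by blast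
  have sum: "fibre_sum r v (r g) = (\<Sum>a\<in>?F. v a)" if "v \<in> ?I" for v
    by (rule fibre_sum_eq[OF fin F']) (use F(3) that in blast)+
  have "frag_sum (\<lambda>w. fibre_sum r (w ! 0) (r g) * (w ! 1) g) p = frag_sum (\<lambda>w. \<Sum>a\<in>?F. (w ! 0) a * (w ! 1) g) p"
    using sum by (intro frag_sum_cong) (simp add: sum_distrib_right del: sum.insert)
  also have "\<dots> = (\<Sum>a\<in>?F. delta u a g)"
    unfolding frag_sum_swap by (rule sum.cong[OF refl]) (rule P(2)[OF F'])
  also have "\<dots> = u g" using fin unfolding delta_def by (simp add: sum.delta del: sum.insert)
  finally show "frag_sum (\<lambda>w. fibre_sum r (w ! 0) (r g) * (w ! 1) g) p = u g" .
  have "frag_sum (\<lambda>w. fibre_sum r (w ! 1) (r g) * (w ! 0) g) p = frag_sum (\<lambda>w. \<Sum>a\<in>?F. (w ! 0) g * (w ! 1) a) p"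
    using sum by (intro frag_sum_cong) (simp add: sum_distrib_left mult.commute del: sum.insert)
  also have "\<dots> = (\<Sum>a\<in>?F. delta u g a)"
    unfolding frag_sum_swap by (rule sum.cong[OF refl]) (rule P(2)[OF F'[symmetric]])
  also have "\<dots> = u g" using fin unfolding delta_def by (simp add: sum.delta' del: sum.insert)
  finally show "frag_sum (\<lambda>w. fibre_sum r (w ! 1) (r g) * (w ! 0) g) p = u g" .
qed


lemma unit_extension_mult:
  "conv (unit_ext f) (unit_ext f') = unit_ext (\<lambda>x. f x * f' x)"
  by (rule ext) (auto simp: convolution_unit_left unit_extension_def src_idn tgt_idn)

lemma unit_extension_hom: "unit_ext \<in> complex_algebra_hom \<A> \<H>"
  unfolding complex_algebra_hom_def ring_hom_def
  by (auto simp: base_algebra_simps convolution_algebra_simps unit_extension_Cc unit_extension_mult)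
    (auto simp: unit_extension_def fun_eq_iff)

lemma unit_extension_opposite_hom:
  "unit_ext \<in> complex_algebra_hom (opposite_algebra \<A>) \<H>"
  using unit_extension_hom unfolding complex_algebra_hom_def ring_hom_def opposite_algebra_def
  by (auto simp: base_algebra_simps mult.commute)

lemma coproduct_eqI:
  assumes "fibre_map r" "u \<in> Cc" "keys p \<subseteq> words [r]"
    and "\<And>g g'. r g = r g' \<Longrightarrow> tensor_function p g g' = delta u g g'"
  shows "coproduct r u = tensor_class \<H> [fibre_balancing r] p"
  using diagonal_tensor_eqI[OF assms] by (simp add: tclass_def)

lemma coproduct_unit:
  assumes "fibre_map r"
  shows "coproduct r (unit_ext (\<lambda>x. 1)) = tensor_class \<H> [fibre_balancing r]
    (frag_of [unit_ext (\<lambda>x. 1), unit_ext (\<lambda>x. 1)])"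
proof (rule coproduct_eqI[OF assms])
  let ?e = "unit_ext (\<lambda>x. 1)"
  fix g g' assume r: "r g = r g'"
  have unit: "g = idn G (r g)" if "?e g \<noteq> 0" for g
    using unit_extension_nonzero[OF that] assms by (auto simp: fibre_map_def)
  show "tensor_function (frag_of [?e, ?e]) g g' = delta ?e g g'"
  proof (cases "g = g'")
    case True
    then show ?thesis by (simp add: tensor_function_of delta_def unit_extension_def)
  next
    case False
    then have "?e g = 0 \<or> ?e g' = 0" using unit[of g] unit[of g'] r by force
    then show ?thesis using False by (auto simp: tensor_function_of delta_def)
  qed
qed (auto simp: unit_extension_Cc Cobj_const words_pair)

lemma frag_sum_product:
  "frag_sum (\<lambda>w. frag_sum (\<lambda>w'. f w * f' w') p') p = frag_sum f p * frag_sum f' p'"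
proof -
  have "frag_sum (\<lambda>w. f w * c) p = frag_sum f p * c" for c
    by (simp add: frag_sum_def sum_distrib_right mult.assoc)
  then show ?thesis by (simp only: frag_sum_mult)
qed

text \<open>After both convolutions have been expanded over factorisations \<open>g = a b\<close> and \<open>g' = a' b'\<close>, the function
  of \<open>\<Delta> u\<close> forces \<open>a = a'\<close>; then \<open>b\<close> and \<open>b'\<close> have the same target, so the function of \<open>\<Delta> v\<close> forces
  \<open>b = b'\<close>, and \<open>g = g'\<close> is left.\<close>

lemma coproduct_mult_function_tgt:
  assumes u: "u \<in> Cc" "p \<in> coproduct (tgt G) u" and v: "v \<in> Cc" "q \<in> coproduct (tgt G) v"
    and t: "tgt G g = tgt G g'"
  shows "frag_sum (\<lambda>w. frag_sum (\<lambda>w'. conv (w ! 0) (w' ! 0) g * conv (w ! 1) (w' ! 1) g') q) p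
    = delta (conv u v) g g'"
proof -
  note P = coproductD[OF u(2) fibre_map_tgt u(1)] and Q = coproductD[OF v(2) fibre_map_tgt v(1)]
  let ?I = "insert u ((\<lambda>w. w ! 0) ` keys p \<union> (\<lambda>w. w ! 1) ` keys p)"
  have "finite ?I" "\<forall>v\<in>?I. v \<in> Cc" using P(3,4) u(1) by auto
  from finite_fibre_support[OF this fibre_map_tgt, of "tgt G g"]
  obtain F where F: "finite F" "\<forall>a\<in>F. tgt G a = tgt G g" "\<forall>v\<in>?I. \<forall>a. tgt G a = tgt G g \<longrightarrow> v a \<noteq> 0 \<longrightarrow> a \<in> F"
    by blast
  have conv: "conv x y h = (\<Sum>a\<in>F. x a * y (\<iota> a \<diamondop> h))" if "x \<in> ?I" "tgt G h = tgt G g" for x y h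
    by (rule convolution_eq[OF F(1)], unfold that(2))
      (rule F(2)[rule_format], assumption, rule F(3)[rule_format, OF that(1)])
  have src: "tgt G (\<iota> a \<diamondop> g) = src G a" "tgt G (\<iota> a \<diamondop> g') = src G a" if "a \<in> F" for a
    using F(2) that t by (simp_all add: tgt_gmul src_ginv tgt_ginv)
  have "frag_sum (\<lambda>w. frag_sum (\<lambda>w'. conv (w ! 0) (w' ! 0) g * conv (w ! 1) (w' ! 1) g') q) p
      = frag_sum (\<lambda>w. frag_sum (\<lambda>w'. \<Sum>a\<in>F. \<Sum>a'\<in>F.
          ((w ! 0) a * (w ! 1) a') * ((w' ! 0) (\<iota> a \<diamondop> g) * (w' ! 1) (\<iota> a' \<diamondop> g'))) q) p"
    using conv t by (intro frag_sum_cong) (simp add: sum_product mult_ac)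
  also have "\<dots> = (\<Sum>a\<in>F. \<Sum>a'\<in>F. frag_sum (\<lambda>w. (w ! 0) a * (w ! 1) a') p
      * frag_sum (\<lambda>w'. (w' ! 0) (\<iota> a \<diamondop> g) * (w' ! 1) (\<iota> a' \<diamondop> g')) q)"
    unfolding frag_sum_swap frag_sum_product ..
  also have "\<dots> = (\<Sum>a\<in>F. \<Sum>a'\<in>F. delta u a a' * frag_sum (\<lambda>w'. (w' ! 0) (\<iota> a \<diamondop> g) * (w' ! 1) (\<iota> a' \<diamondop> g')) q)"
    using P(2) F(2) by (intro sum.cong refl) simp
  also have "\<dots> = (\<Sum>a\<in>F. u a * frag_sum (\<lambda>w'. (w' ! 0) (\<iota> a \<diamondop> g) * (w' ! 1) (\<iota> a \<diamondop> g')) q)"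
  proof (rule sum.cong[OF refl])
    fix a assume "a \<in> F"
    have "(\<Sum>a'\<in>F. delta u a a' * frag_sum (\<lambda>w'. (w' ! 0) (\<iota> a \<diamondop> g) * (w' ! 1) (\<iota> a' \<diamondop> g')) q)
        = (\<Sum>a'\<in>F. if a = a' then u a * frag_sum (\<lambda>w'. (w' ! 0) (\<iota> a \<diamondop> g) * (w' ! 1) (\<iota> a' \<diamondop> g')) q else 0)"
      by (intro sum.cong refl) (simp add: delta_def)
    also have "\<dots> = u a * frag_sum (\<lambda>w'. (w' ! 0) (\<iota> a \<diamondop> g) * (w' ! 1) (\<iota> a \<diamondop> g')) q"
      using F(1) \<open>a \<in> F\<close> by (simp add: sum.delta')
    finally show "(\<Sum>a'\<in>F. delta u a a' * frag_sum (\<lambda>w'. (w' ! 0) (\<iota> a \<diamondop> g) * (w' ! 1) (\<iota> a' \<diamondop> g')) q)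
        = u a * frag_sum (\<lambda>w'. (w' ! 0) (\<iota> a \<diamondop> g) * (w' ! 1) (\<iota> a \<diamondop> g')) q" .
  qed
  also have "\<dots> = (\<Sum>a\<in>F. u a * delta v (\<iota> a \<diamondop> g) (\<iota> a \<diamondop> g'))"
  proof (rule sum.cong[OF refl])
    fix a assume "a \<in> F"
    then have "tgt G (\<iota> a \<diamondop> g) = tgt G (\<iota> a \<diamondop> g')" using src by simp
    from Q(2)[OF this] show "u a * frag_sum (\<lambda>w'. (w' ! 0) (\<iota> a \<diamondop> g) * (w' ! 1) (\<iota> a \<diamondop> g')) q
        = u a * delta v (\<iota> a \<diamondop> g) (\<iota> a \<diamondop> g')" by simp
  qed
  also have "\<dots> = delta (conv u v) g g'"
  proof (cases "g = g'")
    case True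
    then show ?thesis using conv[of u g v] by (simp add: delta_def)
  next
    case False
    have "\<iota> a \<diamondop> g \<noteq> \<iota> a \<diamondop> g'" if "a \<in> F" for a
      using False ginv_mul_cancel[of a g] ginv_mul_cancel[of a g'] F(2) t that by metis
    then show ?thesis using False by (simp add: delta_def)
  qed
  finally show ?thesis .
qed

text \<open>Inversion reverses products and exchanges source and target, so the source version follows.\<close>

lemma coproduct_ginv:
  assumes "p \<in> coproduct (src G) u" "u \<in> Cc"
  shows "frag_extend (\<lambda>w. frag_of [\<lambda>g. (w ! 1) (\<iota> g), \<lambda>g. (w ! 0) (\<iota> g)]) p \<in> coproduct (tgt G) (\<lambda>g. u (\<iota> g))"
proof -
  note P = coproductD[OF assms(1) fibre_map_src assms(2)]
  have "tensor_function (frag_extend (\<lambda>w. frag_of [\<lambda>g. (w ! 1) (\<iota> g), \<lambda>g. (w ! 0) (\<iota> g)]) p) g g' = delta (\<lambda>g. u (\<iota> g)) g g'"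
    if "tgt G g = tgt G g'" for g g'
  proof -
    have "frag_sum (\<lambda>w. (w ! 0) (\<iota> g') * (w ! 1) (\<iota> g)) p = delta u (\<iota> g') (\<iota> g)"
      using that by (intro P(2)) (simp add: src_ginv)
    moreover have "\<iota> g' = \<iota> g \<longleftrightarrow> g = g'" by (metis ginv_ginv)
    ultimately show ?thesis by (simp add: tensor_function_extend tensor_function_of delta_def mult.commute)
  qed
  then show ?thesis
    using frag_extend_words[of p "\<lambda>w g. (w ! 1) (\<iota> g)" "\<lambda>w g. (w ! 0) (\<iota> g)" "tgt G"] P(3,4)
    by (simp add: diagonal_tensor_iff Cc_ginv[OF assms(2)] Cc_ginv)
qed

lemma coproduct_mult_function_src:
  assumes u: "u \<in> Cc" "p \<in> coproduct (src G) u" and v: "v \<in> Cc" "q \<in> coproduct (src G) v"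
    and t: "src G g = src G g'"
  shows "frag_sum (\<lambda>w. frag_sum (\<lambda>w'. conv (w ! 0) (w' ! 0) g * conv (w ! 1) (w' ! 1) g') q) p
    = delta (conv u v) g g'"
proof -
  have inv: "conv x y h = conv (\<lambda>g. y (\<iota> g)) (\<lambda>g. x (\<iota> g)) (\<iota> h)" for x y h
    using convolution_ginv[of x y "\<iota> h"] by simp
  have swap: "frag_sum (\<lambda>w. frag_sum (\<lambda>w'. f w w') q) p = frag_sum (\<lambda>w'. frag_sum (\<lambda>w. f w w') p) q"
    for f :: "_ \<Rightarrow> _ \<Rightarrow> complex"
    unfolding frag_sum_def sum_distrib_left by (subst sum.swap) (simp add: mult.left_commute)
  have "tgt G (\<iota> g') = tgt G (\<iota> g)" using t by (simp add: tgt_ginv)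
  from coproduct_mult_function_tgt[OF Cc_ginv[OF v(1)] coproduct_ginv[OF v(2,1)] Cc_ginv[OF u(1)] coproduct_ginv[OF u(2,1)] this]
  have "frag_sum (\<lambda>w'. frag_sum (\<lambda>w. conv (\<lambda>g. (w' ! 1) (\<iota> g)) (\<lambda>g. (w ! 1) (\<iota> g)) (\<iota> g')
      * conv (\<lambda>g. (w' ! 0) (\<iota> g)) (\<lambda>g. (w ! 0) (\<iota> g)) (\<iota> g)) p) q
      = delta (conv (\<lambda>g. v (\<iota> g)) (\<lambda>g. u (\<iota> g))) (\<iota> g') (\<iota> g)"
    by (simp add: frag_sum_extend)
  also have "\<dots> = delta (conv u v) g g'"
  proof -
    have "\<iota> g' = \<iota> g \<longleftrightarrow> g = g'" by (metis ginv_ginv)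
    then show ?thesis by (simp add: delta_def inv[of u v g'])
  qed
  also have "frag_sum (\<lambda>w'. frag_sum (\<lambda>w. conv (\<lambda>g. (w' ! 1) (\<iota> g)) (\<lambda>g. (w ! 1) (\<iota> g)) (\<iota> g')
      * conv (\<lambda>g. (w' ! 0) (\<iota> g)) (\<lambda>g. (w ! 0) (\<iota> g)) (\<iota> g)) p) q
    = frag_sum (\<lambda>w'. frag_sum (\<lambda>w. conv (w ! 0) (w' ! 0) g * conv (w ! 1) (w' ! 1) g') p) q"
    by (simp only: mult.commute flip: inv)
  finally show ?thesis by (simp only: swap)
qed

lemma coproduct_mult:
  assumes r: "fibre_map r" and u: "u \<in> Cc" "p \<in> coproduct r u" and v: "v \<in> Cc" "q \<in> coproduct r v"
  shows "coproduct r (conv u v) = tensor_class \<H> [fibre_balancing r]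
    (frag_extend (\<lambda>w. frag_extend (\<lambda>w'. frag_of [conv (w ! 0) (w' ! 0), conv (w ! 1) (w' ! 1)]) q) p)"
proof (rule coproduct_eqI[OF r convolution_Cc[OF u(1) v(1)]])
  note P = coproductD[OF u(2) r u(1)] and Q = coproductD[OF v(2) r v(1)]
  show "keys (frag_extend (\<lambda>w. frag_extend (\<lambda>w'. frag_of [conv (w ! 0) (w' ! 0),
      conv (w ! 1) (w' ! 1)]) q) p) \<subseteq> words [r]"
    by (rule frag_extend_keys, rule frag_extend_words; intro convolution_Cc P(3,4) Q(3,4); assumption)
  fix g g' assume "r g = r g'"
  then show "tensor_function (frag_extend (\<lambda>w. frag_extend (\<lambda>w'. frag_of [conv (w ! 0) (w' ! 0),
      conv (w ! 1) (w' ! 1)]) q) p) g g' = delta (conv u v) g g'"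
    unfolding tensor_function_extend tensor_function_of
    using r u v coproduct_mult_function_tgt[of u p v q g g'] coproduct_mult_function_src[of u p v q g g']
    unfolding fibre_map_def by (elim disjE) (simp_all only:)
qed

text \<open>For \<open>g\<close> not a unit no \<open>a\<close> satisfies \<open>a\<^sup>-\<^sup>1 = a\<^sup>-\<^sup>1 g\<close>, and for \<open>g\<close> a unit every \<open>a\<close> in its fibre does:
  this is how the antipode produces functions supported on the units.\<close>

lemma coproduct_antipode_tgt:
  assumes p: "p \<in> coproduct (tgt G) u" and u: "u \<in> Cc"
  shows "frag_sum (\<lambda>w. conv (\<lambda>g. (w ! 0) (\<iota> g)) (w ! 1) g) p = unit_ext (fibre_sum (src G) u) g"
proof -
  note P = coproductD[OF p fibre_map_tgt u]
  let ?I = "insert (\<lambda>g. u (\<iota> g)) ((\<lambda>w g. (w ! 0) (\<iota> g)) ` keys p)"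
  have "finite ?I" "\<forall>v\<in>?I. v \<in> Cc" using P(3) u by (auto intro: Cc_ginv)
  from finite_fibre_support[OF this fibre_map_tgt, of "tgt G g"]
  obtain F where F: "finite F" "\<forall>a\<in>F. tgt G a = tgt G g" "\<forall>v\<in>?I. \<forall>a. tgt G a = tgt G g \<longrightarrow> v a \<noteq> 0 \<longrightarrow> a \<in> F"
    by blast
  have conv: "conv x y g = (\<Sum>a\<in>F. x a * y (\<iota> a \<diamondop> g))" if "x \<in> ?I" for x y
    by (rule convolution_eq[OF F(1)])
      (rule F(2)[rule_format], assumption, rule F(3)[rule_format, OF that])
  have "frag_sum (\<lambda>w. conv (\<lambda>g. (w ! 0) (\<iota> g)) (w ! 1) g) p
      = frag_sum (\<lambda>w. \<Sum>a\<in>F. (w ! 0) (\<iota> a) * (w ! 1) (\<iota> a \<diamondop> g)) p"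
    by (rule frag_sum_cong) (simp add: conv)
  also have "\<dots> = (\<Sum>a\<in>F. delta u (\<iota> a) (\<iota> a \<diamondop> g))"
    unfolding frag_sum_swap
    by (intro sum.cong refl P(2)) (use F(2) in \<open>simp add: tgt_gmul src_ginv tgt_ginv\<close>)
  also have "\<dots> = unit_ext (fibre_sum (src G) u) g"
  proof (cases "g \<in> range (idn G)")
    case True
    then obtain x where x: "g = idn G x" by blast
    have "\<iota> a \<diamondop> g = \<iota> a" if "a \<in> F" for a
      using idn_right[of "\<iota> a"] F(2) that by (simp add: x src_ginv tgt_idn)
    then have "(\<Sum>a\<in>F. delta u (\<iota> a) (\<iota> a \<diamondop> g)) = (\<Sum>a\<in>F. u (\<iota> a))" by (simp add: delta_def)
    also have "\<dots> = fibre_sum (tgt G) (\<lambda>g. u (\<iota> g)) x"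
    proof (rule fibre_sum_eq[symmetric, OF F(1)])
      show "tgt G a = x" if "a \<in> F" for a using F(2) that by (simp add: x tgt_idn)
      show "a \<in> F" if "tgt G a = x" "u (\<iota> a) \<noteq> 0" for a
      proof (rule F(3)[rule_format, OF insertI1])
        show "tgt G a = tgt G g" using that(1) by (simp add: x tgt_idn)
      qed (rule that(2))
    qed
    finally show ?thesis by (simp add: x unit_extension_idn fibre_sum_src)
  next
    case False
    have "\<iota> a \<noteq> \<iota> a \<diamondop> g" if "a \<in> F" for a
    proof
      assume "\<iota> a = \<iota> a \<diamondop> g"
      then have "g = a \<diamondop> \<iota> a" using ginv_mul_cancel[of a g] F(2) that by simp
      then show False using False by (simp add: ginv_right)
    qed
    then show ?thesis using False by (simp add: delta_def unit_extension_def)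
  qed
  finally show ?thesis .
qed

lemma coproduct_antipode_src:
  assumes p: "p \<in> coproduct (src G) u" and u: "u \<in> Cc"
  shows "frag_sum (\<lambda>w. conv (w ! 0) (\<lambda>g. (w ! 1) (\<iota> g)) g) p = unit_ext (fibre_sum (tgt G) u) g"
proof -
  have 1: "frag_sum (\<lambda>w. conv (\<lambda>g. (w ! 1) (\<iota> (\<iota> g))) (\<lambda>g. (w ! 0) (\<iota> g)) (\<iota> g)) p
      = unit_ext (fibre_sum (src G) (\<lambda>g. u (\<iota> g))) (\<iota> g)"
    using coproduct_antipode_tgt[OF coproduct_ginv[OF p u] Cc_ginv[OF u], of "\<iota> g"]
    by (simp add: frag_sum_extend)
  have 2: "conv (\<lambda>g. (w ! 1) (\<iota> (\<iota> g))) (\<lambda>g. (w ! 0) (\<iota> g)) (\<iota> g)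
      = conv (w ! 0) (\<lambda>g. (w ! 1) (\<iota> g)) g" for w
    using convolution_ginv[of "w ! 0" "\<lambda>g. (w ! 1) (\<iota> g)" "\<iota> g"] by simp
  have 3: "fibre_sum (src G) (\<lambda>g. u (\<iota> g)) = fibre_sum (tgt G) u" by (simp add: fibre_sum_src)
  show ?thesis using 1 unfolding 2 3 unit_extension_ginv .
qed

section \<open>The Hopf star-algebroid\<close>

text \<open>The base algebra acts on either factor, from either side, by multiplication with a function of the
  source or target. Here \<open>c\<close> collects these scalars.\<close>

lemma tensor_function_rescaled:
  assumes "fibre_map r" "u \<in> Cc" "p \<in> coproduct r u" "r g = r g'"
    and "\<And>w. a w g * b w g' = c * ((w ! 0) g * (w ! 1) g')"
  shows "tensor_function (frag_extend (\<lambda>w. frag_of [a w, b w]) p) g g' = c * delta u g g'"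
  unfolding tensor_function_extend tensor_function_of assms(5) frag_sum_mult
    coproductD(2)[OF assms(3,1,2,4)] ..

lemma coproduct_rescaled:
  assumes "fibre_map r" "u \<in> Cc" "p \<in> coproduct r u" "u' \<in> Cc"
    and "\<And>w. w \<in> keys p \<Longrightarrow> a w \<in> Cc" "\<And>w. w \<in> keys p \<Longrightarrow> b w \<in> Cc"
    and "\<And>w g g'. a w g * b w g' = c g g' * ((w ! 0) g * (w ! 1) g')"
    and "\<And>g. c g g * u g = u' g"
  shows "coproduct r u' = tensor_class \<H> [fibre_balancing r]
    (frag_extend (\<lambda>w. frag_of [a w, b w]) p)"
proof (rule coproduct_eqI[OF assms(1,4) frag_extend_words[OF assms(5,6)]])
  fix g g' assume "r g = r g'"
  from tensor_function_rescaled[OF assms(1,2,3) this, of a b "c g g'"] assms(7,8)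
  show "tensor_function (frag_extend (\<lambda>w. frag_of [a w, b w]) p) g g' = delta u' g g'"
    by (simp add: delta_def)
qed

text \<open>On the diagonal it does not matter whether the scalar is taken at the first or the second arrow.\<close>

lemma coproduct_takeuchi:
  assumes "fibre_map r" "u \<in> Cc" "p \<in> coproduct r u"
    and "\<And>w. w \<in> keys p \<Longrightarrow> a w \<in> Cc" "\<And>w. w \<in> keys p \<Longrightarrow> b w \<in> Cc"
    and "\<And>w g g'. a w g * (w ! 1) g' = c g * ((w ! 0) g * (w ! 1) g')"
    and "\<And>w g g'. (w ! 0) g * b w g' = c g' * ((w ! 0) g * (w ! 1) g')"
  shows "tensor_class \<H> [fibre_balancing r] (frag_extend (\<lambda>w. frag_of [a w, w ! 1]) p)
    = tensor_class \<H> [fibre_balancing r] (frag_extend (\<lambda>w. frag_of [w ! 0, b w]) p)"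
proof -
  note P = coproductD(3,4)[OF assms(3,1,2)]
  have "tclass [r] (frag_extend (\<lambda>w. frag_of [a w, w ! 1]) p) = tclass [r] (frag_extend (\<lambda>w. frag_of [w ! 0, b w]) p)"
  proof (rule tclass_pair_eqI[OF assms(1) frag_extend_words[OF assms(4) P(2)] frag_extend_words[OF P(1) assms(5)]])
    fix g g' assume r: "r g = r g'"
    show "tensor_function (frag_extend (\<lambda>w. frag_of [a w, w ! 1]) p) g g' =
        tensor_function (frag_extend (\<lambda>w. frag_of [w ! 0, b w]) p) g g'"
      using tensor_function_rescaled[OF assms(1-3) r, of a "\<lambda>w. w ! 1" "c g", OF assms(6)]
        tensor_function_rescaled[OF assms(1-3) r, of "\<lambda>w. w ! 0" b "c g'", OF assms(7)]
      by (simp add: delta_def)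
  qed
  then show ?thesis by (simp add: tclass_def)
qed

lemma Cc_unit_left: "f \<in> Cobj \<Longrightarrow> u \<in> Cc \<Longrightarrow> conv (unit_ext f) u \<in> Cc"
  by (intro convolution_Cc unit_extension_Cc)

lemma Cc_unit_right: "f \<in> Cobj \<Longrightarrow> u \<in> Cc \<Longrightarrow> conv u (unit_ext f) \<in> Cc"
  by (intro convolution_Cc unit_extension_Cc)

lemma unit_extension_commute:
  "conv (unit_ext a) (unit_ext b) = conv (unit_ext b) (unit_ext a)"
  by (simp add: unit_extension_mult mult.commute)

lemma coproduct_hom_balancing:
  "coproduct (tgt G) \<in> hom (add_monoid \<H>) (tensor_product \<H>
    [left_balancing \<H> \<A> (unit_ext) (unit_ext)])"
  "coproduct (src G) \<in> hom (add_monoid \<H>) (tensor_product \<H>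
    [right_balancing \<H> \<A> (unit_ext) (unit_ext)])"
  unfolding left_balancing_eq right_balancing_eq by (simp_all only: coproduct_hom fibre_map_src fibre_map_tgt)

lemma left_bialgebroid_convolution:
  "left_bialgebroid \<H> \<A> (unit_ext) (unit_ext)
    (coproduct (tgt G)) (fibre_sum (tgt G))"
proof (intro left_bialgebroid.intro left_bialgebroid_axioms.intro convolution_complex_algebra
    base_complex_algebra unit_extension_hom unit_extension_opposite_hom coproduct_hom_balancing,
    unfold left_balancing_eq convolution_algebra_simps base_algebra_simps)
  let ?\<Delta> = "coproduct (tgt G)" and ?\<epsilon> = "fibre_sum (tgt G)" and ?e = "unit_ext"
    and ?class = "tensor_class \<H> [fibre_balancing (tgt G)]"
  note t = fibre_map_tgt
  show "conv (?e a) (?e b) = conv (?e b) (?e a)" for a b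
    by (rule unit_extension_commute)
  show "coassociative \<H> [fibre_balancing (tgt G), fibre_balancing (tgt G)] ?\<Delta> ?\<Delta> ?\<Delta> ?\<Delta>"
    by (rule coproduct_coassociative[OF t t])
  show "?\<Delta> (?e (\<lambda>x. 1)) = ?class (frag_of [?e (\<lambda>x. 1), ?e (\<lambda>x. 1)])"
    by (rule coproduct_unit[OF t])
  show "?\<epsilon> (?e (\<lambda>x. 1)) = (\<lambda>x. 1)" by (rule fibre_sum_unit[OF t])
  fix u assume u: "u \<in> Cc"
  show "?\<epsilon> u \<in> Cobj" by (rule fibre_sum_Cobj[OF u t])
  show "?\<epsilon> (conv (conv (?e a) (?e b)) u) = (\<lambda>x. a x * ?\<epsilon> u x * b x)"
    if "a \<in> Cobj" "b \<in> Cobj" for a b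
    unfolding unit_extension_mult
    unfolding convolution_unit_left fibre_sum_mult[OF u t, of "\<lambda>x. a x * b x"] by (simp add: mult_ac)
  {
    fix v assume v: "v \<in> Cc"
    show "?\<epsilon> (\<lambda>g. u g + v g) = (\<lambda>x. ?\<epsilon> u x + ?\<epsilon> v x)" by (rule fibre_sum_add[OF u v t])
    show "?\<epsilon> (conv u (?e (?\<epsilon> v))) = ?\<epsilon> (conv u v)"
      unfolding convolution_unit_right by (rule fibre_sum_convolution_tgt[OF u v])
    then show "?\<epsilon> (conv u (?e (?\<epsilon> v))) = ?\<epsilon> (conv u v)" .
  }
  fix p assume p: "p \<in> ?\<Delta> u"
  note P = coproductD(3,4)[OF p t u]
  show "?\<Delta> (conv u v) = ?class (frag_extend (\<lambda>w. frag_extend (\<lambda>w'.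
      frag_of [conv (w ! 0) (w' ! 0), conv (w ! 1) (w' ! 1)]) q) p)"
    if "v \<in> Cc" "q \<in> ?\<Delta> v" for v q
    by (rule coproduct_mult[OF t u p that])
  show "?\<Delta> (conv (conv (?e a) (?e b)) u) = ?class (frag_extend (\<lambda>w.
      frag_of [conv (?e a) (w ! 0), conv (?e b) (w ! 1)]) p)"
    if ab: "a \<in> Cobj" "b \<in> Cobj" for a b
  proof (rule coproduct_rescaled[OF t u p, where c = "\<lambda>g g'. a (tgt G g) * b (tgt G g')"])
    show "conv (conv (?e a) (?e b)) u \<in> Cc"
      by (intro convolution_Cc unit_extension_Cc ab u)
    show "conv (?e a) (w ! 0) \<in> Cc" "conv (?e b) (w ! 1) \<in> Cc"
      if "w \<in> keys p" for w
      by (intro Cc_unit_left ab P that)+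
    show "a (tgt G g) * b (tgt G g) * u g = conv (conv (?e a) (?e b)) u g" for g
      unfolding unit_extension_mult unfolding convolution_unit_left ..
  qed (simp add: convolution_unit_left)
  show "?class (frag_extend (\<lambda>w. frag_of [conv (w ! 0) (?e a), w ! 1]) p) =
      ?class (frag_extend (\<lambda>w. frag_of [w ! 0, conv (w ! 1) (?e a)]) p)"
    if a: "a \<in> Cobj" for a
  proof (rule coproduct_takeuchi[OF t u p, where c = "\<lambda>g. a (src G g)"])
    show "conv (w ! 0) (?e a) \<in> Cc" "conv (w ! 1) (?e a) \<in> Cc"
      if "w \<in> keys p" for w
      by (intro Cc_unit_right a P that)+
  qed (simp_all add: convolution_unit_right)
  have "tensor_eval \<H> (\<lambda>w. conv (?e (?\<epsilon> (w ! 0))) (w ! 1)) p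
      = (\<lambda>g. frag_sum (\<lambda>w. ?\<epsilon> (w ! 0) (tgt G g) * (w ! 1) g) p)"
  proof (subst tensor_eval_frag_sum)
    show "conv (?e (?\<epsilon> (w ! 0))) (w ! 1) \<in> Cc" if "w \<in> keys p" for w
      by (intro Cc_unit_left fibre_sum_Cobj t P that)
  qed (simp only: convolution_unit_left)
  then show "tensor_eval \<H> (\<lambda>w. conv (?e (?\<epsilon> (w ! 0))) (w ! 1)) p = u"
    by (simp only: coproduct_counit(1)[OF p t u])
  have "tensor_eval \<H> (\<lambda>w. conv (?e (?\<epsilon> (w ! 1))) (w ! 0)) p
      = (\<lambda>g. frag_sum (\<lambda>w. ?\<epsilon> (w ! 1) (tgt G g) * (w ! 0) g) p)"
  proof (subst tensor_eval_frag_sum)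
    show "conv (?e (?\<epsilon> (w ! 1))) (w ! 0) \<in> Cc" if "w \<in> keys p" for w
      by (intro Cc_unit_left fibre_sum_Cobj t P that)
  qed (simp only: convolution_unit_left)
  then show "tensor_eval \<H> (\<lambda>w. conv (?e (?\<epsilon> (w ! 1))) (w ! 0)) p = u"
    by (simp only: coproduct_counit(2)[OF p t u])
qed

lemma right_bialgebroid_convolution:
  "right_bialgebroid \<H> \<A> (unit_ext) (unit_ext)
    (coproduct (src G)) (fibre_sum (src G))"
proof (intro right_bialgebroid.intro right_bialgebroid_axioms.intro convolution_complex_algebra
    base_complex_algebra unit_extension_hom unit_extension_opposite_hom coproduct_hom_balancing,
    unfold right_balancing_eq convolution_algebra_simps base_algebra_simps)
  let ?\<Delta> = "coproduct (src G)" and ?\<epsilon> = "fibre_sum (src G)" and ?e = "unit_ext"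
    and ?class = "tensor_class \<H> [fibre_balancing (src G)]"
  note s = fibre_map_src
  show "conv (?e a) (?e b) = conv (?e b) (?e a)" for a b
    by (rule unit_extension_commute)
  show "coassociative \<H> [fibre_balancing (src G), fibre_balancing (src G)] ?\<Delta> ?\<Delta> ?\<Delta> ?\<Delta>"
    by (rule coproduct_coassociative[OF s s])
  show "?\<Delta> (?e (\<lambda>x. 1)) = ?class (frag_of [?e (\<lambda>x. 1), ?e (\<lambda>x. 1)])"
    by (rule coproduct_unit[OF s])
  show "?\<epsilon> (?e (\<lambda>x. 1)) = (\<lambda>x. 1)" by (rule fibre_sum_unit[OF s])
  fix u assume u: "u \<in> Cc"
  show "?\<epsilon> u \<in> Cobj" by (rule fibre_sum_Cobj[OF u s])
  show "?\<epsilon> (conv (conv u (?e a)) (?e b)) = (\<lambda>x. a x * ?\<epsilon> u x * b x)"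
    if "a \<in> Cobj" "b \<in> Cobj" for a b
  proof -
    have "conv (conv u (?e a)) (?e b) = (\<lambda>g. a (src G g) * b (src G g) * u g)"
      by (simp add: convolution_unit_right mult_ac)
    then show ?thesis using fibre_sum_mult[OF u s, of "\<lambda>x. a x * b x"] by (simp add: mult_ac)
  qed
  {
    fix v assume v: "v \<in> Cc"
    show "?\<epsilon> (\<lambda>g. u g + v g) = (\<lambda>x. ?\<epsilon> u x + ?\<epsilon> v x)" by (rule fibre_sum_add[OF u v s])
    show "?\<epsilon> (conv (?e (?\<epsilon> u)) v) = ?\<epsilon> (conv u v)"
      unfolding convolution_unit_left by (rule fibre_sum_convolution_src[OF u v])
    then show "?\<epsilon> (conv (?e (?\<epsilon> u)) v) = ?\<epsilon> (conv u v)" .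
  }
  fix p assume p: "p \<in> ?\<Delta> u"
  note P = coproductD(3,4)[OF p s u]
  show "?\<Delta> (conv u v) = ?class (frag_extend (\<lambda>w. frag_extend (\<lambda>w'.
      frag_of [conv (w ! 0) (w' ! 0), conv (w ! 1) (w' ! 1)]) q) p)"
    if "v \<in> Cc" "q \<in> ?\<Delta> v" for v q
    by (rule coproduct_mult[OF s u p that])
  show "?\<Delta> (conv (conv u (?e a)) (?e b)) = ?class (frag_extend (\<lambda>w.
      frag_of [conv (w ! 0) (?e a), conv (w ! 1) (?e b)]) p)"
    if ab: "a \<in> Cobj" "b \<in> Cobj" for a b
  proof (rule coproduct_rescaled[OF s u p, where c = "\<lambda>g g'. a (src G g) * b (src G g')"])
    show "conv (conv u (?e a)) (?e b) \<in> Cc" by (intro Cc_unit_right ab u)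
    show "conv (w ! 0) (?e a) \<in> Cc" "conv (w ! 1) (?e b) \<in> Cc"
      if "w \<in> keys p" for w
      by (intro Cc_unit_right ab P that)+
  qed (simp_all add: convolution_unit_right)
  show "?class (frag_extend (\<lambda>w. frag_of [conv (?e a) (w ! 0), w ! 1]) p) =
      ?class (frag_extend (\<lambda>w. frag_of [w ! 0, conv (?e a) (w ! 1)]) p)"
    if a: "a \<in> Cobj" for a
  proof (rule coproduct_takeuchi[OF s u p, where c = "\<lambda>g. a (tgt G g)"])
    show "conv (?e a) (w ! 0) \<in> Cc" "conv (?e a) (w ! 1) \<in> Cc"
      if "w \<in> keys p" for w
      by (intro Cc_unit_left a P that)+
  qed (simp_all add: convolution_unit_left)
  have "tensor_eval \<H> (\<lambda>w. conv (w ! 1) (?e (?\<epsilon> (w ! 0)))) p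
      = (\<lambda>g. frag_sum (\<lambda>w. ?\<epsilon> (w ! 0) (src G g) * (w ! 1) g) p)"
  proof (subst tensor_eval_frag_sum)
    show "conv (w ! 1) (?e (?\<epsilon> (w ! 0))) \<in> Cc" if "w \<in> keys p" for w
      by (intro Cc_unit_right fibre_sum_Cobj s P that)
  qed (simp only: convolution_unit_right mult.commute)
  then show "tensor_eval \<H> (\<lambda>w. conv (w ! 1) (?e (?\<epsilon> (w ! 0)))) p = u"
    by (simp only: coproduct_counit(1)[OF p s u])
  have "tensor_eval \<H> (\<lambda>w. conv (w ! 0) (?e (?\<epsilon> (w ! 1)))) p
      = (\<lambda>g. frag_sum (\<lambda>w. ?\<epsilon> (w ! 1) (src G g) * (w ! 0) g) p)"
  proof (subst tensor_eval_frag_sum)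
    show "conv (w ! 0) (?e (?\<epsilon> (w ! 1))) \<in> Cc" if "w \<in> keys p" for w
      by (intro Cc_unit_right fibre_sum_Cobj s P that)
  qed (simp only: convolution_unit_right mult.commute)
  then show "tensor_eval \<H> (\<lambda>w. conv (w ! 0) (?e (?\<epsilon> (w ! 1)))) p = u"
    by (simp only: coproduct_counit(2)[OF p s u])
qed

lemma convolution_hopf_simps:
  "total_alg (convolution_hopf_algebroid G) = \<H>"
  "left_base (convolution_hopf_algebroid G) = \<A>"
  "left_source (convolution_hopf_algebroid G) = unit_ext"
  "left_target (convolution_hopf_algebroid G) = unit_ext"
  "left_coproduct (convolution_hopf_algebroid G) = coproduct (tgt G)"
  "left_counit (convolution_hopf_algebroid G) = fibre_sum (tgt G)"
  "right_base (convolution_hopf_algebroid G) = \<A>"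
  "right_source (convolution_hopf_algebroid G) = unit_ext"
  "right_target (convolution_hopf_algebroid G) = unit_ext"
  "right_coproduct (convolution_hopf_algebroid G) = coproduct (src G)"
  "right_counit (convolution_hopf_algebroid G) = fibre_sum (src G)"
  "antipode (convolution_hopf_algebroid G) = (\<lambda>u g. u (\<iota> g))"
  by (simp_all add: convolution_hopf_algebroid_def left_balancing_eq right_balancing_eq fibre_sum_def fun_eq_iff)

lemma hopf_algebroid_convolution: "hopf_algebroid (convolution_hopf_algebroid G)"
proof (intro hopf_algebroid.intro, unfold convolution_hopf_simps left_balancing_eq right_balancing_eq
    convolution_algebra_simps)
  let ?e = "unit_ext"
  show "left_bialgebroid \<H> \<A> ?e ?e (coproduct (tgt G)) (fibre_sum (tgt G))"
    by (rule left_bialgebroid_convolution)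
  show "right_bialgebroid \<H> \<A> ?e ?e (coproduct (src G)) (fibre_sum (src G))"
    by (rule right_bialgebroid_convolution)
  show "?e (fibre_sum (tgt G) (?e a)) = ?e a" "?e (fibre_sum (src G) (?e a)) = ?e a"
    "?e (fibre_sum (tgt G) (?e a)) = ?e a" "?e (fibre_sum (src G) (?e a)) = ?e a" for a
    by (simp_all add: fibre_sum_unit)
  show "coassociative \<H> [fibre_balancing (tgt G), fibre_balancing (src G)]
      (coproduct (tgt G)) (coproduct (src G)) (coproduct (src G)) (coproduct (tgt G))"
    by (rule coproduct_coassociative) simp_all
  show "coassociative \<H> [fibre_balancing (src G), fibre_balancing (tgt G)]
      (coproduct (src G)) (coproduct (tgt G)) (coproduct (tgt G)) (coproduct (src G))"
    by (rule coproduct_coassociative) simp_all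
  show "bij_betw (\<lambda>u g. u (\<iota> g)) Cc Cc"
    by (rule bij_betw_byWitness[where f' = "\<lambda>u g. u (\<iota> g)"]) (auto simp: Cc_ginv)
  show "(\<lambda>g. u (\<iota> g) + v (\<iota> g)) = (\<lambda>g. u (\<iota> g) + v (\<iota> g))" for u v :: "'g \<Rightarrow> complex" ..
  show "(\<lambda>g. c * u (\<iota> g)) = (\<lambda>g. c * u (\<iota> g))" for c and u :: "'g \<Rightarrow> complex" ..
  show "(\<lambda>g. conv (conv (?e a) u) (?e b) (\<iota> g)) =
      conv (conv (?e b) (\<lambda>g. u (\<iota> g))) (?e a)" for a b u
    by (simp add: convolution_unit_left convolution_unit_right src_ginv tgt_ginv mult_ac)
  fix u p assume u: "u \<in> Cc"
  show "tensor_eval \<H> (\<lambda>w. conv (\<lambda>g. (w ! 0) (\<iota> g)) (w ! 1)) p =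
      ?e (fibre_sum (src G) u)" if p: "p \<in> coproduct (tgt G) u"
    using coproductD(3,4)[OF p fibre_map_tgt u]
    by (subst tensor_eval_frag_sum) (auto intro: convolution_Cc Cc_ginv simp: coproduct_antipode_tgt[OF p u, simplified])
  show "tensor_eval \<H> (\<lambda>w. conv (w ! 0) (\<lambda>g. (w ! 1) (\<iota> g))) p =
      ?e (fibre_sum (tgt G) u)" if p: "p \<in> coproduct (src G) u"
    using coproductD(3,4)[OF p fibre_map_src u]
    by (subst tensor_eval_frag_sum) (auto intro: convolution_Cc Cc_ginv simp: coproduct_antipode_src[OF p u, simplified])
qed

text \<open>Conjugation commutes with the evaluation, and inversion turns pairs with equal source into pairs
  with equal target.\<close>

lemma coproduct_star:
  assumes u: "u \<in> Cc" and p: "p \<in> coproduct (tgt G) u"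
  shows "coproduct (src G) (convolution_star G u) = tensor_class \<H> [fibre_balancing (src G)]
    (frag_extend (\<lambda>w. frag_of [convolution_star G (w ! 0), convolution_star G (w ! 1)]) p)"
proof (rule coproduct_eqI[OF fibre_map_src])
  note P = coproductD[OF p fibre_map_tgt u]
  have star: "convolution_star G v \<in> Cc" if "v \<in> Cc" for v
    unfolding convolution_star_eq by (rule Cc_cnj[OF Cc_ginv[OF that]])
  show "convolution_star G u \<in> Cc" by (rule star[OF u])
  show "keys (frag_extend (\<lambda>w. frag_of [convolution_star G (w ! 0), convolution_star G (w ! 1)]) p)
      \<subseteq> words [src G]"
    by (rule frag_extend_words) (rule star, rule P, assumption)+
  fix g g' assume "src G g = src G g'"
  then have "tgt G (\<iota> g) = tgt G (\<iota> g')" by (simp add: tgt_ginv)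
  from P(2)[OF this] have "cnj (frag_sum (\<lambda>w. (w ! 0) (\<iota> g) * (w ! 1) (\<iota> g')) p) = cnj (delta u (\<iota> g) (\<iota> g'))"
    by (rule arg_cong)
  moreover have "\<iota> g = \<iota> g' \<longleftrightarrow> g = g'" by (metis ginv_ginv)
  ultimately show "tensor_function (frag_extend (\<lambda>w. frag_of [convolution_star G (w ! 0), convolution_star G (w ! 1)]) p) g g'
      = delta (convolution_star G u) g g'"
    unfolding tensor_function_extend tensor_function_of convolution_star_eq
    by (simp add: frag_sum_def delta_def cnj_sum)
qed

lemma unit_extension_star: "unit_ext (function_star f) = convolution_star G (unit_ext f)"
  by (rule ext) (simp add: convolution_star_eq unit_extension_ginv, simp add: unit_extension_def function_star_def)

lemma hopf_star_algebroid_convolution: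
  "hopf_star_algebroid (convolution_hopf_algebroid G) (convolution_star G) function_star function_star"
proof (intro hopf_star_algebroid.intro hopf_algebroid_convolution hopf_star_algebroid_axioms.intro,
    unfold convolution_hopf_simps right_balancing_eq)
  show "star_algebra \<H> (convolution_star G)" by (rule convolution_star_algebra)
  show "star_algebra \<A> function_star" by (rule base_star_algebra)
  then show "star_algebra \<A> function_star" .
  show "unit_ext (function_star f) = convolution_star G (unit_ext f)" for f
    by (rule unit_extension_star)
  then show "unit_ext (function_star f) = convolution_star G (unit_ext f)" for f .
  show "fibre_sum (tgt G) (unit_ext (function_star f)) = function_star (fibre_sum (tgt G) (unit_ext f))"
    "fibre_sum (src G) (unit_ext (function_star f)) = function_star (fibre_sum (src G) (unit_ext f))" for f
    by (simp_all add: fibre_sum_unit)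
  show "coproduct (src G) (convolution_star G u) = tensor_class \<H> [fibre_balancing (src G)]
      (frag_extend (\<lambda>w. frag_of [convolution_star G (w ! 0), convolution_star G (w ! 1)]) p)"
    if "u \<in> Cc" "p \<in> coproduct (tgt G) u" for u p
    by (rule coproduct_star[OF that])
qed

end

theorem proposition3p2p4:
  fixes G :: "('g::t2_space, 'x::t2_space, 'e::real_inner) smooth_groupoid"
  assumes "hausdorff_etale_groupoid G"
    and "compact (UNIV :: 'x set)"
  shows "hopf_star_algebroid (convolution_hopf_algebroid G)
           (convolution_star G) function_star function_star"
proof -
  interpret compact_etale_groupoid G
    using assms by (simp add: compact_etale_groupoid_def compact_etale_groupoid_axioms_def)
  show ?thesis by (rule hopf_star_algebroid_convolution)
qed

end
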